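(* Fix real numbers $\alpha>1$ and $L>0$, and let $X=(\mathbb{R}^2)^3$. For each $\gamma>0$ there exist a non-resonant vector $\omega\in\mathbb{R}^3$, a point $z\in X$ with $z\neq 0$, and a diffeomorphism $\Psi\in\mathcal{U}^{\alpha,L}$ such that $\|\Psi-\mathrm{Id}\|_{\alpha,L}\le\gamma$ and the map $T=\Psi\circ S_\omega$ satisfies $T^n(z)\to 0$ as $n\to+\infty$.
   Context: $X=(\mathbb{R}^2)^3=\mathbb{R}^6$ carries the canonical symplectic form $\sum_{i=1}^3 dx_i\wedge dy_i$, where $s=(s_1,s_2,s_3)\in X$ and $s_i=(x_i,y_i)\in\mathbb{R}^2$. For $\beta\in\mathbb{R}$, $R_\beta:\mathbb{R}^2\to\mathbb{R}^2$ is the rigid rotation around the origin with rotation number $\beta$ (angle $2\pi\beta$). For $\omega=(\omega_1,\omega_2,\omega_3)\in\mathbb{R}^3$, $S_\omega:X\to X$ is $S_\omega(s_1,s_2,s_3)=(R_{\omega_1}(s_1),R_{\omega_2}(s_2),R_{\omega_3}(s_3))$. The vector $\omega$ is non-resonant if $(k,\omega)\notin\mathbb{Z}$ for every $k\in\mathbb{Z}^3\setminus\{0\}$, where $(\cdot,\cdot)$ is the Euclidean scalar product. Gevrey spaces ($\mathbb{N}=\{0,1,2,\dots\}$): for $N\ge1$, $G^{\alpha,L}(\mathbb{R}^N)$ is the set of real-valued $f\in C^\infty(\mathbb{R}^N)$ with $\|f\|_{\alpha,L}:=\sum_{\ell\in\mathbb{N}^N}\frac{L^{|\ell|\alpha}}{\ell!^\alpha}\|\partial^\ell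 f\|_{C^0(\mathbb{R}^N)}<\infty$, where $|\ell|=\ell_1+\dots+\ell_N$, $\ell!=\ell_1!\cdots\ell_N!$. $G^{\alpha,L}(\mathbb{R}^N,\mathbb{R}^M)$ is the set of $F=(F_{[1]},\dots,F_{[M]})\in C^\infty(\mathbb{R}^N,\mathbb{R}^M)$ with $\|F\|_{\alpha,L}:=\|F_{[1]}\|_{\alpha,L}+\dots+\|F_{[M]}\|_{\alpha,L}<\infty$. $\mathcal{U}^{\alpha,L}$ is the set of all symplectic diffeomorphisms $\Psi$ of $X=\mathbb{R}^6$ of the form $\Psi=\mathrm{Id}+F$ with $F\in G^{\alpha,L}(\mathbb{R}^6,\mathbb{R}^6)$ that fix the origin and are $C^\infty$-tangent to $\mathrm{Id}$ at the origin (all partial derivatives of $F$, of every order including $0$, vanish at $0$). *)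

theory Defs
  imports "HOL-Analysis.Analysis"
begin

text \<open>
  Coordinates on a Euclidean space are taken with respect to \<^const>\<open>Basis\<close>. The expression below is
  the partial derivative at those points where \<open>f\<close> is differentiable, and it is used for smooth
  functions only.
\<close>

definition partial_deriv ::
    "'a::euclidean_space \<Rightarrow> ('a \<Rightarrow> 'b::real_normed_vector) \<Rightarrow> 'a \<Rightarrow> 'b" where
  "partial_deriv v f x = frechet_derivative f (at x) v"

primrec C_k :: "nat \<Rightarrow> ('a::euclidean_space \<Rightarrow> 'b::real_normed_vector) \<Rightarrow> bool" where
  "C_k 0 f \<longleftrightarrow> continuous_on UNIV f"
| "C_k (Suc k) f \<longleftrightarrow> f differentiable_on UNIV \<and> (\<forall>v\<in>Basis. C_k k (partial_deriv v f))"

definition smooth :: "('a::euclidean_space \<Rightarrow> 'b::real_normed_vector) \<Rightarrow> bool" where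
  "smooth f \<longleftrightarrow> (\<forall>k. C_k k f)"

text \<open>
  A multi-index assigns an exponent to each basis vector. To have a unique function for each
  multi-index, the exponents are required to be zero off the basis.
\<close>

definition multi_indices :: "('a::euclidean_space \<Rightarrow> nat) set" where
  "multi_indices = {l. \<forall>v. v \<notin> Basis \<longrightarrow> l v = 0}"

text \<open>
  The basis carries no order, so some order of differentiation is chosen. For smooth \<open>f\<close>
  the result does not depend on it, because mixed partial derivatives commute.
\<close>

definition mderiv ::
    "('a::euclidean_space \<Rightarrow> nat) \<Rightarrow> ('a \<Rightarrow> 'b::real_normed_vector) \<Rightarrow> 'a \<Rightarrow> 'b" where
  "mderiv l f = foldr partial_deriv (SOME vs. \<forall>v. count_list vs v = l v) f"

definition C0_norm :: "('a \<Rightarrow> real) \<Rightarrow> ennreal" where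
  "C0_norm f = (SUP x. ennreal \<bar>f x\<bar>)"

definition gevrey_norm :: "real \<Rightarrow> real \<Rightarrow> ('a::euclidean_space \<Rightarrow> real) \<Rightarrow> ennreal" where
  "gevrey_norm \<alpha> L f =
     (\<Sum>\<^sub>\<infinity>l\<in>multi_indices.
        ennreal (L powr (real (\<Sum>v\<in>Basis. l v) * \<alpha>) / (\<Prod>v\<in>Basis. fact (l v)) powr \<alpha>)
          * C0_norm (mderiv l f))"

definition gevrey_norm_vec ::
    "real \<Rightarrow> real \<Rightarrow> ('a::euclidean_space \<Rightarrow> 'b::euclidean_space) \<Rightarrow> ennreal" where
  "gevrey_norm_vec \<alpha> L F = (\<Sum>b\<in>Basis. gevrey_norm \<alpha> L (\<lambda>x. F x \<bullet> b))"

definition gevrey_space ::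
    "real \<Rightarrow> real \<Rightarrow> ('a::euclidean_space \<Rightarrow> 'b::euclidean_space) set" where
  "gevrey_space \<alpha> L = {F. smooth F \<and> gevrey_norm_vec \<alpha> L F < \<infinity>}"

text \<open>For \<open>s\<close> in the phase space, \<open>x\<^sub>i\<close> is \<open>s $ i $ 1\<close> and \<open>y\<^sub>i\<close> is \<open>s $ i $ 2\<close>.\<close>

type_synonym phase = "real ^ 2 ^ 3"

definition symplectic_form :: "phase \<Rightarrow> phase \<Rightarrow> real" where
  "symplectic_form u v = (\<Sum>i\<in>UNIV. u $ i $ 1 * v $ i $ 2 - u $ i $ 2 * v $ i $ 1)"

definition diffeomorphism :: "('a::euclidean_space \<Rightarrow> 'a) \<Rightarrow> bool" where
  "diffeomorphism \<Psi> \<longleftrightarrow> bij \<Psi> \<and> smooth \<Psi> \<and> smooth (inv \<Psi>)"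

definition symplectic :: "(phase \<Rightarrow> phase) \<Rightarrow> bool" where
  "symplectic \<Psi> \<longleftrightarrow>
     (\<forall>s u v. symplectic_form (frechet_derivative \<Psi> (at s) u) (frechet_derivative \<Psi> (at s) v)
              = symplectic_form u v)"

definition gevrey_symplectic :: "real \<Rightarrow> real \<Rightarrow> (phase \<Rightarrow> phase) set" where
  "gevrey_symplectic \<alpha> L =
     {\<Psi>. diffeomorphism \<Psi> \<and> symplectic \<Psi> \<and>
         (\<lambda>s. \<Psi> s - s) \<in> gevrey_space \<alpha> L \<and>
         \<Psi> 0 = 0 \<and>
         (\<forall>l\<in>multi_indices. mderiv l (\<lambda>s. \<Psi> s - s) 0 = 0)}"

definition rotation :: "real \<Rightarrow> real ^ 2 \<Rightarrow> real ^ 2" where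
  "rotation \<beta> p =
     vector [cos (2 * pi * \<beta>) * p $ 1 - sin (2 * pi * \<beta>) * p $ 2,
             sin (2 * pi * \<beta>) * p $ 1 + cos (2 * pi * \<beta>) * p $ 2]"

definition product_rotation :: "real ^ 3 \<Rightarrow> phase \<Rightarrow> phase" where
  "product_rotation \<omega> s = (\<chi> i. rotation (\<omega> $ i) (s $ i))"

definition non_resonant :: "real ^ 3 \<Rightarrow> bool" where
  "non_resonant \<omega> \<longleftrightarrow> (\<forall>k::int ^ 3. k \<noteq> 0 \<longrightarrow> (\<chi> i. real_of_int (k $ i)) \<bullet> \<omega> \<notin> \<int>)"

end

theory Submission
  imports Defs "HOL-Complex_Analysis.Cauchy_Integral_Formula"
begin

text \<open>
  The diffeomorphism is a single shear. Take \<open>\<Psi>(x, y) = (x, y - \<nabla>P(x))\<close> with a potential \<open>P\<close> of the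
  three positions; it is symplectic because the Hessian of \<open>P\<close> is symmetric, and it is Gevrey, close to the
  identity and infinitely tangent to it at the origin as soon as \<open>P\<close> is Gevrey, small and flat
  (\<open>shear_in_gevrey_symplectic\<close>). In complex coordinates \<open>z\<^sub>i = x\<^sub>i + \<i> y\<^sub>i\<close> the map \<open>T\<close> rotates each plane and
  then kicks the planes in the imaginary direction. The potential is a sum of pulses, and the
  frequencies and the starting point are limits of sequences that are built along with it.

  A pulse pushes one plane \<open>p\<close> and uses the next plane \<open>p + 1\<close> as a gate: its potential is a function of
  \<open>x\<^sub>p\<close> multiplied by a function of \<open>x\<^sub>p\<^sub>+\<^sub>1\<close> that vanishes, with all derivatives, unless \<open>x\<^sub>p\<^sub>+\<^sub>1\<close> is
  nearly as large as the present radius of that plane. In the current stage the frequencies are rational,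
  and their arithmetic is arranged so that the gate opens only once in a long period; at the
  openings the pushed plane has one of finitely many phases, and the force is placed at two of these,
  \<open>\<beta>\<close> and \<open>2 \<beta>\<close> (\<open>freq_timing\<close>, \<open>pulse_exists\<close>). A single kick would turn the point as well as move it.
  Since \<open>1 - 2 cos \<beta> e\<^sup>-\<^sup>i\<^sup>\<beta> + e\<^sup>-\<^sup>2\<^sup>i\<^sup>\<beta> = 0\<close>, the two kicks of a cycle together change only the radius,
  and the back reaction on the gate cancels (\<open>kick_pair\<close>, \<open>pulse_second_kick\<close>). Hence at the end of a cycle the
  orbit is again on the imaginary axes, with a smaller radius in plane \<open>p\<close>. Weak pulses suffice,
  because the number of cycles is free (\<open>stage_run\<close>).

  The three planes take turns. When plane \<open>p\<close> has been pushed, its former gate \<open>p + 1\<close> is pushed next, with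
  \<open>p + 2\<close> as a gate whose frequency is changed by a tiny \<open>1 / 2\<^sup>e\<close>. As the radius of plane \<open>p + 1\<close> shrinks, the
  old gate closes for ever, so at most two pulses act at the same time (\<open>two_pulses\<close>). Each new pulse
  and each change of frequency is so small that the finite part of the orbit obtained so far is
  almost unchanged (\<open>stage_step\<close>). Each plane loses a fixed fraction of its radius in every three
  stages, so the limit orbit tends to the origin (\<open>orb_lim_tendsto_zero\<close>); every pulse
  vanishes with all its derivatives where its gate is closed, in particular at the origin, and so does
  the sum. The exponents \<open>e\<close> grow so fast that the limit frequencies are non-resonant (\<open>non_resonant_limit\<close>).
\<close>

section \<open>Gevrey functions of one variable\<close>

text \<open>
  A function is carried together with all its derivatives: \<open>f k\<close> is the \<open>k\<close>-th derivative of \<open>f 0\<close>.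
\<close>

definition gevrey_jet :: "real \<Rightarrow> real \<Rightarrow> real \<Rightarrow> (nat \<Rightarrow> real \<Rightarrow> real) \<Rightarrow> bool" where
  "gevrey_jet \<sigma> C K f \<longleftrightarrow>
     (\<forall>k x. (f k has_real_derivative f (Suc k) x) (at x)) \<and>
     (\<forall>k x. \<bar>f k x\<bar> \<le> C * K ^ k * fact k powr \<sigma>)"

lemma pow_le_exp_pow:
  fixes y :: real
  assumes "y > 0" "N \<ge> 1"
  shows "y ^ k * exp (- (1/2) * y ^ N) \<le> 2 ^ k * fact k powr (1 / real N)"
proof -
  define Y where "Y = y ^ N / 2"
  have Y: "Y \<ge> 0" using assms by (simp add: Y_def)
  have "Y ^ k / fact k \<le> exp Y"
    using sum_le_suminf[of "\<lambda>n. Y ^ n / fact n" "{k}"] Y summable_exp_generic[of Y]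
    by (simp add: exp_def divide_inverse_commute)
  then have 1: "Y ^ k \<le> fact k * exp Y"
    by (simp add: field_simps)
  have "(y ^ k) ^ N = (2 * Y) ^ k"
    by (simp add: Y_def power_mult[symmetric] mult.commute)
  also have "\<dots> \<le> 2 ^ k * fact k * exp Y"
    using 1 by (simp add: power_mult_distrib)
  finally have 2: "(y ^ k) ^ N \<le> 2 ^ k * fact k * exp Y" .
  have "y ^ k = ((y ^ k) ^ N) powr (1 / real N)"
    using assms by (simp add: powr_powr powr_realpow[symmetric])
  also have "\<dots> \<le> (2 ^ k * fact k * exp Y) powr (1 / real N)"
    using 2 assms by (intro powr_mono2) auto
  also have "\<dots> = (2 ^ k) powr (1 / real N) * fact k powr (1 / real N) * exp Y powr (1 / real N)"
    by (simp add: powr_mult)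
  also have "\<dots> \<le> 2 ^ k * fact k powr (1 / real N) * exp Y"
  proof -
    have "(2 ^ k) powr (1 / real N) \<le> (2 ^ k :: real) powr 1"
      using assms by (intro powr_mono) auto
    moreover have "exp Y powr (1 / real N) \<le> exp Y powr 1"
      using assms Y by (intro powr_mono) auto
    ultimately show ?thesis by (intro mult_mono) auto
  qed
  finally have "y ^ k \<le> 2 ^ k * fact k powr (1 / real N) * exp Y" .
  then have "y ^ k * exp (- Y) \<le> 2 ^ k * fact k powr (1 / real N) * exp Y * exp (- Y)"
    by (intro mult_right_mono) auto
  then show ?thesis by (simp add: exp_minus_inverse mult.assoc Y_def)
qed

text \<open>
  In a thin sector around the positive half-line the argument of \<open>1 / z ^ N\<close> stays small. So
  \<open>exp (- 1 / z ^ N)\<close> is flat at the origin on discs whose radius is proportional to the distance to the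
  origin, and Cauchy's inequality can be applied on them.
\<close>

lemma sector_bound:
  assumes "N \<ge> (1::nat)"
  obtains \<theta> where "0 < \<theta>" "\<theta> < 1"
    "\<And>x z. x > 0 \<Longrightarrow> cmod (z - of_real x) \<le> \<theta> * x \<Longrightarrow>
       Re (inverse z ^ N) \<ge> (1/2) * (1/x) ^ N"
proof -
  have "((\<lambda>\<xi>::complex. inverse (1 + \<xi>) ^ N) \<longlongrightarrow> inverse (1 + 0) ^ N) (at 0)"
    by (intro tendsto_intros) auto
  then have "\<forall>\<^sub>F \<xi> in at 0. dist (inverse (1 + \<xi>) ^ N) (1::complex) < 1/2"
    by (intro tendstoD) auto
  then obtain d where d: "d > 0" "\<And>\<xi>::complex. \<xi> \<noteq> 0 \<Longrightarrow> dist \<xi> 0 < d \<Longrightarrow> dist (inverse (1 + \<xi>) ^ N) 1 < 1/2"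
    unfolding eventually_at by auto
  define \<theta> where "\<theta> = min (d/2) (1/2)"
  show ?thesis
  proof (rule that)
    show "0 < \<theta>" "\<theta> < 1" using d by (auto simp: \<theta>_def)
    fix x :: real and z :: complex assume x: "x > 0" and z: "cmod (z - of_real x) \<le> \<theta> * x"
    define \<xi> where "\<xi> = (z - of_real x) / of_real x"
    have "cmod \<xi> \<le> \<theta>" using x z by (simp add: \<xi>_def norm_divide field_simps)
    then have "dist \<xi> 0 < d" using d by (auto simp: \<theta>_def)
    then have "dist (inverse (1 + \<xi>) ^ N) 1 < 1/2" using d by (cases "\<xi> = 0") auto
    then have "cmod (inverse (1 + \<xi>) ^ N - 1) < 1/2" by (simp add: dist_norm)
    then have "Re (inverse (1 + \<xi>) ^ N) \<ge> 1/2"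
      using abs_Re_le_cmod[of "inverse (1 + \<xi>) ^ N - 1"] by auto
    moreover have "z = of_real x * (1 + \<xi>)" using x by (simp add: \<xi>_def field_simps)
    then have "inverse z ^ N = of_real ((1/x) ^ N) * inverse (1 + \<xi>) ^ N"
      by (simp add: power_mult_distrib divide_inverse)
    then have "Re (inverse z ^ N) = (1/x) ^ N * Re (inverse (1 + \<xi>) ^ N)"
      by (simp only: Re_complex_of_real Re_divide_of_real complex_scaleR scaleR_conv_of_real[symmetric]) simp
    ultimately show "Re (inverse z ^ N) \<ge> (1/2) * (1/x) ^ N"
      using x by (simp add: mult.commute mult_right_mono field_simps)
  qed
qed

text \<open>
  Cauchy's inequality on the disc of radius \<open>\<theta> x\<close> bounds the \<open>k\<close>-th derivative at \<open>x\<close> by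
  \<open>k! (\<theta> x) ^ (- k)\<close> times the flat factor, and the flat factor absorbs \<open>x ^ (- k)\<close> at the price of
  \<open>k! powr (1 / N)\<close>. The entire function \<open>F\<close> is left arbitrary so that the gate below and its
  reciprocal both come out of the same flat function, with bounds proportional to \<open>M\<close>.
\<close>

lemma flat_gevrey_jet:
  assumes "N \<ge> (1::nat)"
  obtains K where "K > 0"
    "\<And>F M. F holomorphic_on UNIV \<Longrightarrow> M \<ge> 0 \<Longrightarrow> (\<And>w. cmod w \<le> 1 \<Longrightarrow> cmod (F w) \<le> M * cmod w) \<Longrightarrow>
       \<exists>f. gevrey_jet (1 + 1 / real N) M K f \<and>
           (\<forall>x>0. f 0 x = Re (F (of_real (exp (- ((1/x) ^ N)))))) \<and> (\<forall>k. \<forall>x\<le>0. f k x = 0)"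
proof -
  obtain \<theta> where \<theta>: "0 < \<theta>" "\<theta> < 1"
    "\<And>x z. x > 0 \<Longrightarrow> cmod (z - of_real x) \<le> \<theta> * x \<Longrightarrow> Re (inverse z ^ N) \<ge> (1/2) * (1/x) ^ N"
    using sector_bound[OF assms] by blast
  define K where "K = 2 / \<theta>"
  show ?thesis
  proof (rule that)
    show "K > 0" using \<theta> by (simp add: K_def)
    fix F M assume F: "F holomorphic_on UNIV" and M: "M \<ge> 0"
      and FM: "\<And>w. cmod w \<le> 1 \<Longrightarrow> cmod (F w) \<le> M * cmod w"
    define G where "G = (\<lambda>z. F (exp (- (inverse z ^ N))))"
    have holE: "(\<lambda>z. exp (- (inverse z ^ N))) holomorphic_on (-{0})"
      by (intro holomorphic_intros) auto
    have holG: "G holomorphic_on (-{0})"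
      using holomorphic_on_compose_gen[OF holE F] by (simp add: o_def G_def)
    have op: "open (- {0::complex})" by auto
    have holk: "(deriv ^^ k) G holomorphic_on (-{0})" for k
      using holG op by (rule holomorphic_higher_deriv)
    define f where "f = (\<lambda>k x. if x > 0 then Re ((deriv ^^ k) G (of_real x)) else 0)"
    have bd: "\<bar>f k x\<bar> \<le> fact k * (M * exp (- (1/2) * (1/x)^N)) / (\<theta> * x) ^ k" if "x > 0" for k x
    proof -
      have sub: "cball (of_real x) (\<theta> * x) \<subseteq> - {0::complex}"
      proof
        fix z assume "z \<in> cball (complex_of_real x) (\<theta> * x)"
        then have "cmod (of_real x - z) \<le> \<theta> * x" by (simp add: dist_norm)
        moreover have "\<theta> * x < x" using \<theta> that by auto
        ultimately show "z \<in> - {0}" using that by auto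
      qed
      have "cmod ((deriv ^^ k) G (of_real x)) \<le> fact k * (M * exp (- (1/2) * (1/x)^N)) / (\<theta> * x) ^ k"
      proof (rule Cauchy_inequality)
        show "G holomorphic_on ball (complex_of_real x) (\<theta> * x)"
          using holG sub by (meson ball_subset_cball holomorphic_on_subset order_trans)
        show "continuous_on (cball (complex_of_real x) (\<theta> * x)) G"
          using holG sub by (meson holomorphic_on_imp_continuous_on holomorphic_on_subset)
        show "0 < \<theta> * x" using \<theta> that by simp
        fix z assume "cmod (complex_of_real x - z) = \<theta> * x"
        then have "cmod (z - complex_of_real x) \<le> \<theta> * x" by (simp add: norm_minus_commute)
        then have R: "Re (inverse z ^ N) \<ge> (1/2) * (1/x) ^ N" using \<theta>(3) that by blast
        have E: "cmod (exp (- (inverse z ^ N))) \<le> exp (- (1/2) * (1/x)^N)"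
          using R by (simp add: norm_exp_eq_Re)
        also have "\<dots> \<le> 1" using that by simp
        finally have "cmod (G z) \<le> M * cmod (exp (- (inverse z ^ N)))"
          unfolding G_def by (rule FM)
        also have "\<dots> \<le> M * exp (- (1/2) * (1/x)^N)" using E M by (rule mult_left_mono)
        finally show "cmod (G z) \<le> M * exp (- (1/2) * (1/x)^N)" .
      qed
      then show ?thesis
        using abs_Re_le_cmod[of "(deriv ^^ k) G (of_real x)"] that by (simp add: f_def)
    qed
    have bd2: "\<bar>f k x\<bar> \<le> fact k * M / \<theta> ^ k * ((1/x) ^ k * exp (- (1/2) * (1/x)^N))" if "x > 0" for k x
      using bd[OF that, of k] by (simp add: power_mult_distrib power_divide mult_ac)
    have glob: "\<bar>f k x\<bar> \<le> M * K ^ k * fact k powr (1 + 1 / real N)" for k x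
    proof (cases "x > 0")
      case True
      have "\<bar>f k x\<bar> \<le> fact k * M / \<theta> ^ k * ((1/x) ^ k * exp (- (1/2) * (1/x)^N))" by (rule bd2[OF True])
      also have "\<dots> \<le> fact k * M / \<theta> ^ k * (2 ^ k * fact k powr (1 / real N))"
        using \<theta> M True assms by (intro mult_left_mono pow_le_exp_pow) auto
      also have "\<dots> = M * K ^ k * (fact k powr 1 * fact k powr (1 / real N))"
        by (simp add: K_def power_divide)
      also have "\<dots> = M * K ^ k * fact k powr (1 + 1 / real N)" by (simp add: powr_add)
      finally show ?thesis .
    next
      case False
      then show ?thesis using M \<open>K > 0\<close> by (simp add: f_def)
    qed
    have quad: "\<exists>c. \<forall>x. \<bar>f k x\<bar> \<le> c * x\<^sup>2" for k
    proof -
      define c where "c = fact k * M / \<theta> ^ k * (2 ^ (k+2) * fact (k+2) powr (1 / real N))"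
      have "\<bar>f k x\<bar> \<le> c * x\<^sup>2" for x
      proof (cases "x > 0")
        case True
        have "(1/x) ^ (k+2) * exp (- (1/2) * (1/x)^N) \<le> 2 ^ (k+2) * fact (k+2) powr (1 / real N)"
          using True assms by (intro pow_le_exp_pow) auto
        then have "(1/x) ^ (k+2) * exp (- (1/2) * (1/x)^N) * x\<^sup>2 \<le> 2 ^ (k+2) * fact (k+2) powr (1 / real N) * x\<^sup>2"
          by (rule mult_right_mono) auto
        moreover have "(1/x) ^ (k+2) * exp (- (1/2) * (1/x)^N) * x\<^sup>2 = (1/x) ^ k * exp (- (1/2) * (1/x)^N)"
          using True by (simp add: power_add power2_eq_square field_simps)
        ultimately have "(1/x) ^ k * exp (- (1/2) * (1/x)^N) \<le> 2 ^ (k+2) * fact (k+2) powr (1 / real N) * x\<^sup>2" by simp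
        then have "fact k * M / \<theta> ^ k * ((1/x) ^ k * exp (- (1/2) * (1/x)^N)) \<le> fact k * M / \<theta> ^ k * (2 ^ (k+2) * fact (k+2) powr (1 / real N) * x\<^sup>2)"
          using \<theta> M by (intro mult_left_mono) auto
        then show ?thesis using bd2[OF True, of k] by (simp add: c_def mult.assoc)
      next
        case False
        then show ?thesis using M \<theta> by (simp add: f_def c_def)
      qed
      then show ?thesis by blast
    qed
    have der: "(f k has_real_derivative f (Suc k) x) (at x)" for k x
    proof -
      consider "x > 0" | "x < 0" | "x = 0" by linarith
      then show ?thesis
      proof cases
        case 1
        have "((deriv ^^ k) G has_field_derivative deriv ((deriv ^^ k) G) (of_real x)) (at (of_real x))"
          using holomorphic_derivI[OF holk op] 1 by auto
        then have "((\<lambda>t. (deriv ^^ k) G (of_real t)) has_vector_derivative deriv ((deriv ^^ k) G) (of_real x)) (at x)"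
          by (rule has_vector_derivative_real_field)
        then have "((\<lambda>t. Re ((deriv ^^ k) G (of_real t))) has_vector_derivative Re (deriv ((deriv ^^ k) G) (of_real x))) (at x)"
          by (rule bounded_linear.has_vector_derivative[OF bounded_linear_Re])
        then have "((\<lambda>t. Re ((deriv ^^ k) G (of_real t))) has_real_derivative f (Suc k) x) (at x)"
          using 1 by (simp add: has_real_derivative_iff_has_vector_derivative f_def)
        moreover have "\<forall>\<^sub>F t in nhds x. f k t = Re ((deriv ^^ k) G (of_real t))"
          using eventually_nhds_in_open[of "{0<..}" x] 1 by (auto simp: f_def elim!: eventually_mono)
        ultimately show ?thesis by (subst DERIV_cong_ev[OF refl _ refl])
      next
        case 2
        have "((\<lambda>t. 0) has_real_derivative f (Suc k) x) (at x)" using 2 by (simp add: f_def)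
        moreover have "\<forall>\<^sub>F t in nhds x. f k t = 0"
          using eventually_nhds_in_open[of "{..<0}" x] 2 by (auto simp: f_def elim!: eventually_mono)
        ultimately show ?thesis by (subst DERIV_cong_ev[OF refl _ refl])
      next
        case 3
        obtain c where c: "\<And>x. \<bar>f k x\<bar> \<le> c * x\<^sup>2" using quad by blast
        have "((\<lambda>h. f k h / h) \<longlongrightarrow> 0) (at 0)"
        proof (rule Lim_null_comparison)
          show "\<forall>\<^sub>F h in at 0. norm (f k h / h) \<le> c * \<bar>h\<bar>"
          proof (rule eventually_at_ball'[THEN eventually_mono, of 1])
            fix h :: real assume "h \<in> ball 0 1 \<and> h \<noteq> 0 \<and> h \<in> UNIV"
            then show "norm (f k h / h) \<le> c * \<bar>h\<bar>"
              using c[of h] by (auto simp: field_simps power2_eq_square abs_if split: if_splits)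
          qed auto
          show "((\<lambda>h. c * \<bar>h\<bar>) \<longlongrightarrow> 0) (at 0)" by (auto intro!: tendsto_eq_intros)
        qed
        moreover have "f k 0 = 0" "f (Suc k) 0 = 0" by (auto simp: f_def)
        ultimately show ?thesis using 3 by (simp add: DERIV_def)
      qed
    qed
    have val: "f 0 x = Re (F (of_real (exp (- ((1/x) ^ N)))))" if "x > 0" for x
      using that by (simp add: f_def G_def exp_of_real[symmetric] inverse_eq_divide of_real_power)
    show "\<exists>f. gevrey_jet (1 + 1 / real N) M K f \<and>
           (\<forall>x>0. f 0 x = Re (F (of_real (exp (- ((1/x) ^ N)))))) \<and> (\<forall>k. \<forall>x\<le>0. f k x = 0)"
      using der glob val by (intro exI[of _ f]) (auto simp: gevrey_jet_def f_def)
  qed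
qed

lemma gevrey_jet_affine:
  assumes "gevrey_jet \<sigma> C K f"
  shows "gevrey_jet \<sigma> C (K * \<bar>c\<bar>) (\<lambda>k x. c ^ k * f k (c * x + d))"
proof -
  have der: "(f k has_real_derivative f (Suc k) x) (at x)" and bd: "\<bar>f k x\<bar> \<le> C * K ^ k * fact k powr \<sigma>" for k x
    using assms by (auto simp: gevrey_jet_def)
  have "((\<lambda>x. c ^ k * f k (c * x + d)) has_real_derivative c ^ Suc k * f (Suc k) (c * x + d)) (at x)" for k x
    by (rule derivative_eq_intros DERIV_chain2[OF der] refl)+ (simp add: mult_ac)
  moreover have "\<bar>c ^ k * f k (c * x + d)\<bar> \<le> C * (K * \<bar>c\<bar>) ^ k * fact k powr \<sigma>" for k x
    using mult_left_mono[OF bd[of k "c * x + d"], of "\<bar>c\<bar> ^ k"]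
    by (simp add: abs_mult power_abs power_mult_distrib mult_ac)
  ultimately show ?thesis by (simp add: gevrey_jet_def)
qed

lemma gevrey_jet_scale:
  assumes "gevrey_jet \<sigma> C K f"
  shows "gevrey_jet \<sigma> (\<bar>c\<bar> * C) K (\<lambda>k x. c * f k x)"
proof -
  have der: "(f k has_real_derivative f (Suc k) x) (at x)" and bd: "\<bar>f k x\<bar> \<le> C * K ^ k * fact k powr \<sigma>" for k x
    using assms by (auto simp: gevrey_jet_def)
  have "\<bar>c * f k x\<bar> \<le> \<bar>c\<bar> * C * K ^ k * fact k powr \<sigma>" for k x
    using mult_left_mono[OF bd[of k x], of "\<bar>c\<bar>"] by (simp add: abs_mult mult_ac)
  then show ?thesis using der by (auto simp: gevrey_jet_def intro!: derivative_eq_intros)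
qed

lemma gevrey_jet_mono:
  assumes "gevrey_jet \<sigma> C K f" "C \<le> C'" "K \<le> K'" "0 \<le> C" "0 \<le> K"
  shows "gevrey_jet \<sigma> C' K' f"
proof -
  have "C * K ^ k * fact k powr \<sigma> \<le> C' * K' ^ k * fact k powr \<sigma>" for k
    using assms by (intro mult_right_mono mult_mono power_mono) auto
  then show ?thesis using assms(1) unfolding gevrey_jet_def by (meson order_trans)
qed

lemma gevrey_jet_diff:
  assumes "gevrey_jet \<sigma> C K f" "gevrey_jet \<sigma> C' K g"
  shows "gevrey_jet \<sigma> (C + C') K (\<lambda>k x. f k x - g k x)"
proof -
  have "\<bar>f k x - g k x\<bar> \<le> (C + C') * K ^ k * fact k powr \<sigma>" for k x
  proof -
    have "\<bar>f k x\<bar> \<le> C * K ^ k * fact k powr \<sigma>" "\<bar>g k x\<bar> \<le> C' * K ^ k * fact k powr \<sigma>"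
      using assms by (auto simp: gevrey_jet_def)
    then show ?thesis by (simp add: algebra_simps)
  qed
  then show ?thesis using assms unfolding gevrey_jet_def by (auto intro!: derivative_intros)
qed

lemma fact_powr_binomial:
  assumes "\<sigma> \<ge> (1::real)" "i \<le> k"
  shows "real (k choose i) * (fact i powr \<sigma> * fact (k - i) powr \<sigma>) \<le> fact k powr \<sigma>"
proof -
  have b: "real (k choose i) \<ge> 1" using assms(2) by (simp add: Suc_leI)
  have "real (k choose i) = real (k choose i) powr 1" using b by simp
  also have "\<dots> \<le> real (k choose i) powr \<sigma>" using b assms by (intro powr_mono) auto
  finally have "real (k choose i) * (fact i powr \<sigma> * fact (k - i) powr \<sigma>)
      \<le> real (k choose i) powr \<sigma> * (fact i powr \<sigma> * fact (k - i) powr \<sigma>)"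
    by (intro mult_right_mono) auto
  also have "\<dots> = (real (k choose i) * fact i * fact (k - i)) powr \<sigma>"
    by (simp add: powr_mult)
  also have "real (k choose i) * fact i * fact (k - i) = fact k"
    using binomial_fact[OF assms(2), where 'a=real] by (simp add: field_simps)
  finally show ?thesis .
qed

text \<open>
  Leibniz' rule. The binomial coefficient is absorbed by the factorials because
  \<open>(k choose i) i! (k - i)! = k!\<close> and \<open>\<sigma> \<ge> 1\<close>; the \<open>k + 1\<close> summands cost a factor \<open>2 ^ k\<close>.
\<close>

lemma gevrey_jet_mult:
  assumes "gevrey_jet \<sigma> C K f" "gevrey_jet \<sigma> C' K g" and "\<sigma> \<ge> 1" "C \<ge> 0" "C' \<ge> 0" "K \<ge> 0"
  shows "gevrey_jet \<sigma> (C * C') (2 * K) (\<lambda>k x. \<Sum>i\<le>k. real (k choose i) * (f i x * g (k - i) x))"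
proof -
  have df: "(f k has_real_derivative f (Suc k) x) (at x)" and bf: "\<bar>f k x\<bar> \<le> C * K ^ k * fact k powr \<sigma>" for k x
    using assms by (auto simp: gevrey_jet_def)
  have dg: "(g k has_real_derivative g (Suc k) x) (at x)" and bg: "\<bar>g k x\<bar> \<le> C' * K ^ k * fact k powr \<sigma>" for k x
    using assms by (auto simp: gevrey_jet_def)
  have "((\<lambda>x. \<Sum>i\<le>k. real (k choose i) * (f i x * g (k - i) x)) has_real_derivative
      (\<Sum>i\<le>Suc k. real (Suc k choose i) * (f i x * g (Suc k - i) x))) (at x)" for k x
  proof -
    have "((\<lambda>x. \<Sum>i\<le>k. real (k choose i) * (f i x * g (k - i) x)) has_real_derivative
      (\<Sum>i\<le>k. real (k choose i) * (f i x * g (Suc (k - i)) x + f (Suc i) x * g (k - i) x))) (at x)"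
      by (intro DERIV_sum DERIV_cmult DERIV_mult' df dg)
    moreover have "(\<Sum>i\<le>k. real (k choose i) * (f i x * g (Suc (k - i)) x + f (Suc i) x * g (k - i) x))
       = (\<Sum>i\<le>Suc k. real (Suc k choose i) * (f i x * g (Suc k - i) x))"
    proof -
      have "(\<Sum>i\<le>Suc k. real (Suc k choose i) * (f i x * g (Suc k - i) x))
        = f 0 x * g (Suc k) x + (\<Sum>i\<le>k. real (Suc k choose Suc i) * (f (Suc i) x * g (k - i) x))"
        by (subst sum.atMost_Suc_shift) simp
      also have "\<dots> = f 0 x * g (Suc k) x + (\<Sum>i\<le>k. real (k choose Suc i) * (f (Suc i) x * g (k - i) x))
         + (\<Sum>i\<le>k. real (k choose i) * (f (Suc i) x * g (k - i) x))"
        by (simp add: sum.distrib algebra_simps)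
      also have "f 0 x * g (Suc k) x + (\<Sum>i\<le>k. real (k choose Suc i) * (f (Suc i) x * g (k - i) x))
         = (\<Sum>i\<le>Suc k. real (k choose i) * (f i x * g (Suc k - i) x))"
        by (subst sum.atMost_Suc_shift) simp
      also have "\<dots> = (\<Sum>i\<le>k. real (k choose i) * (f i x * g (Suc (k - i)) x))"
        by (simp add: Suc_diff_le)
      finally show ?thesis by (simp add: sum.distrib distrib_left)
    qed
    ultimately show ?thesis by simp
  qed
  moreover have "\<bar>\<Sum>i\<le>k. real (k choose i) * (f i x * g (k - i) x)\<bar> \<le> C * C' * (2 * K) ^ k * fact k powr \<sigma>" for k x
  proof -
    have "\<bar>\<Sum>i\<le>k. real (k choose i) * (f i x * g (k - i) x)\<bar> \<le> (\<Sum>i\<le>k. \<bar>real (k choose i) * (f i x * g (k - i) x)\<bar>)"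
      by (rule sum_abs)
    also have "\<dots> \<le> (\<Sum>i\<le>k. C * C' * K ^ k * fact k powr \<sigma>)"
    proof (rule sum_mono)
      fix i assume "i \<in> {..k}" then have i: "i \<le> k" by simp
      have "\<bar>real (k choose i) * (f i x * g (k - i) x)\<bar> = real (k choose i) * (\<bar>f i x\<bar> * \<bar>g (k - i) x\<bar>)"
        by (simp add: abs_mult)
      also have "\<dots> \<le> real (k choose i) * ((C * K ^ i * fact i powr \<sigma>) * (C' * K ^ (k - i) * fact (k - i) powr \<sigma>))"
        using assms by (intro mult_left_mono mult_mono bf bg) auto
      also have "\<dots> = C * C' * K ^ k * (real (k choose i) * (fact i powr \<sigma> * fact (k - i) powr \<sigma>))"
        using i by (simp add: power_add[symmetric] mult_ac)
      also have "\<dots> \<le> C * C' * K ^ k * fact k powr \<sigma>"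
        using assms i by (intro mult_left_mono fact_powr_binomial) auto
      finally show "\<bar>real (k choose i) * (f i x * g (k - i) x)\<bar> \<le> C * C' * K ^ k * fact k powr \<sigma>" .
    qed
    also have "\<dots> = real (Suc k) * (C * C' * K ^ k * fact k powr \<sigma>)" by simp
    also have "\<dots> \<le> 2 ^ k * (C * C' * K ^ k * fact k powr \<sigma>)"
    proof -
      have "Suc k \<le> 2 ^ k" by (rule Suc_leI) (rule less_exp)
      then have "real (Suc k) \<le> 2 ^ k" by (metis of_nat_le_iff of_nat_numeral of_nat_power)
      then show ?thesis using assms by (intro mult_right_mono) auto
    qed
    finally show ?thesis by (simp add: power_mult_distrib mult_ac)
  qed
  ultimately show ?thesis by (simp add: gevrey_jet_def)
qed

text \<open>
  The derivatives of \<open>(x - v) f x\<close>. Multiplying by an unbounded function keeps the bounds because \<open>f\<close>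
  lives where \<open>x - v\<close> is bounded.
\<close>

lemma gevrey_jet_mult_linear:
  assumes f: "gevrey_jet \<sigma> C K f" and "\<sigma> \<ge> 1" "C \<ge> 0" "K \<ge> 0" "B \<ge> 0"
    and supp: "\<And>k x. \<bar>x - v\<bar> > B \<Longrightarrow> f k x = 0"
  shows "gevrey_jet \<sigma> ((B + 1) * C) (K + 1) (\<lambda>k x. (x - v) * f k x + real k * f (k - 1) x)"
proof -
  have df: "(f k has_real_derivative f (Suc k) x) (at x)" and bf: "\<bar>f k x\<bar> \<le> C * K ^ k * fact k powr \<sigma>" for k x
    using assms by (auto simp: gevrey_jet_def)
  have "((\<lambda>x. (x - v) * f k x + real k * f (k - 1) x) has_real_derivative
      (x - v) * f (Suc k) x + real (Suc k) * f (Suc k - 1) x) (at x)" for k x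
  proof -
    have "((\<lambda>x. real k * f (k - 1) x) has_real_derivative real k * f k x) (at x)"
      using df[of "k - 1" x] by (cases k) (auto intro!: derivative_eq_intros)
    from DERIV_add[OF DERIV_mult[OF DERIV_diff[OF DERIV_ident DERIV_const] df] this]
    show ?thesis by (rule DERIV_cong) (simp add: algebra_simps)
  qed
  moreover have "\<bar>(x - v) * f k x + real k * f (k - 1) x\<bar> \<le> (B + 1) * C * (K + 1) ^ k * fact k powr \<sigma>" for k x
  proof -
    have "\<bar>(x - v) * f k x\<bar> \<le> B * (C * (K + 1) ^ k * fact k powr \<sigma>)"
    proof (cases "\<bar>x - v\<bar> > B")
      case False
      have "\<bar>f k x\<bar> \<le> C * (K + 1) ^ k * fact k powr \<sigma>"
        using assms by (intro order_trans[OF bf] mult_mono mult_nonneg_nonneg power_mono) auto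
      then show ?thesis using False assms by (simp add: abs_mult mult_mono)
    qed (use supp assms in auto)
    moreover have "\<bar>real k * f (k - 1) x\<bar> \<le> C * (K + 1) ^ k * fact k powr \<sigma>"
    proof (cases k)
      case (Suc j)
      have "\<bar>real k * f (k - 1) x\<bar> \<le> real k * (C * K ^ j * fact j powr \<sigma>)"
        using bf[of j x] Suc by (simp add: abs_mult mult_left_mono)
      also have "\<dots> = C * K ^ j * (real k powr 1 * fact j powr \<sigma>)" by (simp add: mult_ac)
      also have "\<dots> \<le> C * (K + 1) ^ k * (real k powr \<sigma> * fact j powr \<sigma>)"
      proof -
        have "K ^ j \<le> (K + 1) ^ j" using assms by (intro power_mono) auto
        also have "\<dots> \<le> (K + 1) ^ k" using assms Suc by (intro power_increasing) auto
        finally show ?thesis using assms Suc by (intro mult_mono powr_mono) auto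
      qed
      also have "real k powr \<sigma> * fact j powr \<sigma> = fact k powr \<sigma>"
        using Suc by (simp add: powr_mult)
      finally show ?thesis .
    qed (use assms in auto)
    ultimately have "\<bar>(x - v) * f k x + real k * f (k - 1) x\<bar> \<le> B * (C * (K + 1) ^ k * fact k powr \<sigma>) + C * (K + 1) ^ k * fact k powr \<sigma>"
      by linarith
    then show ?thesis by (simp add: algebra_simps)
  qed
  ultimately show ?thesis by (simp add: gevrey_jet_def)
qed

lemma gevrey_bump:
  assumes "N \<ge> (1::nat)"
  obtains C K b where "C \<ge> 0" "K \<ge> 0" "gevrey_jet (1 + 1 / real N) C K b"
    "\<And>k x. x \<le> 0 \<or> x \<ge> 1 \<Longrightarrow> b k x = 0" "\<And>x. b 0 x \<ge> 0" "b 0 (1/2) > 0"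
proof -
  obtain K where K: "K > 0"
    "\<And>F M. F holomorphic_on UNIV \<Longrightarrow> M \<ge> 0 \<Longrightarrow> (\<And>w. cmod w \<le> 1 \<Longrightarrow> cmod (F w) \<le> M * cmod w) \<Longrightarrow>
       \<exists>f. gevrey_jet (1 + 1 / real N) M K f \<and>
           (\<forall>x>0. f 0 x = Re (F (of_real (exp (- ((1/x) ^ N)))))) \<and> (\<forall>k. \<forall>x\<le>0. f k x = 0)"
    using flat_gevrey_jet[OF assms] by blast
  obtain f where f: "gevrey_jet (1 + 1 / real N) 1 K f"
    "\<And>x. x > 0 \<Longrightarrow> f 0 x = exp (- ((1/x) ^ N))" "\<And>k x. x \<le> 0 \<Longrightarrow> f k x = 0"
    using K(2)[of "\<lambda>w. w" 1] by auto
  have g: "gevrey_jet (1 + 1 / real N) 1 K (\<lambda>k x. (-1) ^ k * f k ((-1) * x + 1))"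
    using gevrey_jet_affine[OF f(1), of "-1" 1] by simp
  define b where "b = (\<lambda>k x. \<Sum>i\<le>k. real (k choose i) * (f i x * ((-1) ^ (k-i) * f (k-i) ((-1) * x + 1))))"
  show ?thesis
  proof (rule that)
    show "gevrey_jet (1 + 1 / real N) (1 * 1) (2 * K) b"
      unfolding b_def using K(1) by (intro gevrey_jet_mult f g) auto
    show "b k x = 0" if "x \<le> 0 \<or> x \<ge> 1" for k x
      using that f(3) by (auto simp: b_def intro!: sum.neutral)
    show "b 0 x \<ge> 0" for x
      using f(2,3)[of x] f(2)[of "1 - x"] f(3)[of "1 - x" 0] f(3)[of x 0] by (cases "0 < x"; cases "0 < 1 - x") (auto simp: b_def)
    show "b 0 (1/2) > 0" by (simp add: b_def f(2))
  qed (use K(1) in auto)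
qed

lemma gevrey_step:
  assumes "N \<ge> (1::nat)"
  obtains C K S where "C \<ge> 0" "K \<ge> 0" "gevrey_jet (1 + 1 / real N) C K S"
    "\<And>k x. x \<le> 0 \<Longrightarrow> S k x = 0" "\<And>x. x \<ge> 1 \<Longrightarrow> S 0 x = 1" "\<And>k x. x \<ge> 1 \<Longrightarrow> S (Suc k) x = 0"
proof -
  define \<sigma> where "\<sigma> = 1 + 1 / real N"
  obtain C K b where b: "C \<ge> 0" "K \<ge> 0" "gevrey_jet \<sigma> C K b"
    "\<And>k x. x \<le> 0 \<or> x \<ge> 1 \<Longrightarrow> b k x = 0" "\<And>x. b 0 x \<ge> 0" "b 0 (1/2) > 0"
    using gevrey_bump[OF assms] unfolding \<sigma>_def by metis
  have db: "(b k has_real_derivative b (Suc k) x) (at x)" and bb: "\<bar>b k x\<bar> \<le> C * K ^ k * fact k powr \<sigma>" for k x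
    using b(3) by (auto simp: gevrey_jet_def)
  have cont: "continuous_on A (b 0)" for A
    using db by (meson DERIV_continuous continuous_at_imp_continuous_on)
  define I where "I = (\<lambda>x. integral {-1..x} (b 0))"
  have I0: "I x = 0" if "x \<le> 0" for x
    unfolding I_def using b(4) that by (intro integral_unique has_integral_is_0) auto
  have dI: "(I has_real_derivative b 0 x) (at x)" for x
  proof (cases "x > -1")
    case True
    have "(I has_real_derivative b 0 x) (at x within {-1..x+1})"
      unfolding I_def using True by (intro integral_has_real_derivative cont) auto
    moreover have "at x within {-1..x+1} = at x"
      using True by (intro at_within_interior) auto
    ultimately show ?thesis by simp
  next
    case False
    have "((\<lambda>t. 0) has_real_derivative b 0 x) (at x)" using b(4)[of x 0] False by simp
    moreover have "\<forall>\<^sub>F t in nhds x. I t = 0"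
      using eventually_nhds_in_open[of "{..<0}" x] False I0 by (auto elim!: eventually_mono)
    ultimately show ?thesis by (subst DERIV_cong_ev[OF refl _ refl])
  qed
  have mono: "I x \<le> I y" if "x \<le> y" for x y
    using DERIV_nonneg_imp_nondecreasing[OF that, of I] dI b(5) by blast
  have I1: "I x = I 1" if "x \<ge> 1" for x
  proof (cases "x = 1")
    case False
    then have "1 < x" using that by simp
    then show ?thesis
      using DERIV_isconst2[of 1 x I x] dI b(4)
      by (metis (no_types, lifting) DERIV_isCont continuous_at_imp_continuous_on less_imp_le order_refl)
  qed simp
  have pos: "I 1 > 0"
  proof (rule ccontr)
    assume "\<not> I 1 > 0"
    then have "I 1 = 0" using mono[of 0 1] I0[of 0] by simp
    then have "\<forall>x\<in>{-1..1}. b 0 x = 0"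
      unfolding I_def using integral_eq_0_iff[of "-1" 1 "b 0"] cont b(5) by auto
    then show False using b(6) by force
  qed
  define S where "S = (\<lambda>k x. (case k of 0 \<Rightarrow> I x | Suc j \<Rightarrow> b j x) / I 1)"
  have "gevrey_jet \<sigma> (max 1 (C / I 1)) (K + 1) S"
  proof -
    have "(S k has_real_derivative S (Suc k) x) (at x)" for k x
      using dI db pos by (cases k) (auto simp: S_def intro!: derivative_eq_intros)
    moreover have "\<bar>S k x\<bar> \<le> max 1 (C / I 1) * (K + 1) ^ k * fact k powr \<sigma>" for k x
    proof (cases k)
      case 0
      have "0 \<le> I x" using mono[of 0 x] I0[of 0] I0[of x] by (cases "x \<le> 0") auto
      moreover have "I x \<le> I 1" using mono[of x 1] I1[of x] by (cases "x \<le> 1") auto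
      ultimately have "\<bar>S k x\<bar> \<le> 1" using 0 pos by (simp add: S_def)
      then show ?thesis using 0 by simp
    next
      case (Suc j)
      have "\<bar>S k x\<bar> = \<bar>b j x\<bar> / I 1" using Suc pos by (simp add: S_def)
      also have "\<dots> \<le> C / I 1 * (K ^ j * fact j powr \<sigma>)"
        using bb[of j x] pos by (simp add: field_simps)
      also have "\<dots> \<le> max 1 (C / I 1) * ((K + 1) ^ k * fact k powr \<sigma>)"
      proof -
        have "K ^ j \<le> (K + 1) ^ j" using b by (intro power_mono) auto
        also have "\<dots> \<le> (K + 1) ^ k" using b Suc by (intro power_increasing) auto
        finally have 1: "K ^ j \<le> (K + 1) ^ k" .
        have "fact j \<le> (fact k :: real)" using Suc by (intro fact_mono) auto
        then have "fact j powr \<sigma> \<le> fact k powr \<sigma>" by (intro powr_mono2) (auto simp: \<sigma>_def)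
        with 1 show ?thesis using b pos by (intro mult_mono mult_nonneg_nonneg) auto
      qed
      finally show ?thesis by (simp add: mult.assoc)
    qed
    ultimately show ?thesis by (simp add: gevrey_jet_def)
  qed
  moreover have "S k x = 0" if "x \<le> 0" for k x
    using that I0 b(4) by (auto simp: S_def split: nat.splits)
  moreover have "S 0 x = 1" if "x \<ge> 1" for x using I1[OF that] pos by (simp add: S_def)
  moreover have "S (Suc k) x = 0" if "x \<ge> 1" for k x using that b(4) by (auto simp: S_def)
  ultimately show ?thesis using b(2) unfolding \<sigma>_def
    by (intro that[of "max 1 (C / I 1)" "K + 1" S]) auto
qed

lemma gevrey_quadratic_bump:
  assumes "N \<ge> (1::nat)" "l \<le> h" "d > 0"
  obtains C K f where "C \<ge> 0" "K \<ge> 0" "gevrey_jet (1 + 1 / real N) C K f"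
    "\<And>x. l \<le> x \<Longrightarrow> x \<le> h \<Longrightarrow> f 0 x = (x - v)\<^sup>2" "\<And>x. l \<le> x \<Longrightarrow> x \<le> h \<Longrightarrow> f 1 x = 2 * (x - v)"
    "\<And>k x. x \<le> l - d \<or> x \<ge> h + d \<Longrightarrow> f k x = 0"
proof -
  define \<sigma> where "\<sigma> = 1 + 1 / real N"
  have \<sigma>: "\<sigma> \<ge> 1" by (simp add: \<sigma>_def)
  obtain C K S where S: "C \<ge> 0" "K \<ge> 0" "gevrey_jet \<sigma> C K S"
    "\<And>k x. x \<le> 0 \<Longrightarrow> S k x = 0" "\<And>x. x \<ge> 1 \<Longrightarrow> S 0 x = 1" "\<And>k x. x \<ge> 1 \<Longrightarrow> S (Suc k) x = 0"
    using gevrey_step[OF assms(1)] unfolding \<sigma>_def by metis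
  define cut where "cut = (\<lambda>k x. (1/d)^k * S k (1/d * x + (1 - l/d)) - (1/d)^k * S k (1/d * x + (- (h/d))))"
  have cut: "gevrey_jet \<sigma> (C + C) (K * \<bar>1/d\<bar>) cut"
    unfolding cut_def by (intro gevrey_jet_diff gevrey_jet_affine S)
  have arg: "1/d * x + (1 - l/d) = (x - l + d) / d" "1/d * x + (- (h/d)) = (x - h) / d" for x
    using assms by (auto simp: field_simps)
  have out: "cut k x = 0" if "x \<le> l - d \<or> x \<ge> h + d" for k x
    unfolding cut_def arg using that assms S(4)[of "(x - l + d)/d"] S(4)[of "(x-h)/d"]
      S(5)[of "(x - l + d)/d"] S(5)[of "(x-h)/d"] S(6)[of "(x - l + d)/d"] S(6)[of "(x-h)/d"]
    by (cases k) (auto simp: field_simps)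
  have inn: "cut 0 x = 1" "cut 1 x = 0" if "l \<le> x" "x \<le> h" for x
    unfolding cut_def arg using that assms S(4)[of "(x-h)/d"] S(5)[of "(x - l + d)/d"] S(6)[of "(x - l + d)/d" 0]
    by (auto simp: field_simps)
  define B where "B = \<bar>l - d - v\<bar> + \<bar>h + d - v\<bar>"
  have far: "x \<le> l - d \<or> x \<ge> h + d" if "\<bar>x - v\<bar> > B" for x using that by (auto simp: B_def)
  define g where "g = (\<lambda>k x. (x - v) * cut k x + real k * cut (k - 1) x)"
  have g: "gevrey_jet \<sigma> ((B + 1) * (C + C)) (K * \<bar>1/d\<bar> + 1) g"
    unfolding g_def using out far S(1,2) by (intro gevrey_jet_mult_linear[OF cut \<sigma>]) (auto simp: B_def)
  have gout: "g k x = 0" if "x \<le> l - d \<or> x \<ge> h + d" for k x using out[OF that] by (simp add: g_def)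
  define f where "f = (\<lambda>k x. (x - v) * g k x + real k * g (k - 1) x)"
  have f: "gevrey_jet \<sigma> ((B + 1) * ((B + 1) * (C + C))) (K * \<bar>1/d\<bar> + 1 + 1) f"
    unfolding f_def using gout far S(1,2) by (intro gevrey_jet_mult_linear[OF g \<sigma>]) (auto simp: B_def)
  show ?thesis
  proof (rule that)
    show "gevrey_jet (1 + 1 / real N) ((B + 1) * ((B + 1) * (C + C))) (K * \<bar>1/d\<bar> + 1 + 1) f"
      using f by (simp add: \<sigma>_def)
    show "f 0 x = (x - v)\<^sup>2" if "l \<le> x" "x \<le> h" for x
      using inn[OF that] by (simp add: f_def g_def power2_eq_square)
    show "f 1 x = 2 * (x - v)" if "l \<le> x" "x \<le> h" for x
      using inn[OF that] by (simp add: f_def g_def)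
    show "f k x = 0" if "x \<le> l - d \<or> x \<ge> h + d" for k x using gout[OF that] by (simp add: f_def)
  qed (use S in \<open>auto simp: B_def\<close>)
qed

text \<open>
  The gate is \<open>lam = exp (- \<epsilon> \<phi>)\<close> with a flat \<open>\<phi>\<close> that is positive exactly beyond \<open>\<gamma>\<close>. With this
  form \<open>1 - lam\<close> and \<open>1 / lam - 1\<close> are both entire functions of \<open>\<phi>\<close> that vanish to first order, so both are
  Gevrey and of size \<open>\<epsilon>\<close>. They are the strengths of the two kicks of a pulse, and the relation between
  their derivatives makes the gate plane return to its place after the second kick.
\<close>

lemma gevrey_gate:
  assumes "N \<ge> (1::nat)"
  obtains K where "K > 0"
    "\<And>\<epsilon> \<gamma>. 0 < \<epsilon> \<Longrightarrow> \<epsilon> \<le> 1 \<Longrightarrow> \<exists>A B lam. gevrey_jet (1 + 1 / real N) (3 * \<epsilon>) K A \<and>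
       gevrey_jet (1 + 1 / real N) (3 * \<epsilon>) K B \<and>
       (\<forall>x. 0 < lam x \<and> lam x \<le> 1 \<and> (x > \<gamma> \<longrightarrow> lam x < 1) \<and> (x \<le> \<gamma> \<longrightarrow> (\<forall>k. A k x = 0 \<and> B k x = 0)) \<and>
          A 0 x = 1 - lam x \<and> B 0 x = 1 / lam x - 1 \<and> B 1 x = A 1 x / (lam x)\<^sup>2)"
proof -
  define \<sigma> where "\<sigma> = 1 + 1 / real N"
  obtain K where K: "K > 0"
    "\<And>F M. F holomorphic_on UNIV \<Longrightarrow> M \<ge> 0 \<Longrightarrow> (\<And>w. cmod w \<le> 1 \<Longrightarrow> cmod (F w) \<le> M * cmod w) \<Longrightarrow>
       \<exists>f. gevrey_jet \<sigma> M K f \<and>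
           (\<forall>x>0. f 0 x = Re (F (of_real (exp (- ((1/x) ^ N)))))) \<and> (\<forall>k. \<forall>x\<le>0. f k x = 0)"
    using flat_gevrey_jet[OF assms] unfolding \<sigma>_def by blast
  show ?thesis
  proof (rule that)
    show "K > 0" by fact
    fix \<epsilon> \<gamma> :: real assume e: "0 < \<epsilon>" "\<epsilon> \<le> 1"
    have ebd: "cmod (exp z - 1) \<le> 3 * cmod z" if "cmod z \<le> 1" for z
    proof -
      have "cmod (exp z - 1) \<le> exp \<bar>Re z\<bar> * cmod z"
        using Taylor_exp[of z 0] by simp
      also have "exp \<bar>Re z\<bar> \<le> exp 1" using that abs_Re_le_cmod[of z] by simp
      also have "exp (1::real) \<le> 3" by (rule exp_le)
      finally show ?thesis by (simp add: mult_right_mono)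
    qed
    have b1: "cmod (1 - exp (- (of_real \<epsilon> * w))) \<le> 3 * \<epsilon> * cmod w" if "cmod w \<le> 1" for w
      using ebd[of "- (of_real \<epsilon> * w)"] that e by (simp add: norm_mult norm_minus_commute mult_le_one)
    have b2: "cmod (exp (of_real \<epsilon> * w) - 1) \<le> 3 * \<epsilon> * cmod w" if "cmod w \<le> 1" for w
      using ebd[of "of_real \<epsilon> * w"] that e by (simp add: norm_mult mult_le_one)
    have "(\<lambda>w::complex. 1 - exp (- (of_real \<epsilon> * w))) holomorphic_on UNIV"
      "(\<lambda>w::complex. exp (of_real \<epsilon> * w) - 1) holomorphic_on UNIV"
      by (intro holomorphic_intros)+
    from K(2)[OF this(1) _ b1] K(2)[OF this(2) _ b2] e
    obtain A B where A: "gevrey_jet \<sigma> (3 * \<epsilon>) K A"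
        "\<And>x. x > 0 \<Longrightarrow> A 0 x = Re (1 - exp (- (of_real \<epsilon> * of_real (exp (- ((1/x) ^ N))))))" "\<And>k x. x \<le> 0 \<Longrightarrow> A k x = 0"
      and B: "gevrey_jet \<sigma> (3 * \<epsilon>) K B"
        "\<And>x. x > 0 \<Longrightarrow> B 0 x = Re (exp (of_real \<epsilon> * of_real (exp (- ((1/x) ^ N)))) - 1)" "\<And>k x. x \<le> 0 \<Longrightarrow> B k x = 0"
      by auto
    define lam where "lam = (\<lambda>x. 1 - A 0 (x - \<gamma>))"
    have A0: "A 0 x = 1 - exp (- (\<epsilon> * exp (- ((1/x) ^ N))))" if "x > 0" for x
      using A(2)[OF that] by (simp add: Re_exp)
    have B0: "B 0 x = exp (\<epsilon> * exp (- ((1/x) ^ N))) - 1" if "x > 0" for x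
      using B(2)[OF that] by (simp add: Re_exp)
    have AB: "B 0 x = 1 / (1 - A 0 x) - 1" for x
      using A0[of x] B0[of x] A(3)[of x 0] B(3)[of x 0] by (cases "x > 0") (auto simp: exp_minus divide_inverse)
    have lt: "A 0 x < 1" for x using A0 A(3)[of x 0] by (cases "x > 0") auto
    have B1: "B 1 x = A 1 x / (1 - A 0 x)\<^sup>2" for x
    proof (rule DERIV_unique)
      show "(B 0 has_real_derivative B 1 x) (at x)" using B(1) by (simp add: gevrey_jet_def)
      have "(A 0 has_real_derivative A 1 x) (at x)" using A(1) by (simp add: gevrey_jet_def)
      then have "((\<lambda>x. 1 / (1 - A 0 x) - 1) has_real_derivative A 1 x / (1 - A 0 x)\<^sup>2) (at x)"
        using lt[of x] by (auto intro!: derivative_eq_intros simp: power2_eq_square)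
      moreover have "B 0 = (\<lambda>x. 1 / (1 - A 0 x) - 1)" using AB by (rule ext)
      ultimately show "(B 0 has_real_derivative A 1 x / (1 - A 0 x)\<^sup>2) (at x)" by simp
    qed
    have "gevrey_jet \<sigma> (3 * \<epsilon>) K (\<lambda>k x. A k (x - \<gamma>))" "gevrey_jet \<sigma> (3 * \<epsilon>) K (\<lambda>k x. B k (x - \<gamma>))"
      using gevrey_jet_affine[OF A(1), of 1 "-\<gamma>"] gevrey_jet_affine[OF B(1), of 1 "-\<gamma>"] by simp_all
    moreover have "0 < lam x \<and> lam x \<le> 1 \<and> (x > \<gamma> \<longrightarrow> lam x < 1)" for x
      using A0[of "x - \<gamma>"] A(3)[of "x - \<gamma>" 0] e lt[of "x - \<gamma>"] by (cases "x > \<gamma>") (auto simp: lam_def)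
    ultimately show "\<exists>A B lam. gevrey_jet (1 + 1 / real N) (3 * \<epsilon>) K A \<and>
       gevrey_jet (1 + 1 / real N) (3 * \<epsilon>) K B \<and>
       (\<forall>x. 0 < lam x \<and> lam x \<le> 1 \<and> (x > \<gamma> \<longrightarrow> lam x < 1) \<and> (x \<le> \<gamma> \<longrightarrow> (\<forall>k. A k x = 0 \<and> B k x = 0)) \<and>
          A 0 x = 1 - lam x \<and> B 0 x = 1 / lam x - 1 \<and> B 1 x = A 1 x / (lam x)\<^sup>2)"
      using A(3) B(3) AB B1 unfolding \<sigma>_def
      by (intro exI[of _ "\<lambda>k x. A k (x - \<gamma>)"] exI[of _ "\<lambda>k x. B k (x - \<gamma>)"] exI[of _ lam]) (auto simp: lam_def)
  qed
qed

section \<open>Jets of potentials\<close>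

definition inc :: "3 \<Rightarrow> (3 \<Rightarrow> nat) \<Rightarrow> (3 \<Rightarrow> nat)" where
  "inc i k = k(i := Suc (k i))"

lemma inc_commute: "inc i (inc j k) = inc j (inc i k)"
  by (auto simp: inc_def fun_eq_iff)

text \<open>
  The family of all partial derivatives of a potential in the three positions. Differentiability is asked
  from order one on, because the dynamics sees a potential only through its gradient.
\<close>

definition jet3 :: "((3 \<Rightarrow> nat) \<Rightarrow> real ^ 3 \<Rightarrow> real) \<Rightarrow> bool" where
  "jet3 D \<longleftrightarrow> (\<forall>k i x. (D (inc i k) has_derivative (\<lambda>u. \<Sum>j\<in>UNIV. u $ j * D (inc j (inc i k)) x)) (at x))"

text \<open>
  The reciprocal of the Gevrey weight, with an extra \<open>2 ^ n\<close> that makes the sum over all multi-indices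
  converge.
\<close>

definition gweight :: "real \<Rightarrow> real \<Rightarrow> nat \<Rightarrow> real" where
  "gweight \<alpha> L n = fact n powr \<alpha> / (L powr (real n * \<alpha>) * 2 ^ n)"

definition jet3_bound :: "real \<Rightarrow> real \<Rightarrow> real \<Rightarrow> ((3 \<Rightarrow> nat) \<Rightarrow> real ^ 3 \<Rightarrow> real) \<Rightarrow> bool" where
  "jet3_bound \<alpha> L \<eta> D \<longleftrightarrow> (\<forall>k i x. \<bar>D (inc i k) x\<bar> \<le> \<eta> * (\<Prod>j\<in>UNIV. gweight \<alpha> L (k j)))"

lemma gweight_pos: "L > 0 \<Longrightarrow> gweight \<alpha> L n > 0"
  by (simp add: gweight_def)

text \<open>
  Termwise differentiation: the bounds decrease geometrically in \<open>n\<close>, uniformly in the point, for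
  derivatives of each fixed order.
\<close>

lemma jet3_series:
  assumes L: "L > 0" and \<eta>: "\<eta> > 0"
    and D: "\<And>n. jet3 (D n)" and bd: "\<And>n. jet3_bound \<alpha> L (\<eta> / 2 ^ n) (D n)"
  shows "\<And>k i x. (\<lambda>n. D n (inc i k) x) sums (\<Sum>n. D n (inc i k) x)"
    and "jet3 (\<lambda>k x. \<Sum>n. D n k x)" and "jet3_bound \<alpha> L (2 * \<eta>) (\<lambda>k x. \<Sum>n. D n k x)"
proof -
  define W where "W = (\<lambda>k::3\<Rightarrow>nat. \<Prod>j\<in>UNIV. gweight \<alpha> L (k j))"
  have W: "W k > 0" for k unfolding W_def using L by (intro prod_pos) (simp add: gweight_pos)
  have b: "\<bar>D n (inc i k) x\<bar> \<le> \<eta> * W k * (1/2) ^ n" for n i k x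
    using bd[of n] by (simp add: jet3_bound_def W_def power_one_over field_simps)
  have geo: "(\<lambda>n. \<eta> * W k * (1/2) ^ n) sums (\<eta> * W k * 2)" for k
    using sums_mult[OF geometric_sums[of "1/2::real"], of "\<eta> * W k"] by simp
  have sm: "summable (\<lambda>n. D n (inc i k) x)" for i k x
    using b by (intro summable_comparison_test'[OF sums_summable[OF geo]]) auto
  then show S: "(\<lambda>n. D n (inc i k) x) sums (\<Sum>n. D n (inc i k) x)" for k i x
    by (rule summable_sums)
  have tail: "\<bar>(\<Sum>i<n. D i (inc a k) x) - (\<Sum>i. D i (inc a k) x)\<bar> \<le> \<eta> * W k * 2 * (1/2) ^ n" for n a k x
  proof -
    have le: "\<bar>D (i + n) (inc a k) x\<bar> \<le> \<eta> * W k * (1/2) ^ n * (1/2) ^ i" for i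
      using b[of "i + n"] by (simp add: power_add mult_ac)
    have sm2: "summable (\<lambda>i. \<eta> * W k * (1/2) ^ n * (1/2::real) ^ i)"
      by (intro summable_mult summable_geometric) auto
    have sm3: "summable (\<lambda>i. \<bar>D (i + n) (inc a k) x\<bar>)"
      by (rule summable_comparison_test'[OF sm2]) (use le in auto)
    have "(\<Sum>i. D i (inc a k) x) - (\<Sum>i<n. D i (inc a k) x) = (\<Sum>i. D (i + n) (inc a k) x)"
      by (subst suminf_minus_initial_segment[OF sm]) simp
    also have "\<bar>\<dots>\<bar> \<le> (\<Sum>i. \<bar>D (i + n) (inc a k) x\<bar>)" by (rule summable_rabs[OF sm3])
    also have "\<dots> \<le> (\<Sum>i. \<eta> * W k * (1/2) ^ n * (1/2) ^ i)" by (rule suminf_le[OF le sm3 sm2])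
    also have "\<dots> = \<eta> * W k * 2 * (1/2) ^ n"
      by (simp add: suminf_mult suminf_geometric summable_geometric)
    finally show ?thesis by (simp add: abs_minus_commute)
  qed
  have tail0: "\<bar>\<Sum>n. D n (inc a k) x\<bar> \<le> 2 * \<eta> * W k" for a k x
  proof -
    have "\<bar>0 - (\<Sum>n. D n (inc a k) x)\<bar> \<le> \<eta> * W k * 2 * 1"
      using tail[where n=0 and a=a and k=k and x=x] by (simp only: lessThan_0 sum.empty power_0)
    then show ?thesis by (simp only: diff_0 abs_minus_cancel mult_1_right mult_ac)
  qed
  then show "jet3_bound \<alpha> L (2 * \<eta>) (\<lambda>k x. \<Sum>n. D n k x)"
    by (simp add: jet3_bound_def W_def)
  show "jet3 (\<lambda>k x. \<Sum>n. D n k x)"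
    unfolding jet3_def
  proof (intro allI)
    fix k i and x :: "real ^ 3"
    define g' where "g' = (\<lambda>x u. \<Sum>j\<in>UNIV. u $ j * (\<Sum>n. D n (inc j (inc i k)) x))"
    define f' where "f' = (\<lambda>n x u. \<Sum>j\<in>UNIV. u $ j * D n (inc j (inc i k)) x)"
    have "\<exists>g. \<forall>x\<in>UNIV. (\<lambda>n. D n (inc i k) x) sums g x \<and> (g has_derivative g' x) (at x within UNIV)"
    proof (rule has_derivative_series)
      show "convex (UNIV :: (real ^ 3) set)" by simp
      show "(D n (inc i k) has_derivative f' n x) (at x within UNIV)" for n x
        using D unfolding f'_def jet3_def by auto
      show "x \<in> UNIV" by simp
      show "(\<lambda>n. D n (inc i k) x) sums (\<Sum>n. D n (inc i k) x)" by (rule S)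
      fix e :: real assume e: "e > 0"
      define Q where "Q = 3 * (\<eta> * W (inc i k) * 2)"
      have "(\<lambda>n. Q * (1/2::real) ^ n) \<longlonglongrightarrow> Q * 0" by (intro tendsto_intros LIMSEQ_power_zero) auto
      then have ev: "\<forall>\<^sub>F n in sequentially. Q * (1/2::real) ^ n < e"
        using e by (intro order_tendstoD) auto
      have nb: "norm (sum (\<lambda>i. f' i x h) {..<n} - g' x h) \<le> Q * (1/2) ^ n * norm h" for n x h
      proof -
        have "sum (\<lambda>i. f' i x h) {..<n} - g' x h
          = (\<Sum>j\<in>UNIV. h $ j * ((\<Sum>m<n. D m (inc j (inc i k)) x) - (\<Sum>m. D m (inc j (inc i k)) x)))"
          unfolding f'_def g'_def by (subst sum.swap) (simp add: sum_distrib_left right_diff_distrib sum_subtractf)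
        also have "\<bar>\<dots>\<bar> \<le> (\<Sum>j\<in>(UNIV::3 set). norm h * (\<eta> * W (inc i k) * 2 * (1/2) ^ n))"
        proof (rule order_trans[OF sum_abs], rule sum_mono)
          fix j :: 3
          have "\<bar>h $ j\<bar> \<le> norm h" by (rule component_le_norm_cart)
          then show "\<bar>h $ j * ((\<Sum>m<n. D m (inc j (inc i k)) x) - (\<Sum>m. D m (inc j (inc i k)) x))\<bar>
              \<le> norm h * (\<eta> * W (inc i k) * 2 * (1/2) ^ n)"
            unfolding abs_mult using tail by (rule mult_mono) auto
        qed
        finally show ?thesis by (simp add: Q_def mult_ac)
      qed
      show "\<forall>\<^sub>F n in sequentially. \<forall>x\<in>UNIV. \<forall>h. norm (sum (\<lambda>i. f' i x h) {..<n} - g' x h) \<le> e * norm h"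
      proof (rule eventually_mono[OF ev], intro ballI allI)
        fix n x h assume "Q * (1/2::real) ^ n < e"
        then have "Q * (1/2) ^ n * norm h \<le> e * norm (h :: real ^ 3)" by (intro mult_right_mono) auto
        then show "norm (sum (\<lambda>i. f' i x h) {..<n} - g' x h) \<le> e * norm h"
          using nb[of x h n] by (rule order_trans[rotated])
      qed
    qed
    then obtain g where g: "\<And>x. (\<lambda>n. D n (inc i k) x) sums g x" "\<And>x. (g has_derivative g' x) (at x)"
      by auto
    have "g = (\<lambda>x. \<Sum>n. D n (inc i k) x)" using sums_unique[OF g(1)] by auto
    then show "((\<lambda>x. \<Sum>n. D n (inc i k) x) has_derivative (\<lambda>u. \<Sum>j\<in>UNIV. u $ j * (\<Sum>n. D n (inc j (inc i k)) x))) (at x)"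
      using g(2) by (simp add: g'_def)
  qed
qed

section \<open>Iterated partial derivatives\<close>

lemma C_k_const: "C_k m (\<lambda>_. c)"
proof (induction m arbitrary: c)
  case (Suc m)
  have "partial_deriv v (\<lambda>_::'a. c) = (\<lambda>_. 0)" for v
    by (simp add: partial_deriv_def fun_eq_iff)
  with Suc show ?case by simp
qed simp

lemma C_k_linear:
  assumes "bounded_linear f" shows "C_k m f"
proof (cases m)
  case 0
  then show ?thesis using assms by (simp add: linear_continuous_on)
next
  case (Suc j)
  have "partial_deriv v f = (\<lambda>_. f v)" for v
    using frechet_derivative_at[OF bounded_linear_imp_has_derivative[OF assms]]
    by (simp add: partial_deriv_def fun_eq_iff)
  then show ?thesis using Suc assms
    by (simp add: C_k_const bounded_linear_imp_differentiable_on)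
qed

lemma C_k_add: "C_k m f \<Longrightarrow> C_k m g \<Longrightarrow> C_k m (\<lambda>x. f x + g x)"
proof (induction m arbitrary: f g)
  case 0
  then show ?case by (simp add: continuous_on_add)
next
  case (Suc m)
  then have d: "f differentiable (at x)" "g differentiable (at x)" for x
    by (auto simp: differentiable_on_def)
  have "partial_deriv v (\<lambda>x. f x + g x) = (\<lambda>x. partial_deriv v f x + partial_deriv v g x)" for v
  proof
    fix x
    have ff: "(f has_derivative frechet_derivative f (at x)) (at x)" using d(1) by (rule frechet_derivative_works[THEN iffD1])
    have fg: "(g has_derivative frechet_derivative g (at x)) (at x)" using d(2) by (rule frechet_derivative_works[THEN iffD1])
    have "((\<lambda>x. f x + g x) has_derivative (\<lambda>u. frechet_derivative f (at x) u + frechet_derivative g (at x) u)) (at x)"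
      by (intro has_derivative_add ff fg)
    then show "partial_deriv v (\<lambda>x. f x + g x) x = partial_deriv v f x + partial_deriv v g x"
      by (simp add: partial_deriv_def frechet_derivative_at[symmetric])
  qed
  then show ?case using Suc by (simp add: differentiable_on_add)
qed

lemma partial_deriv_inner:
  assumes "f differentiable (at x)"
  shows "partial_deriv v (\<lambda>x. f x \<bullet> b) x = partial_deriv v f x \<bullet> b"
proof -
  have "(f has_derivative frechet_derivative f (at x)) (at x)"
    using assms by (rule frechet_derivative_works[THEN iffD1])
  then have "((\<lambda>x. f x \<bullet> b) has_derivative (\<lambda>u. frechet_derivative f (at x) u \<bullet> b)) (at x)"
    by (rule has_derivative_inner_left)
  then show ?thesis by (simp add: partial_deriv_def frechet_derivative_at[symmetric])
qed

lemma C_k_componentwise: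
  fixes f :: "'a::euclidean_space \<Rightarrow> 'b::euclidean_space"
  assumes "\<And>b. b \<in> Basis \<Longrightarrow> C_k m (\<lambda>x. f x \<bullet> b)"
  shows "C_k m f"
  using assms
proof (induction m arbitrary: f)
  case 0
  then show ?case
    using continuous_on_sum[of Basis UNIV "\<lambda>b x. (f x \<bullet> b) *\<^sub>R b"]
    by (simp add: euclidean_representation continuous_on_scaleR)
next
  case (Suc m)
  have d: "f differentiable_on UNIV"
    unfolding differentiable_on_def
  proof
    fix x
    show "f differentiable (at x)"
      using Suc.prems by (subst differentiable_componentwise_within) (simp add: differentiable_on_def)
  qed
  then have "f differentiable (at x)" for x by (simp add: differentiable_on_def)
  then have "(\<lambda>x. partial_deriv v f x \<bullet> b) = partial_deriv v (\<lambda>x. f x \<bullet> b)" for v b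
    by (simp add: fun_eq_iff partial_deriv_inner)
  then show ?case using Suc d by simp
qed

lemma smooth_partial_deriv: "smooth f \<Longrightarrow> v \<in> Basis \<Longrightarrow> smooth (partial_deriv v f)"
  unfolding smooth_def by (metis C_k.simps(2))

lemma smooth_differentiable: "smooth f \<Longrightarrow> f differentiable (at x)"
  unfolding smooth_def by (metis C_k.simps(2) UNIV_I differentiable_on_def)

lemma smooth_foldr_partial_deriv: "smooth f \<Longrightarrow> set vs \<subseteq> Basis \<Longrightarrow> smooth (foldr partial_deriv vs f)"
  by (induction vs) (auto intro: smooth_partial_deriv)

lemma foldr_partial_deriv_inner:
  fixes f :: "'a::euclidean_space \<Rightarrow> 'b::euclidean_space"
  assumes "smooth f" "set vs \<subseteq> Basis"
  shows "foldr partial_deriv vs f x \<bullet> b = foldr partial_deriv vs (\<lambda>x. f x \<bullet> b) x"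
  using assms(2)
proof (induction vs arbitrary: x)
  case (Cons v vs)
  then have s: "smooth (foldr partial_deriv vs f)" using assms smooth_foldr_partial_deriv by auto
  have "foldr partial_deriv vs (\<lambda>x. f x \<bullet> b) = (\<lambda>x. foldr partial_deriv vs f x \<bullet> b)"
    using Cons by auto
  then show ?case using partial_deriv_inner[OF smooth_differentiable[OF s]] by simp
qed simp

text \<open>
  The list of directions selected in the definition of \<^const>\<open>mderiv\<close> exists, since the basis is finite.
\<close>

lemma multi_index_list:
  assumes "l \<in> multi_indices"
  defines "vs \<equiv> (SOME vs. \<forall>v::'a::euclidean_space. count_list vs v = l v)"
  shows "\<And>v. count_list vs v = l v" and "set vs \<subseteq> Basis"
proof -
  obtain bs where bs: "set bs = (Basis :: 'a set)" "distinct bs"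
    using finite_distinct_list[OF finite_Basis] by blast
  have cr: "count_list (replicate n a) v = (if a = v then n else 0)" for n and a v :: 'a
    by (induction n) auto
  have "count_list (concat (map (\<lambda>b. replicate (l b) b) bs')) v = (if v \<in> set bs' then l v else 0)"
    if "distinct bs'" for bs' v
    using that by (induction bs') (auto simp: cr)
  then have "\<forall>v. count_list (concat (map (\<lambda>b. replicate (l b) b) bs)) v = l v"
    using assms(1) bs by (auto simp: multi_indices_def)
  then have *: "\<forall>v. count_list vs v = l v" unfolding vs_def by (rule someI)
  then show "\<And>v. count_list vs v = l v" by blast
  show "set vs \<subseteq> Basis"
    using * assms(1) by (metis (mono_tags, lifting) count_list_0_iff mem_Collect_eq multi_indices_def subsetI)
qed

section \<open>Gevrey norms of functions of the positions\<close>

abbreviation xb :: "3 \<Rightarrow> phase" where "xb j \<equiv> axis j (axis 1 1)"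
abbreviation yb :: "3 \<Rightarrow> phase" where "yb j \<equiv> axis j (axis 2 1)"

definition positions :: "phase \<Rightarrow> real ^ 3" where
  "positions s = (\<chi> j. s $ j $ 1)"

lemma phase_Basis: "(Basis :: phase set) = range xb \<union> range yb"
proof -
  have "(Basis :: (real ^ 2) set) = {axis 1 1, axis 2 1}"
    by (auto simp: Basis_vec_def UNIV_2)
  then show ?thesis by (auto simp: Basis_vec_def)
qed

lemma xb_nth: "xb j $ i $ l = (if i = j \<and> l = 1 then 1 else 0)"
  and yb_nth: "yb j $ i $ l = (if i = j \<and> l = 2 then 1 else 0)"
  by (auto simp: axis_def)

lemma xb_neq_yb: "xb i \<noteq> yb j"
proof
  assume "xb i = yb j"
  then have "xb i $ i $ 1 = yb j $ i $ 1" by simp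
  then show False by (simp add: xb_nth yb_nth del: axis_nth)
qed

lemma inj_xb: "inj xb"
  by (auto simp: inj_def axis_eq_axis)

lemma inj_yb: "inj yb"
  by (auto simp: inj_def axis_eq_axis)

lemma sum_phase_Basis: "(\<Sum>v\<in>Basis. f v) = (\<Sum>j\<in>UNIV. f (xb j)) + (\<Sum>j\<in>UNIV. f (yb j))"
proof -
  have "(\<Sum>v\<in>Basis. f v) = (\<Sum>v\<in>range xb. f v) + (\<Sum>v\<in>range yb. f v)"
    unfolding phase_Basis using xb_neq_yb by (intro sum.union_disjoint) auto
  then show ?thesis by (simp add: sum.reindex[OF inj_xb] sum.reindex[OF inj_yb])
qed

lemma prod_phase_Basis: "(\<Prod>v\<in>Basis. f v) = (\<Prod>j\<in>UNIV. f (xb j)) * (\<Prod>j\<in>UNIV. f (yb j))"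
proof -
  have "(\<Prod>v\<in>Basis. f v) = (\<Prod>v\<in>range xb. f v) * (\<Prod>v\<in>range yb. f v)"
    unfolding phase_Basis using xb_neq_yb by (intro prod.union_disjoint) auto
  then show ?thesis by (simp add: prod.reindex[OF inj_xb] prod.reindex[OF inj_yb])
qed

lemma linear_positions: "bounded_linear positions"
  unfolding positions_def
  by (intro linear_conv_bounded_linear[THEN iffD1] linearI) (auto simp: vec_eq_iff)

lemma jet3_positions_derivative:
  assumes "jet3 P"
  shows "((\<lambda>s. P (inc i k) (positions s)) has_derivative
           (\<lambda>u. \<Sum>j\<in>UNIV. u $ j $ 1 * P (inc j (inc i k)) (positions s))) (at s)"
proof -
  have "(P (inc i k) has_derivative (\<lambda>u. \<Sum>j\<in>UNIV. u $ j * P (inc j (inc i k)) (positions s))) (at (positions s))"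
    using assms by (simp add: jet3_def)
  from has_derivative_compose[OF bounded_linear_imp_has_derivative[OF linear_positions] this]
  show ?thesis by (simp add: positions_def)
qed

text \<open>
  The scalar \<open>c\<close> is kept explicit, so that a derivative in a momentum direction has again the same form,
  with \<open>c = 0\<close>. This lets one induction treat all directions.
\<close>

lemma partial_deriv_jet3:
  assumes "jet3 P"
  shows "partial_deriv (xb j) (\<lambda>s. c * P (inc i k) (positions s)) = (\<lambda>s. c * P (inc i (inc j k)) (positions s))"
    and "partial_deriv (yb j) (\<lambda>s. c * P (inc i k) (positions s)) = (\<lambda>s. 0 * P (inc i k) (positions s))"
proof -
  have "frechet_derivative (\<lambda>s. c * P (inc i k) (positions s)) (at s)
     = (\<lambda>u. c * (\<Sum>j\<in>UNIV. u $ j $ 1 * P (inc j (inc i k)) (positions s)))" for s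
    by (rule frechet_derivative_at[symmetric], rule has_derivative_mult_right, rule jet3_positions_derivative[OF assms])
  then show "partial_deriv (xb j) (\<lambda>s. c * P (inc i k) (positions s)) = (\<lambda>s. c * P (inc i (inc j k)) (positions s))"
    "partial_deriv (yb j) (\<lambda>s. c * P (inc i k) (positions s)) = (\<lambda>s. 0 * P (inc i k) (positions s))"
    by (auto simp: partial_deriv_def fun_eq_iff xb_nth yb_nth inc_commute[of i] if_distrib if_distribR cong: if_cong simp del: axis_nth)
qed

lemma C_k_jet3:
  assumes "jet3 P"
  shows "C_k m (\<lambda>s. c * P (inc i k) (positions s))"
proof (induction m arbitrary: c k)
  case 0
  have "(\<lambda>s. c * P (inc i k) (positions s)) differentiable (at s)" for s
    using has_derivative_mult_right[OF jet3_positions_derivative[OF assms], of c i k s] by (auto simp: differentiable_def)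
  then show ?case by (simp add: continuous_at_imp_continuous_on differentiable_imp_continuous_within)
next
  case (Suc m)
  have "(\<lambda>s. c * P (inc i k) (positions s)) differentiable (at s)" for s
    using has_derivative_mult_right[OF jet3_positions_derivative[OF assms], of c i k s] by (auto simp: differentiable_def)
  then show ?case using Suc
    by (auto simp: phase_Basis partial_deriv_jet3[OF assms] differentiable_on_def C_k_const)
qed

definition xcount :: "phase list \<Rightarrow> (3 \<Rightarrow> nat) \<Rightarrow> (3 \<Rightarrow> nat)" where
  "xcount vs k = (\<lambda>j. k j + count_list vs (xb j))"

lemma foldr_partial_deriv_jet3:
  assumes "jet3 P" "set vs \<subseteq> Basis"
  shows "foldr partial_deriv vs (\<lambda>s. c * P (inc i k) (positions s)) =
    (\<lambda>s. (if \<exists>j. yb j \<in> set vs then 0 else c) * P (inc i (xcount vs k)) (positions s))"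
  using assms(2)
proof (induction vs)
  case Nil
  then show ?case by (simp add: xcount_def)
next
  case (Cons v vs)
  then have IH: "foldr partial_deriv vs (\<lambda>s. c * P (inc i k) (positions s)) =
    (\<lambda>s. (if \<exists>j. yb j \<in> set vs then 0 else c) * P (inc i (xcount vs k)) (positions s))" by auto
  from Cons.prems consider j where "v = xb j" | j where "v = yb j" by (auto simp: phase_Basis)
  then show ?case
  proof cases
    case (1 j)
    have "inc j (xcount vs k) = xcount (v # vs) k"
      using inj_xb unfolding 1 by (auto simp: inc_def xcount_def fun_eq_iff inj_def)
    moreover have "(\<exists>i. yb i \<in> set (v # vs)) = (\<exists>i. yb i \<in> set vs)" using 1 xb_neq_yb by (auto simp: eq_commute)
    ultimately show ?thesis
      unfolding foldr_Cons o_apply IH unfolding 1 partial_deriv_jet3[OF assms(1)] by simp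
  next
    case (2 j)
    then have "(\<exists>i. yb i \<in> set (v # vs))" by auto
    then show ?thesis
      unfolding foldr_Cons o_apply IH unfolding 2 partial_deriv_jet3[OF assms(1)] by simp
  qed
qed

lemma mderiv_jet3:
  assumes "jet3 P" "l \<in> multi_indices"
  shows "mderiv l (\<lambda>s. c * P (inc i (\<lambda>_. 0)) (positions s)) =
    (\<lambda>s. (if \<exists>j. l (yb j) \<noteq> 0 then 0 else c) * P (inc i (\<lambda>j. l (xb j))) (positions s))"
proof -
  define vs where "vs = (SOME vs. \<forall>v::phase. count_list vs v = l v)"
  note vs = multi_index_list[OF assms(2), folded vs_def]
  have "yb j \<in> set vs \<longleftrightarrow> l (yb j) \<noteq> 0" for j using vs(1)[of "yb j"] by (metis count_list_0_iff)
  moreover have "xcount vs (\<lambda>_. 0) = (\<lambda>j. l (xb j))" by (simp add: xcount_def vs(1))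
  ultimately show ?thesis
    unfolding mderiv_def vs_def[symmetric] foldr_partial_deriv_jet3[OF assms(1) vs(2)] by simp
qed

text \<open>
  Derivatives in momentum directions vanish, so the sum runs over the multi-indices in three positions. The
  weights leave \<open>\<eta> (1/2) ^ |k|\<close>, and each of the three geometric series contributes a factor \<open>2\<close>.
\<close>

lemma gevrey_norm_jet3:
  assumes P: "jet3 P" and bd: "jet3_bound \<alpha> L \<eta> P" and L: "L > 0" and "\<eta> \<ge> 0" and c: "\<bar>c\<bar> \<le> 1"
  shows "gevrey_norm \<alpha> L (\<lambda>s. c * P (inc i (\<lambda>_. 0)) (positions s)) \<le> ennreal (8 * \<eta>)"
proof -
  define t :: "(phase \<Rightarrow> nat) \<Rightarrow> ennreal" where "t = (\<lambda>l. ennreal (L powr (real (\<Sum>v\<in>Basis. l v) * \<alpha>) / (\<Prod>v\<in>Basis. fact (l v)) powr \<alpha>)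
          * C0_norm (mderiv l (\<lambda>s. c * P (inc i (\<lambda>_. 0)) (positions s))))"
  define Z where "Z = {l::phase \<Rightarrow> nat. \<forall>j. l (yb j) = 0}"
  define r where "r = (\<lambda>(l :: phase \<Rightarrow> nat) j. l (xb j))"
  have t0: "t l = 0" if "l \<in> multi_indices" "l \<notin> Z" for l
    using that by (auto simp: t_def mderiv_jet3[OF P that(1)] Z_def C0_norm_def)
  have t1: "t l \<le> ennreal (\<eta> * (\<Prod>j\<in>UNIV. (1/2) ^ r l j))" if "l \<in> multi_indices" "l \<in> Z" for l
  proof -
    have y: "l (yb j) = 0" for j using that by (simp add: Z_def)
    have "C0_norm (mderiv l (\<lambda>s. c * P (inc i (\<lambda>_. 0)) (positions s))) \<le> ennreal (\<eta> * (\<Prod>j\<in>UNIV. gweight \<alpha> L (r l j)))"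
      unfolding C0_norm_def
    proof (rule SUP_least)
      fix s
      have "\<bar>c * P (inc i (r l)) (positions s)\<bar> \<le> 1 * (\<eta> * (\<Prod>j\<in>UNIV. gweight \<alpha> L (r l j)))"
        unfolding abs_mult using bd c by (intro mult_mono) (auto simp: jet3_bound_def)
      then show "ennreal \<bar>mderiv l (\<lambda>s. c * P (inc i (\<lambda>_. 0)) (positions s)) s\<bar> \<le> ennreal (\<eta> * (\<Prod>j\<in>UNIV. gweight \<alpha> L (r l j)))"
        by (simp add: mderiv_jet3[OF P that(1)] y r_def ennreal_leI)
    qed
    then have "t l \<le> ennreal (L powr (real (\<Sum>v\<in>Basis. l v) * \<alpha>) / (\<Prod>v\<in>Basis. fact (l v)) powr \<alpha>)
        * ennreal (\<eta> * (\<Prod>j\<in>UNIV. gweight \<alpha> L (r l j)))"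
      unfolding t_def by (intro mult_left_mono) auto
    also have "\<dots> = ennreal (L powr (real (\<Sum>v\<in>Basis. l v) * \<alpha>) / (\<Prod>v\<in>Basis. fact (l v)) powr \<alpha>
        * (\<eta> * (\<Prod>j\<in>UNIV. gweight \<alpha> L (r l j))))"
      by (rule ennreal_mult'[symmetric]) auto
    also have "L powr (real (\<Sum>v\<in>Basis. l v) * \<alpha>) / (\<Prod>v\<in>Basis. fact (l v)) powr \<alpha>
        = (\<Prod>j\<in>UNIV. L powr (real (r l j) * \<alpha>) / fact (r l j) powr \<alpha>)"
    proof -
      have "(\<Sum>v\<in>Basis. l v) = (\<Sum>j\<in>UNIV. r l j)" "(\<Prod>v\<in>Basis. fact (l v)) = (\<Prod>j\<in>UNIV. fact (r l j) :: real)"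
        by (simp_all add: sum_phase_Basis prod_phase_Basis y r_def)
      moreover have "real (\<Sum>j\<in>UNIV. r l j) * \<alpha> = (\<Sum>j\<in>UNIV. real (r l j) * \<alpha>)" by (simp add: sum_distrib_right)
      ultimately show ?thesis
        using L by (simp only: powr_sum[OF less_imp_neq[OF L, symmetric]] prod_powr_distrib prod_dividef fact_ge_zero)
    qed
    also have "\<dots> * (\<eta> * (\<Prod>j\<in>UNIV. gweight \<alpha> L (r l j))) = \<eta> * (\<Prod>j\<in>UNIV. L powr (real (r l j) * \<alpha>) / fact (r l j) powr \<alpha> * gweight \<alpha> L (r l j))"
      unfolding prod.distrib by (simp only: mult_ac)
    also have "(\<lambda>j. L powr (real (r l j) * \<alpha>) / fact (r l j) powr \<alpha> * gweight \<alpha> L (r l j)) = (\<lambda>j. (1/2) ^ r l j)"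
      using L by (auto simp: gweight_def power_one_over)
    finally show ?thesis .
  qed
  have "sum t F \<le> ennreal (8 * \<eta>)" if F: "finite F" "F \<subseteq> multi_indices" for F
  proof -
    define F' where "F' = F \<inter> Z"
    have "sum t F = sum t F'"
      unfolding F'_def using F t0 by (intro sum.mono_neutral_right) auto
    also have "\<dots> \<le> (\<Sum>l\<in>F'. ennreal (\<eta> * (\<Prod>j\<in>UNIV. (1/2) ^ r l j)))"
      using F t1 by (intro sum_mono) (auto simp: F'_def)
    also have "\<dots> = ennreal (\<Sum>l\<in>F'. \<eta> * (\<Prod>j\<in>UNIV. (1/2) ^ r l j))"
      using assms by (intro sum_ennreal) (auto intro!: mult_nonneg_nonneg prod_nonneg)
    also have "(\<Sum>l\<in>F'. \<eta> * (\<Prod>j\<in>UNIV. (1/2) ^ r l j)) \<le> 8 * \<eta>"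
    proof -
      have inj: "inj_on r F'"
      proof (rule inj_onI)
        fix l l' assume l: "l \<in> F'" "l' \<in> F'" and eq: "r l = r l'"
        show "l = l'"
        proof
          fix v show "l v = l' v"
          proof (cases "v \<in> Basis")
            case True
            then show ?thesis using l fun_cong[OF eq[unfolded r_def]] by (auto simp only: phase_Basis F'_def Z_def Un_iff image_iff Int_iff mem_Collect_eq)
          next
            case False
            have "l \<in> multi_indices" "l' \<in> multi_indices" using l F by (auto simp: F'_def)
            then show ?thesis using False by (simp add: multi_indices_def)
          qed
        qed
      qed
      define m where "m = Max (insert 0 (\<Union>l\<in>F'. range (r l)))"
      have fin: "finite (\<Union>l\<in>F'. range (r l))" using F by (auto simp: F'_def)
      have "r ` F' \<subseteq> PiE UNIV (\<lambda>_. {..m})"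
        unfolding m_def using fin by (auto simp: PiE_UNIV_domain intro!: Max_ge)
      then have "(\<Sum>k\<in>r ` F'. \<Prod>j\<in>UNIV. (1/2::real) ^ k j) \<le> (\<Sum>k\<in>PiE UNIV (\<lambda>_::3. {..m}). \<Prod>j\<in>UNIV. (1/2) ^ k j)"
        by (intro sum_mono2 finite_PiE prod_nonneg) auto
      also have "\<dots> = (\<Prod>j\<in>(UNIV::3 set). \<Sum>n\<le>m. (1/2) ^ n)"
        by (rule prod_sum_PiE[symmetric]) auto
      also have "\<dots> \<le> (\<Prod>j\<in>(UNIV::3 set). 2)"
      proof (rule prod_mono)
        have "(\<Sum>n\<le>m. (1/2::real) ^ n) \<le> (\<Sum>n. (1/2) ^ n)"
          by (intro sum_le_suminf summable_geometric) auto
        then show "0 \<le> (\<Sum>n\<le>m. (1/2::real) ^ n) \<and> (\<Sum>n\<le>m. (1/2::real) ^ n) \<le> 2"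
          by (auto simp: suminf_geometric intro: sum_nonneg)
      qed
      also have "\<dots> = (8::real)" by simp
      finally have "(\<Sum>l\<in>F'. \<Prod>j\<in>UNIV. (1/2::real) ^ r l j) \<le> 8"
        by (simp add: sum.reindex[OF inj])
      then have "\<eta> * (\<Sum>l\<in>F'. \<Prod>j\<in>UNIV. (1/2::real) ^ r l j) \<le> \<eta> * 8"
        using assms by (intro mult_left_mono) auto
      then show ?thesis by (simp add: sum_distrib_left mult.commute)
    qed
    finally show ?thesis by (simp add: ennreal_leI)
  qed
  then have "infsum t multi_indices \<le> ennreal (8 * \<eta>)"
    by (subst nonneg_infsum_complete) (auto intro!: SUP_least)
  then show ?thesis by (simp add: gevrey_norm_def t_def)
qed

section \<open>Symplectic shears\<close>

definition shift :: "real \<Rightarrow> ((3 \<Rightarrow> nat) \<Rightarrow> real ^ 3 \<Rightarrow> real) \<Rightarrow> phase \<Rightarrow> phase" where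
  "shift c P s = (\<chi> i. vector [0, c * P (inc i (\<lambda>_. 0)) (positions s)])"

definition shear :: "real \<Rightarrow> ((3 \<Rightarrow> nat) \<Rightarrow> real ^ 3 \<Rightarrow> real) \<Rightarrow> phase \<Rightarrow> phase" where
  "shear c P s = s + shift c P s"

lemma shift_inner:
  "shift c P s \<bullet> xb j = 0 * P (inc j (\<lambda>_. 0)) (positions s)"
  "shift c P s \<bullet> yb j = c * P (inc j (\<lambda>_. 0)) (positions s)"
  by (simp_all add: shift_def inner_axis)

lemma smooth_shift:
  assumes "jet3 P" shows "smooth (shift c P)"
  unfolding smooth_def
proof
  fix m show "C_k m (shift c P)"
  proof (rule C_k_componentwise)
    fix b :: phase assume "b \<in> Basis"
    then show "C_k m (\<lambda>x. shift c P x \<bullet> b)"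
      using C_k_jet3[OF assms] by (auto simp only: phase_Basis shift_inner Un_iff image_iff)
  qed
qed

lemma smooth_shear: "jet3 P \<Longrightarrow> smooth (shear c P)"
  using smooth_shift C_k_linear[OF bounded_linear_ident]
  unfolding smooth_def shear_def by (auto intro!: C_k_add)

lemma positions_shear: "positions (shear c P s) = positions s"
  by (simp add: positions_def shear_def shift_def vec_eq_iff)

lemma shear_inverse: "shear (- c) P (shear c P s) = s"
proof -
  have "shear (- c) P (shear c P s) = s + (shift c P s + shift (- c) P (shear c P s))"
    by (simp add: shear_def)
  also have "shift c P s + shift (- c) P (shear c P s) = 0"
    unfolding shift_def positions_shear by (simp add: vec_eq_iff forall_2)
  finally show ?thesis by simp
qed

lemma diffeomorphism_shear:
  assumes "jet3 P" shows "diffeomorphism (shear c P)"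
proof -
  have 1: "shear (- c) P \<circ> shear c P = id" "shear c P \<circ> shear (- c) P = id"
    using shear_inverse[of c P] shear_inverse[of "- c" P] by (auto simp: fun_eq_iff)
  have "inv (shear c P) = shear (- c) P" using inv_unique_comp[OF 1(2) 1(1)] .
  then show ?thesis using o_bij[OF 1] smooth_shear[OF assms] by (simp add: diffeomorphism_def)
qed

text \<open>
  The change of the symplectic form is the antisymmetric part of the Hessian of \<open>P\<close>, and second partial
  derivatives commute.
\<close>

lemma symplectic_shear:
  assumes "jet3 P" shows "symplectic (shear c P)"
proof -
  define A where "A = (\<lambda>s (u::phase). (\<chi> i. vector [0, c * (\<Sum>j\<in>UNIV. u $ j $ 1 * P (inc j (inc i (\<lambda>_. 0))) (positions s))]) :: phase)"
  have der: "(shear c P has_derivative (\<lambda>u. u + A s u)) (at s)" for s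
  proof -
    have "(shift c P has_derivative A s) (at s)"
    proof (subst has_derivative_componentwise_within, rule ballI)
      fix b :: phase assume "b \<in> Basis"
      then consider j where "b = xb j" | j where "b = yb j" by (auto simp: phase_Basis)
      then show "((\<lambda>x. shift c P x \<bullet> b) has_derivative (\<lambda>x. A s x \<bullet> b)) (at s)"
      proof cases
        case (1 j)
        have "(\<lambda>x. A s x \<bullet> b) = (\<lambda>_. 0)" by (simp add: 1 A_def inner_axis)
        then show ?thesis by (simp add: 1 shift_inner)
      next
        case (2 j)
        have "(\<lambda>x. A s x \<bullet> b) = (\<lambda>u. c * (\<Sum>i\<in>UNIV. u $ i $ 1 * P (inc i (inc j (\<lambda>_. 0))) (positions s)))"
          by (simp add: 2 A_def inner_axis)
        then show ?thesis
          unfolding 2 shift_inner by (simp only: has_derivative_mult_right[OF jet3_positions_derivative[OF assms]])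
      qed
    qed
    then have "((\<lambda>s. s + shift c P s) has_derivative (\<lambda>u. u + A s u)) (at s)"
      by (intro has_derivative_add has_derivative_ident)
    then show ?thesis by (simp add: shear_def[abs_def])
  qed
  have fd: "frechet_derivative (shear c P) (at s) = (\<lambda>u. u + A s u)" for s
    using frechet_derivative_at[OF der] by simp
  have "symplectic_form (u + A s u) (v + A s v) = symplectic_form u v" for s u v
  proof -
    define Q where "Q = (\<lambda>i j. P (inc j (inc i (\<lambda>_. 0))) (positions s))"
    have Q: "Q i j = Q j i" for i j by (simp add: Q_def inc_commute)
    have A: "A s u $ i $ 1 = 0" "A s u $ i $ 2 = c * (\<Sum>j\<in>UNIV. u $ j $ 1 * Q i j)" for i u
      by (simp_all add: A_def Q_def)
    have "symplectic_form (u + A s u) (v + A s v) = symplectic_form u v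
       + c * ((\<Sum>i\<in>UNIV. \<Sum>j\<in>UNIV. u $ i $ 1 * v $ j $ 1 * Q i j) - (\<Sum>i\<in>UNIV. \<Sum>j\<in>UNIV. u $ j $ 1 * v $ i $ 1 * Q i j))"
      by (simp add: symplectic_form_def A sum.distrib sum_subtractf sum_distrib_left algebra_simps)
    also have "(\<Sum>i\<in>UNIV. \<Sum>j\<in>UNIV. u $ j $ 1 * v $ i $ 1 * Q i j) = (\<Sum>i\<in>UNIV. \<Sum>j\<in>UNIV. u $ i $ 1 * v $ j $ 1 * Q i j)"
      by (subst sum.swap) (simp add: Q)
    finally show ?thesis by simp
  qed
  then show ?thesis by (simp add: symplectic_def fd)
qed

text \<open>
  The displacement has six components; three vanish and each of the others is a partial derivative of the
  potential, with norm at most \<open>8 \<eta>\<close>.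
\<close>

lemma shear_in_gevrey_symplectic:
  assumes P: "jet3 P" and bd: "jet3_bound \<alpha> L \<eta> P" and L: "L > 0" and \<eta>: "\<eta> \<ge> 0"
    and c: "\<bar>c\<bar> \<le> 1" and flat: "\<And>i k. P (inc i k) 0 = 0"
  shows "shear c P \<in> gevrey_symplectic \<alpha> L"
    and "gevrey_norm_vec \<alpha> L (\<lambda>s. shear c P s - s) \<le> ennreal (48 * \<eta>)"
proof -
  have d: "(\<lambda>s. shear c P s - s) = shift c P" by (simp add: shear_def fun_eq_iff)
  have p0: "positions 0 = 0" by (simp add: positions_def vec_eq_iff)
  have gn: "gevrey_norm \<alpha> L (\<lambda>s. shift c P s \<bullet> b) \<le> ennreal (8 * \<eta>)" if "b \<in> Basis" for b
    using that gevrey_norm_jet3[OF P bd L \<eta>, of 0] gevrey_norm_jet3[OF P bd L \<eta> c]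
    by (auto simp only: phase_Basis shift_inner Un_iff image_iff abs_zero zero_le_one)
  have "gevrey_norm_vec \<alpha> L (shift c P) \<le> (\<Sum>b\<in>(Basis :: phase set). ennreal (8 * \<eta>))"
    unfolding gevrey_norm_vec_def using gn by (intro sum_mono) auto
  also have "\<dots> = ennreal (48 * \<eta>)"
    using \<eta> by (subst sum_ennreal) auto
  finally have nv: "gevrey_norm_vec \<alpha> L (shift c P) \<le> ennreal (48 * \<eta>)" .
  then show "gevrey_norm_vec \<alpha> L (\<lambda>s. shear c P s - s) \<le> ennreal (48 * \<eta>)" by (simp add: d)
  have "mderiv l (shift c P) 0 = 0" if l: "l \<in> multi_indices" for l
  proof (rule euclidean_eqI)
    fix b :: phase assume b: "b \<in> Basis"
    have "mderiv l (shift c P) 0 \<bullet> b = mderiv l (\<lambda>s. shift c P s \<bullet> b) 0"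
      unfolding mderiv_def
      by (rule foldr_partial_deriv_inner[OF smooth_shift[OF P] multi_index_list(2)[OF l]])
    also have "\<dots> = 0"
    proof -
      obtain j c' where "(\<lambda>s. shift c P s \<bullet> b) = (\<lambda>s. c' * P (inc j (\<lambda>_. 0)) (positions s))"
        using b shift_inner[of c P] by (auto simp only: phase_Basis)
      then show ?thesis by (simp add: mderiv_jet3[OF P l] flat p0)
    qed
    finally show "mderiv l (shift c P) 0 \<bullet> b = 0 \<bullet> b" by simp
  qed
  moreover have "shear c P 0 = 0"
    by (simp add: shear_def shift_def p0 flat vec_eq_iff forall_2)
  ultimately show "shear c P \<in> gevrey_symplectic \<alpha> L"
    using diffeomorphism_shear[OF P] symplectic_shear[OF P] smooth_shift[OF P] nv
    by (auto simp: gevrey_symplectic_def gevrey_space_def d intro: le_less_trans)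
qed

section \<open>Potentials with a gate\<close>

lemma power_le_fact_powr:
  assumes "Y > 0" "\<delta> > (0::real)"
  obtains Q where "Q > 0" "\<And>n. Y ^ n \<le> Q * fact n powr \<delta>"
proof
  define Z where "Z = Y powr (1 / \<delta>)"
  have Z: "Z > 0" using assms by (simp add: Z_def)
  show "exp Z powr \<delta> > 0" by simp
  fix n
  have "Z ^ n / fact n \<le> exp Z"
    using sum_le_suminf[of "\<lambda>n. Z ^ n / fact n" "{n}"] Z summable_exp_generic[of Z]
    by (simp add: exp_def divide_inverse_commute)
  then have "Z ^ n \<le> exp Z * fact n" by (simp add: field_simps)
  then have "(Z ^ n) powr \<delta> \<le> (exp Z * fact n) powr \<delta>"
    using Z assms by (intro powr_mono2) auto
  moreover have "(Z ^ n) powr \<delta> = Y ^ n"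
    using assms Z by (simp add: Z_def powr_realpow[symmetric] powr_powr mult.commute)
  ultimately show "Y ^ n \<le> exp Z powr \<delta> * fact n powr \<delta>" by (simp add: powr_mult)
qed

text \<open>
  Any Gevrey exponent below \<open>\<alpha>\<close> leaves a power of \<open>n!\<close> to spare, which dominates every geometric
  factor, in particular \<open>L\<close> and the extra \<open>2 ^ n\<close>. The shifted estimate is there because
  \<^const>\<open>jet3_bound\<close> measures the derivatives of the gradient and not of the potential.
\<close>

lemma gevrey_le_gweight:
  assumes "K > 0" "0 \<le> \<sigma>" "\<sigma> < \<alpha>" "L > 0"
  obtains Q where "Q > 0" "\<And>n. K ^ n * fact n powr \<sigma> \<le> Q * gweight \<alpha> L n"
    "\<And>n. K ^ Suc n * fact (Suc n) powr \<sigma> \<le> Q * gweight \<alpha> L n"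
proof -
  define X where "X = 2 * L powr \<alpha>"
  have X: "X > 0" using assms by (simp add: X_def)
  have gw: "gweight \<alpha> L n = fact n powr \<alpha> / X ^ n" for n
    using assms by (simp add: gweight_def X_def power_mult_distrib powr_realpow[symmetric] powr_powr mult_ac)
  define Y where "Y = K * X * 2 powr \<sigma>"
  have Y: "Y > 0" using assms X by (simp add: Y_def)
  obtain Q where Q: "Q > 0" "\<And>n. Y ^ n \<le> Q * fact n powr (\<alpha> - \<sigma>)"
    using power_le_fact_powr[OF Y, of "\<alpha> - \<sigma>"] assms by auto
  have main: "K ^ n * (2 powr \<sigma>) ^ n * fact n powr \<sigma> \<le> Q * gweight \<alpha> L n" for n
  proof -
    have "K ^ n * (2 powr \<sigma>) ^ n * fact n powr \<sigma> = Y ^ n * fact n powr \<sigma> / X ^ n"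
      using X by (simp add: Y_def power_mult_distrib)
    also have "\<dots> \<le> Q * fact n powr (\<alpha> - \<sigma>) * fact n powr \<sigma> / X ^ n"
      using Q X by (intro divide_right_mono mult_right_mono) auto
    also have "\<dots> = Q * gweight \<alpha> L n"
      by (simp add: gw mult.assoc powr_add[symmetric])
    finally show ?thesis .
  qed
  have p1: "(1::real) \<le> (2 powr \<sigma>) ^ n" for n
    using assms by (intro one_le_power) (simp add: ge_one_powr_ge_zero)
  show ?thesis
  proof (rule that)
    show "(1 + K) * Q > 0" using Q assms by simp
    fix n
    have gp: "0 \<le> Q * gweight \<alpha> L n" using Q gweight_pos[OF assms(4), of \<alpha> n] by simp
    have "K ^ n * fact n powr \<sigma> \<le> K ^ n * (2 powr \<sigma>) ^ n * fact n powr \<sigma>"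
      using p1[of n] assms by (intro mult_right_mono) (auto simp: mult_le_cancel_left1)
    also note main
    finally have 1: "K ^ n * fact n powr \<sigma> \<le> Q * gweight \<alpha> L n" .
    show "K ^ n * fact n powr \<sigma> \<le> (1 + K) * Q * gweight \<alpha> L n"
    proof -
      have "0 \<le> K * (Q * gweight \<alpha> L n)" by (rule mult_nonneg_nonneg[OF less_imp_le[OF assms(1)] gp])
      then have "K ^ n * fact n powr \<sigma> \<le> Q * gweight \<alpha> L n + K * (Q * gweight \<alpha> L n)" using 1 by linarith
      then show ?thesis by (simp only: distrib_right mult.assoc mult_1_left)
    qed
    have "real (Suc n) \<le> 2 ^ n"
      using Suc_leI[OF less_exp[of n]] by (metis of_nat_le_iff of_nat_numeral of_nat_power)
    then have "real (Suc n) powr \<sigma> \<le> (2 ^ n) powr \<sigma>" using assms by (intro powr_mono2) auto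
    also have "(2 ^ n) powr \<sigma> = (2 powr \<sigma>) ^ n"
      by (simp add: powr_realpow[symmetric] powr_powr mult.commute)
    finally have s: "real (Suc n) powr \<sigma> \<le> (2 powr \<sigma>) ^ n" .
    have "K ^ Suc n * fact (Suc n) powr \<sigma> = K * (K ^ n * real (Suc n) powr \<sigma> * fact n powr \<sigma>)"
      by (simp add: powr_mult)
    also have "\<dots> \<le> K * (K ^ n * (2 powr \<sigma>) ^ n * fact n powr \<sigma>)"
      using s assms by (intro mult_left_mono mult_right_mono) auto
    also have "\<dots> \<le> K * (Q * gweight \<alpha> L n)" using main assms by (intro mult_left_mono) auto
    finally show "K ^ Suc n * fact (Suc n) powr \<sigma> \<le> (1 + K) * Q * gweight \<alpha> L n"
      using gp by (simp add: distrib_right mult.assoc)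
  qed
qed

lemma gevrey_jet_le_gweight:
  assumes f: "gevrey_jet \<sigma> C K f" and "C \<ge> 0" "K \<ge> 0" "0 \<le> \<sigma>" "\<sigma> < \<alpha>" "L > 0"
  obtains Q where "Q \<ge> 0" "\<And>n x. \<bar>f n x\<bar> \<le> Q * gweight \<alpha> L n" "\<And>n x. \<bar>f (Suc n) x\<bar> \<le> Q * gweight \<alpha> L n"
proof -
  have f': "gevrey_jet \<sigma> C (K + 1) f" using gevrey_jet_mono[OF f] assms by auto
  obtain Q where Q: "Q > 0" "\<And>n. (K + 1) ^ n * fact n powr \<sigma> \<le> Q * gweight \<alpha> L n"
    "\<And>n. (K + 1) ^ Suc n * fact (Suc n) powr \<sigma> \<le> Q * gweight \<alpha> L n"
    using gevrey_le_gweight[of "K + 1" \<sigma> \<alpha> L] assms by auto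
  have b: "\<bar>f n x\<bar> \<le> C * ((K + 1) ^ n * fact n powr \<sigma>)" for n x
    using f' by (simp add: gevrey_jet_def mult.assoc)
  show ?thesis
  proof (rule that)
    show "C * Q \<ge> 0" using Q assms by simp
    show "\<bar>f n x\<bar> \<le> C * Q * gweight \<alpha> L n" for n x
      using b[of n x] mult_left_mono[OF Q(2)[of n] assms(2)] by (simp add: mult.assoc)
    show "\<bar>f (Suc n) x\<bar> \<le> C * Q * gweight \<alpha> L n" for n x
      using b[of "Suc n" x] mult_left_mono[OF Q(3)[of n] assms(2)] unfolding mult.assoc by linarith
  qed
qed

text \<open>
  The jet of \<open>A (x $ g) * F (x $ p)\<close>.
\<close>

definition tensor :: "3 \<Rightarrow> 3 \<Rightarrow> (nat \<Rightarrow> real \<Rightarrow> real) \<Rightarrow> (nat \<Rightarrow> real \<Rightarrow> real) \<Rightarrow> (3 \<Rightarrow> nat) \<Rightarrow> real ^ 3 \<Rightarrow> real" where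
  "tensor p g A F k x = (if \<forall>j. j \<noteq> p \<and> j \<noteq> g \<longrightarrow> k j = 0 then A (k g) (x $ g) * F (k p) (x $ p) else 0)"

lemma jet3_tensor:
  assumes pg: "p \<noteq> g"
    and A: "\<And>k x. (A k has_real_derivative A (Suc k) x) (at x)"
    and F: "\<And>k x. (F k has_real_derivative F (Suc k) x) (at x)"
  shows "(tensor p g A F k has_derivative (\<lambda>u. \<Sum>j\<in>UNIV. u $ j * tensor p g A F (inc j k) x)) (at x)"
proof (cases "\<forall>j. j \<noteq> p \<and> j \<noteq> g \<longrightarrow> k j = 0")
  case True
  have eq: "tensor p g A F k = (\<lambda>x. A (k g) (x $ g) * F (k p) (x $ p))"
    using True by (simp add: tensor_def fun_eq_iff)
  have lin: "((\<lambda>x::real^3. x $ i) has_derivative (\<lambda>u. u $ i)) (at x)" for i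
    by (rule bounded_linear_imp_has_derivative) (rule bounded_linear_vec_nth)
  have dA: "((\<lambda>x::real^3. A (k g) (x $ g)) has_derivative (\<lambda>u. A (Suc (k g)) (x $ g) * u $ g)) (at x)"
    using has_derivative_compose[OF lin A[unfolded has_field_derivative_def]] .
  have dF: "((\<lambda>x::real^3. F (k p) (x $ p)) has_derivative (\<lambda>u. F (Suc (k p)) (x $ p) * u $ p)) (at x)"
    using has_derivative_compose[OF lin F[unfolded has_field_derivative_def]] .
  have "(\<lambda>u. \<Sum>j\<in>UNIV. u $ j * tensor p g A F (inc j k) x)
     = (\<lambda>u. A (k g) (x $ g) * (F (Suc (k p)) (x $ p) * u $ p) + A (Suc (k g)) (x $ g) * u $ g * F (k p) (x $ p))"
  proof
    fix u :: "real ^ 3"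
    have "(\<Sum>j\<in>UNIV. u $ j * tensor p g A F (inc j k) x) = (\<Sum>j\<in>{p, g}. u $ j * tensor p g A F (inc j k) x)"
      by (rule sum.mono_neutral_right) (auto simp: tensor_def inc_def)
    also have "\<dots> = A (k g) (x $ g) * (F (Suc (k p)) (x $ p) * u $ p) + A (Suc (k g)) (x $ g) * u $ g * F (k p) (x $ p)"
      using pg True by (simp add: tensor_def inc_def)
    finally show "(\<Sum>j\<in>UNIV. u $ j * tensor p g A F (inc j k) x)
      = A (k g) (x $ g) * (F (Suc (k p)) (x $ p) * u $ p) + A (Suc (k g)) (x $ g) * u $ g * F (k p) (x $ p)" .
  qed
  then show ?thesis unfolding eq using has_derivative_mult[OF dA dF] by simp
next
  case False
  then have "tensor p g A F k = (\<lambda>_. 0)" "\<And>j. tensor p g A F (inc j k) x = 0"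
    by (auto simp: tensor_def inc_def fun_eq_iff)
  then show ?thesis by simp
qed

lemma tensor_bound:
  assumes pg: "p \<noteq> g" and L: "L > 0" and Q: "0 \<le> QA" "0 \<le> QF"
    and A: "\<And>n x. \<bar>A n x\<bar> \<le> QA * gweight \<alpha> L n" "\<And>n x. \<bar>A (Suc n) x\<bar> \<le> QA * gweight \<alpha> L n"
    and F: "\<And>n x. \<bar>F n x\<bar> \<le> QF * gweight \<alpha> L n" "\<And>n x. \<bar>F (Suc n) x\<bar> \<le> QF * gweight \<alpha> L n"
  shows "\<bar>tensor p g A F (inc i k) x\<bar> \<le> QA * QF * (\<Prod>j\<in>UNIV. gweight \<alpha> L (k j))"
proof (cases "\<forall>j. j \<noteq> p \<and> j \<noteq> g \<longrightarrow> inc i k j = 0")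
  case False
  have "(\<Prod>j\<in>UNIV. gweight \<alpha> L (k j)) \<ge> 0" using L by (intro prod_nonneg) (simp add: gweight_pos less_imp_le)
  then show ?thesis using False Q by (auto simp: tensor_def)
next
  case True
  have g0: "gweight \<alpha> L 0 = 1" using L by (simp add: gweight_def)
  have gp: "gweight \<alpha> L n \<ge> 0" for n using gweight_pos[OF L] by (simp add: less_imp_le)
  have k0: "k j = 0" if "j \<notin> {p, g}" for j using True that by (auto simp: inc_def split: if_splits)
  have i: "i = p \<or> i = g" using True by (auto simp: inc_def split: if_splits)
  have "(\<Prod>j\<in>UNIV. gweight \<alpha> L (k j)) = (\<Prod>j\<in>{p, g}. gweight \<alpha> L (k j))"
    by (rule prod.mono_neutral_right) (auto simp: k0 g0)
  then have W: "(\<Prod>j\<in>UNIV. gweight \<alpha> L (k j)) = gweight \<alpha> L (k g) * gweight \<alpha> L (k p)" using pg by simp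
  have "\<bar>A (inc i k g) (x $ g)\<bar> \<le> QA * gweight \<alpha> L (k g)" using A by (auto simp: inc_def)
  moreover have "\<bar>F (inc i k p) (x $ p)\<bar> \<le> QF * gweight \<alpha> L (k p)" using F by (auto simp: inc_def)
  ultimately have "\<bar>A (inc i k g) (x $ g)\<bar> * \<bar>F (inc i k p) (x $ p)\<bar> \<le> (QA * gweight \<alpha> L (k g)) * (QF * gweight \<alpha> L (k p))"
    using Q gp by (intro mult_mono) auto
  then show ?thesis using True by (simp add: tensor_def abs_mult W mult_ac)
qed

text \<open>
  Near each of two intervals of the position \<open>x $ p\<close> the potential is a parabola multiplied by a gate in
  \<open>x $ g\<close>. On the first interval the strength is \<open>1 - lam\<close>, on the second it is \<open>1 / lam - 1\<close>. The parabolas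
  are fixed by the geometry and may be large; smallness comes from the gate alone, through \<open>\<epsilon>\<close>.
\<close>

lemma gate_potential:
  fixes \<kappa>1 \<kappa>2 :: real
  assumes \<alpha>: "\<alpha> > 1" and L: "L > 0" and pg: "p \<noteq> (g :: 3)" and d: "d > 0"
    and lh: "l1 \<le> h1" "l2 \<le> h2" and \<mu>: "\<mu> > 0"
  obtains D lam dl where "jet3 D" "jet3_bound \<alpha> L \<mu> D"
    "\<And>x. 0 < lam x" "\<And>x. lam x \<le> 1" "\<And>x. x > \<gamma> \<Longrightarrow> lam x < 1"
    "\<And>k x. x $ g \<le> \<gamma> \<Longrightarrow> D k x = 0"
    "\<And>k x. x $ p \<notin> {l1 - d<..<h1 + d} \<Longrightarrow> x $ p \<notin> {l2 - d<..<h2 + d} \<Longrightarrow> D k x = 0"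
    "\<And>x. x $ p \<in> {l1..h1} \<Longrightarrow> x $ p \<notin> {l2 - d<..<h2 + d} \<Longrightarrow>
       D (inc p (\<lambda>_. 0)) x = (1 - lam (x $ g)) * (2 * \<kappa>1 * (x $ p - v1)) \<and>
       D (inc g (\<lambda>_. 0)) x = dl (x $ g) * (\<kappa>1 * (x $ p - v1)\<^sup>2)"
    "\<And>x. x $ p \<in> {l2..h2} \<Longrightarrow> x $ p \<notin> {l1 - d<..<h1 + d} \<Longrightarrow>
       D (inc p (\<lambda>_. 0)) x = (1 / lam (x $ g) - 1) * (2 * \<kappa>2 * (x $ p - v2)) \<and>
       D (inc g (\<lambda>_. 0)) x = dl (x $ g) / (lam (x $ g))\<^sup>2 * (\<kappa>2 * (x $ p - v2)\<^sup>2)"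
    "\<And>i x. i \<noteq> p \<Longrightarrow> i \<noteq> g \<Longrightarrow> D (inc i (\<lambda>_. 0)) x = 0"
proof -
  \<comment> \<open>The flat functions have exponent \<open>1 + 1 / N\<close>, which has to be below \<open>\<alpha>\<close>.\<close>
  obtain N :: nat where N: "1 / (\<alpha> - 1) < real N" using reals_Archimedean2 by blast
  then have N0: "real N > 0" using \<alpha> by (meson diff_gt_0_iff_gt divide_pos_pos less_trans zero_less_one)
  then have N1: "N \<ge> 1" by simp
  define \<sigma> where "\<sigma> = 1 + 1 / real N"
  have \<sigma>: "0 \<le> \<sigma>" "\<sigma> < \<alpha>" using N N0 \<alpha> by (auto simp: \<sigma>_def field_simps)
  obtain C1 K1 f1 where f1: "C1 \<ge> 0" "K1 \<ge> 0" "gevrey_jet \<sigma> C1 K1 f1"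
    "\<And>x. l1 \<le> x \<Longrightarrow> x \<le> h1 \<Longrightarrow> f1 0 x = (x - v1)\<^sup>2" "\<And>x. l1 \<le> x \<Longrightarrow> x \<le> h1 \<Longrightarrow> f1 1 x = 2 * (x - v1)"
    "\<And>k x. x \<le> l1 - d \<or> x \<ge> h1 + d \<Longrightarrow> f1 k x = 0"
    using gevrey_quadratic_bump[OF N1 lh(1) d, of v1] unfolding \<sigma>_def by blast
  obtain C2 K2 f2 where f2: "C2 \<ge> 0" "K2 \<ge> 0" "gevrey_jet \<sigma> C2 K2 f2"
    "\<And>x. l2 \<le> x \<Longrightarrow> x \<le> h2 \<Longrightarrow> f2 0 x = (x - v2)\<^sup>2" "\<And>x. l2 \<le> x \<Longrightarrow> x \<le> h2 \<Longrightarrow> f2 1 x = 2 * (x - v2)"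
    "\<And>k x. x \<le> l2 - d \<or> x \<ge> h2 + d \<Longrightarrow> f2 k x = 0"
    using gevrey_quadratic_bump[OF N1 lh(2) d, of v2] unfolding \<sigma>_def by blast
  define F1 where "F1 = (\<lambda>k x. \<kappa>1 * f1 k x)"
  define F2 where "F2 = (\<lambda>k x. \<kappa>2 * f2 k x)"
  have F1: "gevrey_jet \<sigma> (\<bar>\<kappa>1\<bar> * C1) K1 F1" unfolding F1_def by (rule gevrey_jet_scale[OF f1(3)])
  have F2: "gevrey_jet \<sigma> (\<bar>\<kappa>2\<bar> * C2) K2 F2" unfolding F2_def by (rule gevrey_jet_scale[OF f2(3)])
  obtain Q1 where Q1: "Q1 \<ge> 0" "\<And>n x. \<bar>F1 n x\<bar> \<le> Q1 * gweight \<alpha> L n" "\<And>n x. \<bar>F1 (Suc n) x\<bar> \<le> Q1 * gweight \<alpha> L n"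
    using gevrey_jet_le_gweight[OF F1 _ f1(2) \<sigma> L] f1(1) by auto
  obtain Q2 where Q2: "Q2 \<ge> 0" "\<And>n x. \<bar>F2 n x\<bar> \<le> Q2 * gweight \<alpha> L n" "\<And>n x. \<bar>F2 (Suc n) x\<bar> \<le> Q2 * gweight \<alpha> L n"
    using gevrey_jet_le_gweight[OF F2 _ f2(2) \<sigma> L] f2(1) by auto
  obtain K where K: "K > 0"
    "\<And>\<epsilon> \<gamma>. 0 < \<epsilon> \<Longrightarrow> \<epsilon> \<le> 1 \<Longrightarrow> \<exists>A B lam. gevrey_jet \<sigma> (3 * \<epsilon>) K A \<and>
       gevrey_jet \<sigma> (3 * \<epsilon>) K B \<and>
       (\<forall>x. 0 < lam x \<and> lam x \<le> 1 \<and> (x > \<gamma> \<longrightarrow> lam x < 1) \<and> (x \<le> \<gamma> \<longrightarrow> (\<forall>k. A k x = 0 \<and> B k x = 0)) \<and>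
          A 0 x = 1 - lam x \<and> B 0 x = 1 / lam x - 1 \<and> B 1 x = A 1 x / (lam x)\<^sup>2)"
    using gevrey_gate[OF N1] unfolding \<sigma>_def by metis
  obtain QK where QK: "QK > 0" "\<And>n. K ^ n * fact n powr \<sigma> \<le> QK * gweight \<alpha> L n"
    "\<And>n. K ^ Suc n * fact (Suc n) powr \<sigma> \<le> QK * gweight \<alpha> L n"
    using gevrey_le_gweight[OF K(1) \<sigma> L] by blast
  define \<epsilon> where "\<epsilon> = min 1 (\<mu> / (3 * QK * (Q1 + Q2) + 1))"
  have den: "3 * QK * (Q1 + Q2) + 1 > 0" using QK Q1 Q2 by (simp add: add_nonneg_pos)
  then have \<epsilon>: "0 < \<epsilon>" "\<epsilon> \<le> 1" using \<mu> by (auto simp: \<epsilon>_def)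
  have "\<epsilon> * (3 * QK * (Q1 + Q2) + 1) \<le> \<mu>"
    using den pos_le_divide_eq[OF den, of \<epsilon> \<mu>] by (simp add: \<epsilon>_def)
  then have \<epsilon>\<mu>: "3 * \<epsilon> * QK * Q1 + 3 * \<epsilon> * QK * Q2 \<le> \<mu>" using \<epsilon> by (simp add: algebra_simps)
  obtain A B lam where A: "gevrey_jet \<sigma> (3 * \<epsilon>) K A" and B: "gevrey_jet \<sigma> (3 * \<epsilon>) K B"
    and AB: "\<forall>x. 0 < lam x \<and> lam x \<le> 1 \<and> (x > \<gamma> \<longrightarrow> lam x < 1) \<and> (x \<le> \<gamma> \<longrightarrow> (\<forall>k. A k x = 0 \<and> B k x = 0)) \<and>
          A 0 x = 1 - lam x \<and> B 0 x = 1 / lam x - 1 \<and> B 1 x = A 1 x / (lam x)\<^sup>2"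
    using K(2)[OF \<epsilon>, of \<gamma>] by blast
  then have lam: "\<And>x. 0 < lam x" "\<And>x. lam x \<le> 1" "\<And>x. x > \<gamma> \<Longrightarrow> lam x < 1" "\<And>k x. x \<le> \<gamma> \<Longrightarrow> A k x = 0 \<and> B k x = 0"
      "\<And>x. A 0 x = 1 - lam x" "\<And>x. B 0 x = 1 / lam x - 1" "\<And>x. B 1 x = A 1 x / (lam x)\<^sup>2"
    by auto
  have bb: "\<bar>A n x\<bar> \<le> 3 * \<epsilon> * QK * gweight \<alpha> L n" "\<bar>A (Suc n) x\<bar> \<le> 3 * \<epsilon> * QK * gweight \<alpha> L n"
    if "gevrey_jet \<sigma> (3 * \<epsilon>) K A" for A n x
  proof -
    have b: "\<bar>A n x\<bar> \<le> 3 * \<epsilon> * (K ^ n * fact n powr \<sigma>)" for n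
      using that by (simp add: gevrey_jet_def mult.assoc)
    have e: "0 \<le> 3 * \<epsilon>" using \<epsilon> by simp
    show "\<bar>A n x\<bar> \<le> 3 * \<epsilon> * QK * gweight \<alpha> L n"
      using b[of n] mult_left_mono[OF QK(2)[of n] e] unfolding mult.assoc by linarith
    show "\<bar>A (Suc n) x\<bar> \<le> 3 * \<epsilon> * QK * gweight \<alpha> L n"
      using b[of "Suc n"] mult_left_mono[OF QK(3)[of n] e] unfolding mult.assoc by linarith
  qed
  define D where "D = (\<lambda>k x. tensor p g A F1 k x + tensor p g B F2 k x)"
  have e3: "0 \<le> 3 * \<epsilon> * QK" using \<epsilon> QK by simp
  show ?thesis
  proof (rule that[of D lam "A 1"])
    show "jet3 D"
      unfolding jet3_def D_def using A B F1 F2 pg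
      by (auto simp: gevrey_jet_def distrib_left sum.distrib intro!: has_derivative_add jet3_tensor)
    show "jet3_bound \<alpha> L \<mu> D"
      unfolding jet3_bound_def
    proof (intro allI)
      fix k :: "3 \<Rightarrow> nat" and i x
      have W: "0 \<le> (\<Prod>j\<in>UNIV. gweight \<alpha> L (k j))" using L by (intro prod_nonneg) (simp add: gweight_pos less_imp_le)
      have "\<bar>D (inc i k) x\<bar> \<le> \<bar>tensor p g A F1 (inc i k) x\<bar> + \<bar>tensor p g B F2 (inc i k) x\<bar>"
        unfolding D_def by (rule abs_triangle_ineq)
      also have "\<dots> \<le> 3 * \<epsilon> * QK * Q1 * (\<Prod>j\<in>UNIV. gweight \<alpha> L (k j)) + 3 * \<epsilon> * QK * Q2 * (\<Prod>j\<in>UNIV. gweight \<alpha> L (k j))"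
        by (intro add_mono tensor_bound pg L e3 Q1 Q2 bb A B)
      also have "\<dots> = (3 * \<epsilon> * QK * Q1 + 3 * \<epsilon> * QK * Q2) * (\<Prod>j\<in>UNIV. gweight \<alpha> L (k j))"
        by (simp only: distrib_right)
      also have "\<dots> \<le> \<mu> * (\<Prod>j\<in>UNIV. gweight \<alpha> L (k j))" using \<epsilon>\<mu> W by (rule mult_right_mono)
      finally show "\<bar>D (inc i k) x\<bar> \<le> \<mu> * (\<Prod>j\<in>UNIV. gweight \<alpha> L (k j))" .
    qed
    show "D k x = 0" if "x $ g \<le> \<gamma>" for k x using lam(4)[OF that] by (simp add: D_def tensor_def)
    show "D k x = 0" if "x $ p \<notin> {l1 - d<..<h1 + d}" "x $ p \<notin> {l2 - d<..<h2 + d}" for k x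
      using f1(6)[of "x $ p"] f2(6)[of "x $ p"] that by (auto simp: D_def tensor_def F1_def F2_def not_less)
    show "D (inc p (\<lambda>_. 0)) x = (1 - lam (x $ g)) * (2 * \<kappa>1 * (x $ p - v1)) \<and>
       D (inc g (\<lambda>_. 0)) x = A 1 (x $ g) * (\<kappa>1 * (x $ p - v1)\<^sup>2)"
      if "x $ p \<in> {l1..h1}" "x $ p \<notin> {l2 - d<..<h2 + d}" for x
      using that f1(4,5)[of "x $ p"] f2(6)[of "x $ p"] pg lam(5)
      by (auto simp: D_def tensor_def F1_def F2_def inc_def not_less)
    show "D (inc p (\<lambda>_. 0)) x = (1 / lam (x $ g) - 1) * (2 * \<kappa>2 * (x $ p - v2)) \<and>
       D (inc g (\<lambda>_. 0)) x = A 1 (x $ g) / (lam (x $ g))\<^sup>2 * (\<kappa>2 * (x $ p - v2)\<^sup>2)"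
      if "x $ p \<in> {l2..h2}" "x $ p \<notin> {l1 - d<..<h1 + d}" for x
      using that f2(4,5)[of "x $ p"] f1(6)[of "x $ p"] pg lam(6,7)
      by (auto simp: D_def tensor_def F1_def F2_def inc_def not_less)
    show "D (inc i (\<lambda>_. 0)) x = 0" if "i \<noteq> p" "i \<noteq> g" for i x
      using that by (auto simp: D_def tensor_def inc_def)
  qed (use lam in auto)
qed

section \<open>Timing of the gate\<close>

lemma cis_eq_if_diff_Ints:
  assumes "x - y \<in> \<int>" shows "cis (2 * pi * x) = cis (2 * pi * y)"
proof -
  obtain n where "x - y = of_int n" using assms by (auto elim: Ints_cases)
  then have "2 * pi * x = 2 * pi * y + 2 * pi * of_int n" by (simp add: algebra_simps)
  then show ?thesis by (simp add: cis_mult[symmetric] cis_multiple_2pi)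
qed

lemma cos_le_cos_first:
  assumes "1 \<le> r" "r + 1 \<le> (q::real)"
  shows "cos (2 * pi * r / q) \<le> cos (2 * pi / q)"
proof (cases "2 * r \<le> q")
  case True
  have "2 * pi * r / q \<le> pi" using assms True by (simp add: field_simps)
  then show ?thesis using assms by (intro cos_monotone_0_pi_le) (auto simp: field_simps)
next
  case False
  have "cos (2 * pi * r / q) = cos (2 * pi - 2 * pi * r / q)" by simp
  also have "2 * pi - 2 * pi * r / q = 2 * pi * (q - r) / q" using assms by (simp add: field_simps)
  also have "cos \<dots> \<le> cos (2 * pi / q)"
  proof (rule cos_monotone_0_pi_le)
    show "2 * pi * (q - r) / q \<le> pi" using assms False by (simp add: field_simps)
    have "2 * pi * 1 \<le> 2 * pi * (q - r)" using assms by (intro mult_left_mono) auto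
    then show "2 * pi / q \<le> 2 * pi * (q - r) / q" using assms by (intro divide_right_mono) auto
  qed (use assms in auto)
  finally show ?thesis .
qed

text \<open>
  A point \<open>\<i> r\<close> of the gate plane has position \<open>- r sin \<theta>\<close> after a rotation by \<open>\<theta>\<close>, so the gate
  opens widest when \<open>cis \<theta> = - \<i>\<close>. The product \<open>q \<omega>g\<close> is an integer that is coprime to \<open>q\<close> and
  congruent to \<open>3\<close> modulo \<open>4\<close>: hence the gate plane runs through all \<open>q\<close>-th roots of unity, the widest
  opening occurs exactly at \<open>t = q / 4\<close> modulo \<open>q\<close>, and at all other times the position is at most
  \<open>r cos (2 pi / q)\<close>. At the openings the pushed plane takes only \<open>mp\<close> phases, because
  \<open>q \<omega>p = 1 / mp\<close> modulo \<open>1\<close>; the quarter cycle is chosen as origin since \<open>mp q / 4 = k q + q / 4\<close>.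
\<close>

lemma gate_timing:
  fixes k mg mh E :: nat and bp bg dp dg :: int and \<omega>p \<omega>g :: real
  defines "mp \<equiv> 4 * k + 1" and "q \<equiv> 4 * (mg * mh * 2 ^ E)"
  assumes k: "k \<ge> 2" and pos: "mg > 0" "mh > 0"
    and bp: "(bp * int mh) mod int mp = 1" and two: "(4 * 2 ^ E) mod int mp = 1"
    and cop: "coprime bg (int (mg * mh))" and odd: "(mg * mh) mod 4 = 1" and dg: "dg mod 4 = 1"
    and \<omega>p: "\<omega>p = bp / (real mp * real mg) - dp / 2 ^ E" and \<omega>g: "\<omega>g = bg / (real mg * real mh) - dg / (4 * 2 ^ E)"
  shows "\<And>t :: nat. t mod q \<noteq> q div 4 \<Longrightarrow> - sin (2 * pi * (t * \<omega>g)) \<le> cos (2 * pi / q)"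
    and "\<And>t :: nat. t mod q = q div 4 \<Longrightarrow> cis (2 * pi * (t * \<omega>g)) = - \<i>"
    and "\<And>t j :: nat. t mod (mp * q) = mp * q div 4 + j * q \<Longrightarrow>
       t mod q = q div 4 \<and> cis (2 * pi * (t * \<omega>p)) = cis (2 * pi * (j / mp))"
    and "\<And>t :: nat. t mod q = q div 4 \<Longrightarrow> \<exists>j<mp. cis (2 * pi * (t * \<omega>p)) = cis (2 * pi * (real j / mp)) \<and>
       (j \<in> {1, 2} \<longrightarrow> t mod (mp * q) = mp * q div 4 + j * q)"
proof -
  define m where "m = int (mg * mh)"
  define a where "a = bg * (4 * 2 ^ E) - m * dg"
  define q4 where "q4 = mg * mh * 2 ^ E"
  have q: "q = 4 * q4" "q div 4 = q4" by (simp_all add: q_def q4_def)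
  have qpos: "q > 0" "q4 > 0" using pos by (auto simp: q_def q4_def)
  have mp: "mp > 0" by (simp add: mp_def)
  have m4: "m mod 4 = 1" unfolding m_def using odd by (metis of_nat_1 of_nat_mod of_nat_numeral)
  have q\<omega>g: "real q * \<omega>g = of_int a"
    using pos by (simp add: q_def a_def m_def \<omega>g field_simps)
  have oa: "a mod 4 = 3"
  proof -
    have "(m * dg) mod 4 = ((m mod 4) * (dg mod 4)) mod 4" by (simp only: mod_mult_eq)
    then have "(m * dg) mod 4 = 1" using m4 dg by simp
    moreover have "(4 * x - y) mod 4 = 3" if "y mod 4 = 1" for x y :: int using that by presburger
    ultimately have "(4 * (bg * 2 ^ E) - m * dg) mod 4 = 3" by blast
    then show ?thesis by (simp add: a_def mult.left_commute)
  qed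
  have cop_a: "coprime a (int q)"
  proof -
    have "coprime a 2" using oa by (simp add: coprime_right_2_iff_odd) presburger
    then have c2: "coprime a (4 * 2 ^ E)"
      by (metis coprime_mult_right_iff coprime_power_right_iff mult_2_right numeral_Bit0 mult_2)
    have "coprime m 2" using m4 by (simp add: coprime_right_2_iff_odd) presburger
    then have "coprime (4 * 2 ^ E) m"
      by (metis coprime_commute coprime_mult_right_iff coprime_power_right_iff mult_2_right numeral_Bit0 mult_2)
    then have "coprime (bg * (4 * 2 ^ E)) m" using cop by (simp add: m_def)
    then have "gcd m (bg * (4 * 2 ^ E)) = 1" by (simp add: coprime_iff_gcd_eq_1 gcd.commute)
    moreover have "gcd m ((- dg) * m + bg * (4 * 2 ^ E)) = gcd m (bg * (4 * 2 ^ E))" by (rule gcd_add_mult)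
    moreover have "(- dg) * m + bg * (4 * 2 ^ E) = a" by (simp add: a_def)
    ultimately have "coprime a m" by (simp add: coprime_iff_gcd_eq_1 gcd.commute)
    moreover have "int q = m * (4 * 2 ^ E)" by (simp add: q_def m_def)
    ultimately show ?thesis using c2 by simp
  qed
  have c4: "cis (2 * pi * (-1/4)) = - \<i>" by (simp add: complex_eq_iff)
  show gate: "cis (2 * pi * (t * \<omega>g)) = - \<i>" if t: "t mod q = q div 4" for t :: nat
  proof -
    define l where "l = t div q"
    have "t = q * l + q4" using t q(2) mult_div_mod_eq[of q t] by (simp add: l_def)
    then have "real t * \<omega>g = real l * (real q * \<omega>g) + (real q * \<omega>g) / 4"
      using q(1) by (simp add: algebra_simps)
    also have "\<dots> = real l * a + a / 4" by (simp add: q\<omega>g)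
    finally have e: "real t * \<omega>g = real l * a + a / 4" .
    obtain a' where "a = 4 * a' + 3" using oa by (metis mult_div_mod_eq)
    then have "real t * \<omega>g - (-1/4) = of_int (int l * a + a' + 1)" unfolding e by (simp add: field_simps)
    then have "real t * \<omega>g - (-1/4) \<in> \<int>" by (metis Ints_of_int)
    from cis_eq_if_diff_Ints[OF this] show ?thesis by (simp only: c4)
  qed
  show "- sin (2 * pi * (t * \<omega>g)) \<le> cos (2 * pi / q)" if t: "t mod q \<noteq> q div 4" for t :: nat
  proof -
    define z where "z = int t * a + int q4"
    define r where "r = z mod int q"
    have "\<not> int q dvd z"
    proof
      assume "int q dvd z"
      moreover have "int q dvd int q4 * (a + 1)"
      proof -
        have "4 dvd a + 1" using oa by presburger
        then show ?thesis unfolding q by (simp add: mult.commute mult_dvd_mono)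
      qed
      ultimately have "int q dvd z - int q4 * (a + 1)" by (rule dvd_diff)
      also have "z - int q4 * (a + 1) = a * (int t - int q4)" by (simp add: z_def algebra_simps)
      finally have "int q dvd int t - int q4"
        using cop_a by (simp add: coprime_dvd_mult_right_iff coprime_commute)
      then have "int t mod int q = int q4 mod int q" by (simp add: mod_eq_dvd_iff)
      then have "t mod q = q4 mod q" by (metis of_nat_eq_iff of_nat_mod)
      then show False using t q qpos by simp
    qed
    then have "r \<noteq> 0" by (simp add: r_def dvd_eq_mod_eq_0)
    moreover have "0 \<le> r" "r < int q" using qpos by (auto simp: r_def)
    ultimately have r: "1 \<le> r" "r + 1 \<le> int q" by auto
    have "real t * \<omega>g + 1/4 = z / q"
    proof -
      have "real q * (real t * \<omega>g + 1/4) = real t * (real q * \<omega>g) + real q / 4" by (simp add: algebra_simps)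
      also have "real q / 4 = real q4" by (simp add: q(1))
      also have "real t * (real q * \<omega>g) + real q4 = of_int z" unfolding q\<omega>g z_def by simp
      finally show ?thesis using qpos by (simp add: field_simps)
    qed
    then have "- sin (2 * pi * (t * \<omega>g)) = cos (2 * pi * (z / q))"
      using cos_add[of "2 * pi * (t * \<omega>g)" "pi/2"] by (simp add: algebra_simps flip: \<open>real t * \<omega>g + 1/4 = z / q\<close>)
    also have "\<dots> = cos (2 * pi * (r / q))"
    proof -
      have "z = int q * (z div int q) + r" by (simp add: r_def)
      then have "of_int z = real q * of_int (z div int q) + real_of_int r" by (metis of_int_add of_int_mult of_int_of_nat_eq)
      then have "z / q - r / q = of_int (z div int q)" using qpos by (simp add: field_simps)
      then have "z / q - r / q \<in> \<int>" by (metis Ints_of_int)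
      from cis_eq_if_diff_Ints[OF this] show ?thesis by (metis cis.sel(1))
    qed
    also have "\<dots> \<le> cos (2 * pi / q)"
      using cos_le_cos_first[of r q] r by (simp add: mult.assoc)
    finally show ?thesis .
  qed
  obtain s where s: "bp * int mh = 1 + int mp * s" using bp by (metis add.commute mult_div_mod_eq)
  obtain u where u: "4 * 2 ^ E = 1 + int mp * u" using two by (metis add.commute mult_div_mod_eq)
  have "int mp dvd 4 * (2 ^ E + int k)"
  proof -
    have "4 * (2 ^ E + int k) = int mp * (1 + u)" using u by (simp add: mp_def algebra_simps)
    then show ?thesis by simp
  qed
  moreover have "coprime (int mp) 4"
  proof -
    have "coprime (int mp) 2" by (simp add: coprime_right_2_iff_odd mp_def)
    then show ?thesis by (metis coprime_mult_right_iff mult_2_right numeral_Bit0 mult_2)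
  qed
  ultimately have "int mp dvd 2 ^ E + int k" by (metis coprime_dvd_mult_right_iff)
  then obtain v where v: "2 ^ E = int mp * v - int k" by (auto simp: dvd_def algebra_simps)
  have q\<omega>p: "\<exists>A::int. real q * \<omega>p = 1 / mp + A"
  proof -
    have "real q * \<omega>p = real_of_int ((bp * int mh) * (4 * 2 ^ E)) / mp - real_of_int (4 * m * dp)"
      using pos mp by (simp add: q_def \<omega>p m_def field_simps)
    also have "(bp * int mh) * (4 * 2 ^ E) = 1 + int mp * (s + u + int mp * s * u)"
      unfolding s u by (simp add: algebra_simps)
    also have "real_of_int \<dots> / mp = 1 / mp + (s + u + int mp * s * u)" using mp by (simp add: field_simps)
    finally show ?thesis by (metis (no_types, opaque_lifting) add_diff_eq of_int_diff)
  qed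
  have q4\<omega>p: "\<exists>B::int. real q4 * \<omega>p = - k / mp + B"
  proof -
    have "real q4 * \<omega>p = real_of_int ((bp * int mh) * 2 ^ E) / mp - real_of_int (m * dp)"
      using pos mp by (simp add: q4_def \<omega>p m_def field_simps)
    also have "(bp * int mh) * 2 ^ E = - int k + int mp * (v - int k * s + int mp * s * v)"
      unfolding s v by (simp add: algebra_simps)
    also have "real_of_int \<dots> / mp = - k / mp + (v - int k * s + int mp * s * v)" using mp by (simp add: field_simps)
    finally show ?thesis by (metis (no_types, opaque_lifting) add_diff_eq of_int_diff)
  qed
  have phase: "cis (2 * pi * (t * \<omega>p)) = cis (2 * pi * (j / mp))"
    if t: "t = q * l + q4" and w: "int l = int k + int j + int mp * w" for t l j w
  proof -
    obtain A B :: int where A: "real q * \<omega>p = 1 / mp + A" and B: "real q4 * \<omega>p = - k / mp + B"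
      using q\<omega>p q4\<omega>p by blast
    have "real t * \<omega>p = real l * (real q * \<omega>p) + real q4 * \<omega>p" using t by (simp add: algebra_simps)
    also have "\<dots> = (real l - k) / mp + of_int (int l * A + B)" unfolding A B
      by (simp add: algebra_simps diff_divide_distrib)
    also have "real l = real k + real j + mp * w" using w by (metis of_int_add of_int_mult of_int_of_nat_eq)
    also have "(real k + real j + mp * w - k) / mp = j / mp + w" using mp by (simp add: field_simps)
    finally have "real t * \<omega>p - j / mp = of_int (w + (int l * A + B))" by simp
    then have "real t * \<omega>p - j / mp \<in> \<int>" by (metis Ints_of_int)
    then show ?thesis by (rule cis_eq_if_diff_Ints)
  qed
  have mpq: "mp * q div 4 = k * q + q4" using q by (simp add: mp_def algebra_simps)
  show "t mod q = q div 4 \<and> cis (2 * pi * (t * \<omega>p)) = cis (2 * pi * (j / mp))"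
    if t: "t mod (mp * q) = mp * q div 4 + j * q" for t j :: nat
  proof -
    define c where "c = t div (mp * q)"
    have "t = mp * q * c + (k * q + q4 + j * q)" using t mpq mult_div_mod_eq[of "mp * q" t] by (simp add: c_def)
    then have t': "t = q * (mp * c + k + j) + q4" by (simp add: algebra_simps)
    then have "t mod q = q4" using q qpos by (simp add: mod_mult_self3)
    moreover have "cis (2 * pi * (t * \<omega>p)) = cis (2 * pi * (j / mp))"
      by (rule phase[OF t', of j "int c"]) simp
    ultimately show ?thesis using q by simp
  qed
  show "\<exists>j<mp. cis (2 * pi * (t * \<omega>p)) = cis (2 * pi * (j / mp)) \<and>
       (j \<in> {1, 2} \<longrightarrow> t mod (mp * q) = mp * q div 4 + j * q)" if t: "t mod q = q div 4" for t :: nat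
  proof -
    define l where "l = t div q"
    have tl: "t = q * l + q4" using t q(2) mult_div_mod_eq[of q t] by (simp add: l_def)
    define j where "j = nat ((int l - int k) mod int mp)"
    define w where "w = (int l - int k) div int mp"
    have j: "int j = (int l - int k) mod int mp" using mp by (simp add: j_def)
    have w: "int l = int k + int j + int mp * w" unfolding j w_def by (simp add: algebra_simps)
    have "int j < int mp" using mp unfolding j by simp
    then have "j < mp" by simp
    moreover have "t mod (mp * q) = mp * q div 4 + j * q" if j12: "j \<in> {1, 2}"
    proof -
      have lt: "k + j < mp" using j12 k by (auto simp: mp_def)
      have "int l mod int mp = int (k + j) mod int mp" unfolding w by simp
      then have "l mod mp = k + j" using lt by (metis mod_less of_nat_eq_iff of_nat_mod)
      then have "t mod (q * mp) = q * (k + j) + q4"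
        using t q(2) by (simp add: mod_mult2_eq l_def)
      then show ?thesis by (simp add: mpq algebra_simps)
    qed
    ultimately show ?thesis using phase[OF tl w] by blast
  qed
qed

text \<open>
  Pairwise coprime, and congruent to \<open>1\<close> modulo \<open>4\<close> as the timing requires.
\<close>

definition modulus :: "3 \<Rightarrow> nat" where
  "modulus i = (if i = 1 then 9 else if i = 2 then 13 else 17)"

text \<open>
  The denominator is the product of the moduli \<open>m\<^sub>i m\<^sub>i\<^sub>+\<^sub>1\<close> (cyclically), and the numerator
  is the inverse of the third modulus modulo \<open>m\<^sub>i\<close>.
\<close>

definition base_freq :: "3 \<Rightarrow> real" where
  "base_freq i = (if i = 1 then 8 / 117 else if i = 2 then 3 / 221 else 4 / 153)"

text \<open>
  Here \<open>1989 = 9 * 13 * 17\<close> is the product of the moduli.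
\<close>

definition cycle :: "nat \<Rightarrow> nat" where
  "cycle e = 1989 * 2 ^ e"

text \<open>
  The frequencies of a stage: plane \<open>p\<close> is pushed and plane \<open>p + 1\<close> is its gate. The gate frequency has the
  full denominator \<open>2 ^ e\<close>, the pushed one at most a quarter of it. The exponent is a multiple of \<open>24\<close>
  because \<open>2 ^ 24\<close> is \<open>1\<close> modulo each of the moduli, so the residues needed for the timing do not change from stage to
  stage.
\<close>

definition freq_ok :: "3 \<Rightarrow> nat \<Rightarrow> real ^ 3 \<Rightarrow> bool" where
  "freq_ok p e \<omega> \<longleftrightarrow> 24 dvd e \<and> e > 0 \<and>
     (\<exists>d::int. \<omega> $ p = base_freq p - 4 * d / 2 ^ e) \<and>
     (\<exists>d::int. d mod 4 = 1 \<and> \<omega> $ (p + 1) = base_freq (p + 1) - d / 2 ^ e) \<and>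
     (\<exists>d::int. \<omega> $ (p + 2) = base_freq (p + 2) - d / 2 ^ e)"

lemma three_cases: "i = (1::3) \<or> i = 2 \<or> i = 3" using exhaust_3 by blast

lemma three_arith [simp]:
  "(1::3) + 1 = 2" "(2::3) + 1 = 3" "(3::3) + 1 = 1" "(1::3) + 2 = 3" "(2::3) + 2 = 1" "(3::3) + 2 = 2"
  "(1::3) \<noteq> 2" "(2::3) \<noteq> 1" "(1::3) \<noteq> 3" "(3::3) \<noteq> 1" "(2::3) \<noteq> 3" "(3::3) \<noteq> 2"
  by simp_all

lemma modulus_bounds: "9 \<le> modulus i" "modulus i \<le> 17" "modulus i mod 4 = 1"
  by (auto simp: modulus_def)

lemma modulus_dvd: "modulus i dvd 1989"
  by (auto simp: modulus_def)

lemma two_power_mod_modulus: "24 dvd e \<Longrightarrow> (2::nat) ^ e mod modulus i = 1"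
proof -
  assume "24 dvd e"
  then obtain r where r: "e = 24 * r" by blast
  have "(2::nat) ^ 24 mod modulus i = 1" by (auto simp: modulus_def)
  then have "((2::nat) ^ 24) ^ r mod modulus i = 1 ^ r mod modulus i" by (metis power_mod)
  then show ?thesis using modulus_bounds(1)[of i] by (simp add: r power_mult)
qed

lemma coprime_bezout:
  fixes a b :: int
  assumes "a * x + b * y = 1" shows "coprime a b"
proof (rule coprimeI)
  fix c assume "c dvd a" "c dvd b"
  then have "c dvd a * x + b * y" by (intro dvd_add dvd_mult2)
  then show "is_unit c" using assms by simp
qed

lemma freq_timing:
  assumes "freq_ok p e \<omega>"
  defines "q \<equiv> cycle e div modulus p"
  shows "\<And>t :: nat. t mod q \<noteq> q div 4 \<Longrightarrow> - sin (2 * pi * (t * \<omega> $ (p + 1))) \<le> cos (2 * pi / q)"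
    and "\<And>t :: nat. t mod q = q div 4 \<Longrightarrow> cis (2 * pi * (t * \<omega> $ (p + 1))) = - \<i>"
    and "\<And>t j :: nat. t mod cycle e = cycle e div 4 + j * q \<Longrightarrow>
       t mod q = q div 4 \<and> cis (2 * pi * (t * \<omega> $ p)) = cis (2 * pi * (j / modulus p))"
    and "\<And>t :: nat. t mod q = q div 4 \<Longrightarrow> \<exists>j<modulus p. cis (2 * pi * (t * \<omega> $ p)) = cis (2 * pi * (real j / modulus p)) \<and>
       (j \<in> {1, 2} \<longrightarrow> t mod cycle e = cycle e div 4 + j * q)"
    and "4 \<le> q"
proof -
  have e: "24 dvd e" "e > 0" using assms by (auto simp: freq_ok_def)
  then have "e \<ge> 2" by (auto dest: dvd_imp_le)
  then obtain E where E: "e = E + 2" by (metis le_add_diff_inverse2)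
  have two: "(4 * 2 ^ E) mod int (modulus p) = 1"
  proof -
    have "int ((2::nat) ^ e mod modulus p) = 1" by (simp only: two_power_mod_modulus[OF e(1)] of_nat_1)
    then show ?thesis unfolding E of_nat_mod by (simp add: power_add mult.commute)
  qed
  have C: "cycle e = modulus p * q" using modulus_dvd[of p] by (simp add: q_def cycle_def dvd_mult2)
  obtain dp dg :: int where d: "\<omega> $ p = base_freq p - 4 * dp / 2 ^ e" "dg mod 4 = 1"
    "\<omega> $ (p + 1) = base_freq (p + 1) - dg / 2 ^ e"
    using assms(1) by (auto simp: freq_ok_def)
  have d': "\<omega> $ p = base_freq p - dp / 2 ^ E" "\<omega> $ (p + 1) = base_freq (p + 1) - dg / (4 * 2 ^ E)"
    unfolding d E by (simp_all add: power_add)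
  consider "p = 1" | "p = 2" | "p = 3" using three_cases by blast
  then have "\<exists>k mg mh bp bg. modulus p = 4 * k + 1 \<and> q = 4 * (mg * mh * 2 ^ E) \<and> k \<ge> 2 \<and> mg > 0 \<and> mh > 0 \<and>
     (bp * int mh) mod int (modulus p) = 1 \<and> coprime bg (int (mg * mh)) \<and> (mg * mh) mod 4 = 1 \<and>
     base_freq p = bp / (real (modulus p) * real mg) \<and> base_freq (p + 1) = bg / (real mg * real mh)"
  proof cases
    case 1
    then show ?thesis
      by (intro exI[of _ 2] exI[of _ 13] exI[of _ 17] exI[of _ 8] exI[of _ 3])
         (simp add: modulus_def base_freq_def q_def cycle_def E power_add coprime_bezout[of 3 74 221 "-1"])
  next
    case 2
    then show ?thesis
      by (intro exI[of _ 3] exI[of _ 17] exI[of _ 9] exI[of _ 3] exI[of _ 4])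
         (simp add: modulus_def base_freq_def q_def cycle_def E power_add coprime_bezout[of 4 "-38" 153 1])
  next
    case 3
    then show ?thesis
      by (intro exI[of _ 4] exI[of _ 9] exI[of _ 13] exI[of _ 4] exI[of _ 8])
         (simp add: modulus_def base_freq_def q_def cycle_def E power_add coprime_bezout[of 8 44 117 "-3"])
  qed
  then obtain k mg mh :: nat and bp bg :: int where g: "modulus p = 4 * k + 1" "q = 4 * (mg * mh * 2 ^ E)" "k \<ge> 2" "mg > 0" "mh > 0"
     "(bp * int mh) mod int (modulus p) = 1" "coprime bg (int (mg * mh))" "(mg * mh) mod 4 = 1"
     "base_freq p = bp / (real (modulus p) * real mg)" "base_freq (p + 1) = bg / (real mg * real mh)"
    by blast
  show "4 \<le> q" using g(2,4,5) by (simp add: Suc_le_eq)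
  note T = gate_timing[of k mg mh bp E bg dg "\<omega> $ p" dp "\<omega> $ (p + 1)", folded g(1,2), OF g(3-6) two g(7,8) d(2) d'[unfolded g(9,10)], folded C]
  show "\<And>t :: nat. t mod q \<noteq> q div 4 \<Longrightarrow> - sin (2 * pi * (t * \<omega> $ (p + 1))) \<le> cos (2 * pi / q)" by (rule T(1))
  show "\<And>t :: nat. t mod q = q div 4 \<Longrightarrow> cis (2 * pi * (t * \<omega> $ (p + 1))) = - \<i>" by (rule T(2))
  show "\<And>t j :: nat. t mod cycle e = cycle e div 4 + j * q \<Longrightarrow>
       t mod q = q div 4 \<and> cis (2 * pi * (t * \<omega> $ p)) = cis (2 * pi * (j / modulus p))" by (rule T(3))
  show "\<And>t :: nat. t mod q = q div 4 \<Longrightarrow> \<exists>j<modulus p. cis (2 * pi * (t * \<omega> $ p)) = cis (2 * pi * (real j / modulus p)) \<and>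
       (j \<in> {1, 2} \<longrightarrow> t mod cycle e = cycle e div 4 + j * q)" by (rule T(4))
qed

lemma freq_ok_periodic:
  assumes "freq_ok p e \<omega>"
  shows "real (cycle e) * \<omega> $ i \<in> \<int>"
proof -
  have *: "real (cycle e) * (base_freq i - of_int d / 2 ^ e) \<in> \<int>" for d :: int
  proof -
    have "real (cycle e) * (base_freq i - of_int d / 2 ^ e) = (1989 * base_freq i) * 2 ^ e - 1989 * of_int d"
      by (simp add: cycle_def field_simps)
    moreover have "1989 * base_freq i \<in> \<int>" by (simp add: base_freq_def)
    ultimately show ?thesis by (simp add: Ints_mult Ints_diff)
  qed
  have "i = p \<or> i = p + 1 \<or> i = p + 2" using three_cases[of i] three_cases[of p] by auto
  then show ?thesis using assms *[of "4 * _"] * by (auto simp: freq_ok_def)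
qed

text \<open>
  Subtracting \<open>1 / 2 ^ e'\<close> from the idle frequency turns the idle plane into the gate of the next stage,
  while the two other frequencies get a smaller denominator relative to \<open>2 ^ e'\<close>.
\<close>

lemma freq_ok_advance:
  assumes "freq_ok p e \<omega>" "24 dvd e'" "e < e'"
  shows "freq_ok (p + 1) e' (\<chi> i. if i = p + 2 then \<omega> $ i - 1 / 2 ^ e' else \<omega> $ i)"
proof -
  have p: "p + 1 + 1 = p + 2" "p + 1 + 2 = p" "p + 2 \<noteq> p" "p + 1 \<noteq> p + 2" using three_cases[of p] by auto
  have e: "24 dvd e" using assms by (simp add: freq_ok_def)
  have "24 dvd e' - e" using e assms by simp
  then have "24 \<le> e' - e" using assms by (intro dvd_imp_le) auto
  then have "e' = e + ((e' - e - 2) + 2)" using assms by linarith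
  then obtain f where f: "e' = e + (f + 2)" by blast
  have sc: "real_of_int d / 2 ^ e = real_of_int (d * 2 ^ (f + 2)) / 2 ^ e'" for d
    by (simp add: f power_add)
  obtain d0 d1 d2 :: int where d: "\<omega> $ p = base_freq p - real_of_int (4 * d0) / 2 ^ e" "d1 mod 4 = 1" "\<omega> $ (p + 1) = base_freq (p + 1) - d1 / 2 ^ e"
    "\<omega> $ (p + 2) = base_freq (p + 2) - d2 / 2 ^ e"
    using assms(1) by (auto simp: freq_ok_def)
  have "\<omega> $ (p + 1) = base_freq (p + 1) - 4 * real_of_int (d1 * 2 ^ f) / 2 ^ e'"
    unfolding d sc by (simp add: power_add)
  moreover have "(d2 * 2 ^ (f + 2) + 1) mod 4 = 1"
  proof -
    have "d2 * 2 ^ (f + 2) + 1 = 4 * (d2 * 2 ^ f) + 1" by (simp add: power_add)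
    then show ?thesis by presburger
  qed
  moreover have "\<omega> $ (p + 2) - 1 / 2 ^ e' = base_freq (p + 2) - real_of_int (d2 * 2 ^ (f + 2) + 1) / 2 ^ e'"
    unfolding d sc by (simp add: add_divide_distrib)
  moreover have "\<omega> $ p = base_freq p - real_of_int (4 * d0 * 2 ^ (f + 2)) / 2 ^ e'"
    unfolding d by (subst sc) simp
  ultimately show ?thesis
    using assms(2,3) p unfolding freq_ok_def p(1,2)
    by (intro conjI exI[of _ "d1 * 2 ^ f"] exI[of _ "d2 * 2 ^ (f + 2) + 1"] exI[of _ "4 * d0 * 2 ^ (f + 2)"])
       (simp_all only: vec_lambda_beta if_True if_False refl, simp_all)
qed

lemma nat_quarter_bound:
  fixes X y c :: nat
  assumes "X * 9 \<le> c" "4 \<le> X" "y \<le> 2 * X"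
  shows "y < c div 4" "y < c"
  using assms by linarith+

text \<open>
  Within the shorter cycle of the earlier pulse, the kicks of the later one come before the first quarter and
  hence before both kicks of the earlier pulse. So the two pulses never act at the same time, and the later
  one never acts between the two kicks of the earlier one.
\<close>

lemma kick_time_lower:
  assumes "24 dvd e" "24 dvd e'" "e < e'" "j \<in> {1, 2}"
    and t: "t mod cycle e' = cycle e' div 4 + j * (cycle e' div modulus p)"
  shows "t mod cycle e = j * (cycle e div modulus p)" "j * (cycle e div modulus p) < cycle e div 4" "0 < j * (cycle e div modulus p)"
proof -
  have d: "24 dvd e' - e" using assms by simp
  then have "24 \<le> e' - e" using assms by (intro dvd_imp_le) auto
  then have "e' = e + ((e' - e - 2) + 2)" using assms by linarith
  then obtain f where f: "e' = e + (f + 2)" by blast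
  obtain M where M: "1989 = modulus p * M" using modulus_dvd[of p] by blast
  have mpos: "modulus p > 0" using modulus_bounds(1)[of p] by simp
  have Cm: "cycle e div modulus p = M * 2 ^ e" "cycle e' div modulus p = M * 2 ^ e'"
    using mpos by (simp_all add: cycle_def M mult.assoc)
  obtain s where s: "(2::nat) ^ (f + 2) = 1 + modulus p * s"
    using two_power_mod_modulus[OF d, of p] f by (metis add.commute add_diff_cancel_left' mod_mult_div_eq)
  have C: "cycle e = modulus p * M * 2 ^ e" by (simp add: cycle_def M)
  have C': "cycle e' = cycle e * 2 ^ (f + 2)" by (simp add: cycle_def f power_add)
  have 4: "cycle e' div 4 = cycle e * 2 ^ f" by (simp add: C')
  have "cycle e' div modulus p = M * 2 ^ e * (1 + modulus p * s)"
    unfolding s[symmetric] Cm(2) by (simp add: f power_add)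
  then have m: "j * (cycle e' div modulus p) = j * (M * 2 ^ e) + cycle e * (j * s)" by (simp add: C algebra_simps)
  have dv: "cycle e dvd cycle e'" using C' by simp
  have "M * 2 ^ e * 9 \<le> cycle e" using modulus_bounds(1)[of p] by (simp add: C)
  have "M * 2 ^ e > 0" using M by (cases M) auto
  have lt: "j * (M * 2 ^ e) \<le> 2 * (M * 2 ^ e)" using assms(4) by auto
  show "j * (cycle e div modulus p) < cycle e div 4" "0 < j * (cycle e div modulus p)"
  proof -
    have "4 \<le> M * 2 ^ e"
      proof -
        have "M \<ge> 117"
        proof (rule ccontr)
          assume "\<not> M \<ge> 117"
          then have "modulus p * M \<le> 17 * 116" using modulus_bounds(2) by (intro mult_le_mono) auto
          then show False unfolding M[symmetric] by simp
        qed
        then have "117 * 1 \<le> M * 2 ^ e" by (intro mult_le_mono) auto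
        then show ?thesis by linarith
      qed
    then show "j * (cycle e div modulus p) < cycle e div 4"
      unfolding Cm using nat_quarter_bound(1)[OF \<open>M * 2 ^ e * 9 \<le> cycle e\<close> _ lt] by blast
    show "0 < j * (cycle e div modulus p)" unfolding Cm using \<open>M * 2 ^ e > 0\<close> assms(4) by auto
  qed
  have "t mod cycle e = (t mod cycle e') mod cycle e" using dv by (simp add: mod_mod_cancel)
  also have "\<dots> = (cycle e * (2 ^ f + j * s) + j * (M * 2 ^ e)) mod cycle e"
    unfolding t 4 m by (simp add: algebra_simps)
  also have "\<dots> = j * (M * 2 ^ e)"
  proof -
    have "j * (M * 2 ^ e) < cycle e"
      using \<open>j * (cycle e div modulus p) < cycle e div 4\<close> unfolding Cm by (rule less_le_trans) (rule div_le_dividend)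
    then show ?thesis by (simp only: mod_mult_self4 mod_less)
  qed
  finally show "t mod cycle e = j * (cycle e div modulus p)" by (simp add: Cm)
qed

text \<open>
  Seen at the openings of the gate, the pushed plane occupies the positions \<open>- r sin (2 pi j / m)\<close>. The
  kicks take place at \<open>j = 1\<close> and \<open>j = 2\<close>, and these two positions have to be away from all the others.
\<close>

definition separated :: "real \<Rightarrow> bool" where
  "separated \<eta> \<longleftrightarrow> 0 < \<eta> \<and> \<eta> < 1 / 100 \<and>
     (\<forall>p. \<forall>j<modulus p. \<forall>i\<in>{1, 2}. j \<noteq> i \<longrightarrow>
        10 * \<eta> \<le> \<bar>sin (2 * pi * (real j / modulus p)) - sin (2 * pi * (real i / modulus p))\<bar>)"

text \<open>
  Two sines agree only if the angles agree or sum to a half turn; the latter is impossible for an odd number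
  of equidistant phases.
\<close>

lemma sin_distinct:
  assumes m: "odd m" and ij: "i < m" "j < m" "i \<noteq> j"
  shows "sin (2 * pi * (real j / m)) \<noteq> sin (2 * pi * (real i / m))"
proof
  assume "sin (2 * pi * (real j / m)) = sin (2 * pi * (real i / m))"
  then have "2 * sin ((2 * pi * (real j / m) - 2 * pi * (real i / m)) / 2) * cos ((2 * pi * (real j / m) + 2 * pi * (real i / m)) / 2) = 0"
    by (subst sin_diff_sin[symmetric]) simp
  then consider "sin (pi * ((real j - real i) / m)) = 0" | "cos (pi * ((real j + real i) / m)) = 0"
    by (auto simp: algebra_simps diff_divide_distrib add_divide_distrib)
  then show False
  proof cases
    case 1
    then obtain n :: int where "pi * ((real j - real i) / m) = n * pi" unfolding sin_zero_iff_int2 by blast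
    then have "pi * ((real j - real i) / m) = pi * n" by (simp only: mult.commute)
    then have "(real j - real i) / m = n" by (metis mult_left_cancel pi_neq_zero)
    then have "real j - real i = n * m" using ij by (simp add: field_simps)
    then have "real_of_int (int j - int i) = real_of_int (n * int m)" by simp
    then have "int j - int i = n * int m" by (simp only: of_int_eq_iff)
    then have "int m dvd int j - int i" by simp
    then have "int j mod int m = int i mod int m" by (simp add: mod_eq_dvd_iff)
    then show False using ij by simp
  next
    case 2
    then obtain n :: int where "pi * ((real j + real i) / m) = n * pi + pi / 2" unfolding cos_zero_iff_int2 by blast
    then have "pi * ((real j + real i) / m) = pi * (n + 1/2)" by (simp add: algebra_simps)
    then have "(real j + real i) / m = n + 1/2" by (metis mult_left_cancel pi_neq_zero)
    then have "2 * (real j + real i) = (2 * n + 1) * m" using ij by (simp add: field_simps)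
    then have "real_of_int (2 * (int j + int i)) = real_of_int ((2 * n + 1) * int m)" by simp
    then have "2 * (int j + int i) = (2 * n + 1) * int m" by (simp only: of_int_eq_iff)
    then have "even ((2 * n + 1) * int m)" by (metis dvd_triv_left)
    then show False using m by simp
  qed
qed

lemma separated_exists: "\<exists>\<eta>. separated \<eta>"
proof -
  define f where "f = (\<lambda>(p, j, i). \<bar>sin (2 * pi * (real j / modulus p)) - sin (2 * pi * (real i / modulus p))\<bar>)"
  define X where "X = {(p, j, i). j < modulus p \<and> i \<in> {1, 2::nat} \<and> j \<noteq> i}"
  have "X \<subseteq> UNIV \<times> {..17} \<times> {1, 2}" using modulus_bounds(2) unfolding X_def by (auto intro: order_trans less_imp_le)
  then have fin: "finite X" by (rule finite_subset) auto
  have pos: "f x > 0" if "x \<in> X" for x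
  proof -
    obtain p j i where x0: "x = (p, j, i)" by (cases x)
    then have x: "x = (p, j, i)" "j < modulus p" "i \<in> {1, 2::nat}" "j \<noteq> i" using that by (simp_all add: X_def)
    have "odd (modulus p)" using modulus_bounds(3)[of p] by presburger
    moreover have "i < modulus p" using x modulus_bounds(1)[of p] by auto
    ultimately show ?thesis using sin_distinct[of "modulus p" i j] x by (simp add: f_def)
  qed
  define \<eta> where "\<eta> = Min (insert 1 (f ` X)) / 200"
  have Mpos: "Min (insert 1 (f ` X)) > 0" using fin pos by (subst Min_gr_iff) auto
  have "Min (insert 1 (f ` X)) \<le> 1" using fin by (intro Min_le) auto
  moreover have "10 * \<eta> \<le> f x" if "x \<in> X" for x
  proof -
    have "Min (insert 1 (f ` X)) \<le> f x" using fin that by (intro Min_le) auto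
    then show ?thesis using Mpos by (simp add: \<eta>_def)
  qed
  ultimately have \<eta>: "0 < \<eta>" "\<eta> < 1 / 100" "\<And>x. x \<in> X \<Longrightarrow> 10 * \<eta> \<le> f x" using Mpos by (auto simp: \<eta>_def)
  have sep: "10 * \<eta> \<le> \<bar>sin (2 * pi * (real j / modulus p)) - sin (2 * pi * (real i / modulus p))\<bar>"
    if "j < modulus p" "i \<in> {1, 2}" "j \<noteq> i" for p j i
    using \<eta>(3)[of "(p, j, i)"] that by (simp add: X_def f_def)
  have "separated \<eta>"
    unfolding separated_def by (intro conjI allI impI ballI \<eta> sep)
  then show ?thesis by blast
qed

section \<open>Pulses\<close>

definition grad :: "((3 \<Rightarrow> nat) \<Rightarrow> real ^ 3 \<Rightarrow> real) \<Rightarrow> real ^ 3 \<Rightarrow> real ^ 3" where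
  "grad D x = (\<chi> i. D (inc i (\<lambda>_. 0)) x)"

definition pair_vec :: "3 \<Rightarrow> real \<Rightarrow> real \<Rightarrow> real ^ 3" where
  "pair_vec p u w = (\<chi> i. if i = p then u else if i = p + 1 then w else 0)"

text \<open>
  What the dynamics needs to know of a force \<open>v\<close> that pushes plane \<open>p\<close> through the gate \<open>p + 1\<close>, for
  frequencies \<open>wp\<close> and \<open>wg\<close>. The points \<open>zp\<close> and \<open>zg\<close> are in co-rotating coordinates, close to
  \<open>\<i> r\<close> and \<open>\<i> r'\<close> with tolerances \<open>\<delta>p\<close> and \<open>\<delta>g\<close>. The four parts say: there is no force except at
  two times of each cycle; at these times the phases are \<open>\<beta>\<close> and \<open>2 \<beta>\<close>, with \<open>\<beta> = 2 pi / m\<close>, and the gate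
  is at its widest; then come the strengths of the first and of the second kick. Radii are pushed towards
  \<open>a\<close>.
\<close>

definition pulse :: "3 \<Rightarrow> nat \<Rightarrow> real \<Rightarrow> real \<Rightarrow> real \<Rightarrow> real \<Rightarrow> real \<Rightarrow> real \<Rightarrow> real \<Rightarrow>
    (real \<Rightarrow> real) \<Rightarrow> (real \<Rightarrow> real) \<Rightarrow> (real ^ 3 \<Rightarrow> real ^ 3) \<Rightarrow> bool" where
  "pulse p e wp wg a R rg \<delta>p \<delta>g lam mu v \<longleftrightarrow>
     (\<forall>t r r' zp zg x. r \<in> {a..R} \<longrightarrow> r' \<in> {0..rg} \<longrightarrow> cmod (zp - \<i> * r) \<le> \<delta>p \<longrightarrow> cmod (zg - \<i> * r') \<le> \<delta>g \<longrightarrow>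
        t mod cycle e \<noteq> cycle e div 4 + 1 * (cycle e div modulus p) \<longrightarrow>
        t mod cycle e \<noteq> cycle e div 4 + 2 * (cycle e div modulus p) \<longrightarrow>
        x $ p = Re (zp * cis (2 * pi * (real t * wp))) \<longrightarrow> x $ (p + 1) = Re (zg * cis (2 * pi * (real t * wg))) \<longrightarrow>
        v x = 0) \<and>
     (\<forall>t j. j \<in> {1, 2} \<longrightarrow> t mod cycle e = cycle e div 4 + j * (cycle e div modulus p) \<longrightarrow>
        cis (2 * pi * (real t * wp)) = cis (real j * (2 * pi / modulus p)) \<and> cis (2 * pi * (real t * wg)) = - \<i>) \<and>
     (\<forall>x r. r \<in> {a..R} \<longrightarrow> x $ p = - sin (2 * pi / modulus p) * r \<longrightarrow>
        v x = pair_vec p (2 * cos (2 * pi / modulus p) * (1 - lam (x $ (p + 1))) * (r - a)) (mu (x $ (p + 1)) * (r - a)\<^sup>2)) \<and>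
     (\<forall>x r. r \<in> {a..R} \<longrightarrow> x $ p = - sin (2 * (2 * pi / modulus p)) * r \<longrightarrow>
        v x = pair_vec p (- (1 / lam (x $ (p + 1)) - 1) * (r - a)) (- mu (x $ (p + 1)) / (lam (x $ (p + 1)))\<^sup>2 * (r - a)\<^sup>2))"

text \<open>
  Let the radii range over \<open>[(1 - \<eta>) R, R]\<close> and the errors up to \<open>\<eta> R\<close>. If a position belonging to one
  phase were in the band of another, the two would differ by at most \<open>3 \<eta> R\<close>, against a separation of
  nearly \<open>10 \<eta> R\<close>.
\<close>

lemma band_separation:
  fixes R :: real
  assumes \<eta>: "0 < \<eta>" "\<eta> < 1 / 100" and R: "R > 0" and r: "(1 - \<eta>) * R \<le> r" "r \<le> R"
    and s: "\<bar>si\<bar> \<le> 1" "10 * \<eta> \<le> \<bar>sj - si\<bar>" and x: "\<bar>x + r * sj\<bar> \<le> \<eta> * R"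
    and l: "l = min (- si * ((1 - \<eta>) * R)) (- si * R)" and h: "h = max (- si * ((1 - \<eta>) * R)) (- si * R)"
  shows "x \<notin> {l - \<eta> * R<..<h + \<eta> * R}"
proof
  assume xin: "x \<in> {l - \<eta> * R<..<h + \<eta> * R}"
  define y where "y = max l (min h x)"
  have lh: "l \<le> h" by (simp add: l h)
  have "0 \<le> \<eta> * R" using \<eta> R by simp
  then have xy: "\<bar>x - y\<bar> \<le> \<eta> * R" using xin lh by (auto simp: y_def min_def max_def)
  have y: "l \<le> y" "y \<le> h" using lh by (auto simp: y_def)
  have sR: "\<bar>si * (R - r)\<bar> \<le> \<eta> * R" "\<bar>si * (r - (1 - \<eta>) * R)\<bar> \<le> \<eta> * R"
  proof -
    have "\<bar>si\<bar> * \<bar>R - r\<bar> \<le> 1 * (\<eta> * R)" using s r by (intro mult_mono) (auto simp: algebra_simps)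
    then show "\<bar>si * (R - r)\<bar> \<le> \<eta> * R" by (simp add: abs_mult)
    have "\<bar>si\<bar> * \<bar>r - (1 - \<eta>) * R\<bar> \<le> 1 * (\<eta> * R)" using s r by (intro mult_mono) (auto simp: algebra_simps)
    then show "\<bar>si * (r - (1 - \<eta>) * R)\<bar> \<le> \<eta> * R" by (simp add: abs_mult)
  qed
  have "h + r * si \<le> \<eta> * R" "- (\<eta> * R) \<le> l + r * si"
    using sR unfolding l h by (auto simp: max_def min_def algebra_simps abs_le_iff)
  then have yr: "\<bar>y + r * si\<bar> \<le> \<eta> * R" using y by (auto simp: abs_le_iff)
  have "\<bar>r * (sj - si)\<bar> \<le> 3 * (\<eta> * R)" using x xy yr by (auto simp: abs_le_iff algebra_simps)
  moreover have "(1 - \<eta>) * R * (10 * \<eta>) \<le> \<bar>r\<bar> * \<bar>sj - si\<bar>"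
    using s r \<eta> R by (intro mult_mono) auto
  ultimately have "(1 - \<eta>) * 10 * (\<eta> * R) \<le> 3 * (\<eta> * R)" by (simp add: abs_mult mult_ac)
  then have "(1 - \<eta>) * 10 \<le> 3" using \<eta> R by (simp add: mult_le_cancel_right)
  then show False using \<eta> by simp
qed

text \<open>
  The intervals of the gate potential are the positions at the phases \<open>\<beta>\<close> and \<open>2 \<beta>\<close> of the radii between
  \<open>(1 - \<eta>) R\<close> and \<open>R\<close>, with vertices at radius \<open>(1 - \<eta>) R\<close>. At a time without a kick, either the gate is
  closed or the pushed plane is away from both intervals.
\<close>

lemma pulse_exists:
  assumes \<alpha>: "\<alpha> > 1" and L: "L > 0" and \<eta>: "separated \<eta>" and fo: "freq_ok p e \<omega>"
    and R: "R > 0" and rg: "rg > 0" and \<delta>g: "rg * cos (2 * pi / (cycle e div modulus p)) + \<delta>g \<le> \<gamma>" and \<mu>: "\<mu> > 0"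
  obtains D lam mu where "jet3 D" "jet3_bound \<alpha> L \<mu> D"
    "\<And>y. 0 < lam y" "\<And>y. lam y \<le> 1" "\<And>y. y > \<gamma> \<Longrightarrow> lam y < 1"
    "\<And>k x. x $ (p + 1) \<le> \<gamma> \<Longrightarrow> D k x = 0"
    "pulse p e (\<omega> $ p) (\<omega> $ (p + 1)) ((1 - \<eta>) * R) R rg (\<eta> * R) \<delta>g lam mu (grad D)"
proof -
  define q where "q = cycle e div modulus p"
  define \<beta> where "\<beta> = 2 * pi / modulus p"
  define s where "s = (\<lambda>j::nat. sin (2 * pi * (real j / modulus p)))"
  note T = freq_timing[OF fo, folded q_def]
  have \<eta>1: "0 < \<eta>" "\<eta> < 1 / 100" using \<eta> by (auto simp: separated_def)
  have sep: "10 * \<eta> \<le> \<bar>s j - s i\<bar>" if "j < modulus p" "i \<in> {1, 2}" "j \<noteq> i" for j i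
    using \<eta> that unfolding separated_def s_def by blast
  have m9: "9 \<le> modulus p" by (rule modulus_bounds)
  have s12: "s 1 = sin \<beta>" "s 2 = sin (2 * \<beta>)" by (simp_all add: s_def \<beta>_def)
  have s0: "s 1 \<noteq> 0" "s 2 \<noteq> 0" using sep[of 0 1] sep[of 0 2] m9 \<eta>1 by (auto simp: s_def)
  have sb: "\<bar>s j\<bar> \<le> 1" for j by (simp add: s_def)
  define a where "a = (1 - \<eta>) * R"
  define d where "d = \<eta> * R"
  have d: "d > 0" using \<eta>1 R by (simp add: d_def)
  define l where "l = (\<lambda>i. min (- s i * a) (- s i * R))"
  define h where "h = (\<lambda>i. max (- s i * a) (- s i * R))"
  have lh: "l i \<le> h i" for i by (simp add: l_def h_def)
  have pg: "p \<noteq> p + 1" using three_cases[of p] by auto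
  \<comment> \<open>The positions are \<open>- s i * r\<close>; the two coefficients turn them back into the strengths \<open>2 cos \<beta>\<close> and \<open>- 1\<close> of the kicks.\<close>
  define \<kappa>1 where "\<kappa>1 = - cos \<beta> / s 1"
  define \<kappa>2 where "\<kappa>2 = 1 / (2 * s 2)"
  obtain D lam dl where D: "jet3 D" "jet3_bound \<alpha> L \<mu> D"
    and lam: "\<And>x. 0 < lam x" "\<And>x. lam x \<le> 1" "\<And>x. x > \<gamma> \<Longrightarrow> lam x < 1"
    and Dg: "\<And>k x. x $ (p + 1) \<le> \<gamma> \<Longrightarrow> D k x = 0"
    and Dp: "\<And>k x. x $ p \<notin> {l 1 - d<..<h 1 + d} \<Longrightarrow> x $ p \<notin> {l 2 - d<..<h 2 + d} \<Longrightarrow> D k x = 0"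
    and D1: "\<And>x. x $ p \<in> {l 1..h 1} \<Longrightarrow> x $ p \<notin> {l 2 - d<..<h 2 + d} \<Longrightarrow>
       D (inc p (\<lambda>_. 0)) x = (1 - lam (x $ (p + 1))) * (2 * \<kappa>1 * (x $ p - (- (s 1 * a)))) \<and>
       D (inc (p + 1) (\<lambda>_. 0)) x = dl (x $ (p + 1)) * (\<kappa>1 * (x $ p - (- (s 1 * a)))\<^sup>2)"
    and D2: "\<And>x. x $ p \<in> {l 2..h 2} \<Longrightarrow> x $ p \<notin> {l 1 - d<..<h 1 + d} \<Longrightarrow>
       D (inc p (\<lambda>_. 0)) x = (1 / lam (x $ (p + 1)) - 1) * (2 * \<kappa>2 * (x $ p - (- (s 2 * a)))) \<and>
       D (inc (p + 1) (\<lambda>_. 0)) x = dl (x $ (p + 1)) / (lam (x $ (p + 1)))\<^sup>2 * (\<kappa>2 * (x $ p - (- (s 2 * a)))\<^sup>2)"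
    and D3: "\<And>i x. i \<noteq> p \<Longrightarrow> i \<noteq> p + 1 \<Longrightarrow> D (inc i (\<lambda>_. 0)) x = 0"
    using gate_potential[OF \<alpha> L pg d lh lh \<mu>, of \<gamma> 1 2 \<kappa>1 "- (s 1 * a)" \<kappa>2 "- (s 2 * a)"] by blast
  have band: "x \<notin> {l i - d<..<h i + d}" if "r \<in> {a..R}" "\<bar>x + r * s j\<bar> \<le> \<eta> * R" "i \<in> {1, 2}" "j < modulus p" "j \<noteq> i" for x r i j
    unfolding d_def
    by (rule band_separation[OF \<eta>1 R _ _ sb sep[OF that(4,3,5)] that(2) l_def[THEN fun_cong, unfolded a_def] h_def[THEN fun_cong, unfolded a_def]])
       (use that(1) in \<open>auto simp: a_def\<close>)
  have on: "- s i * r \<in> {l i..h i}" if "r \<in> {a..R}" for i r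
  proof (cases "s i \<ge> 0")
    case True
    then show ?thesis using that mult_left_mono[of a r "s i"] mult_left_mono[of r R "s i"] by (auto simp: l_def h_def)
  next
    case False
    then show ?thesis using that mult_left_mono_neg[of a r "s i"] mult_left_mono_neg[of r R "s i"] by (auto simp: l_def h_def)
  qed
  define mu where "mu = (\<lambda>y. - dl y * (s 1 * cos \<beta>))"
  have s2: "s 2 = 2 * s 1 * cos \<beta>" unfolding s12 by (simp add: sin_double)
  have rest: "grad D x = 0"
    if r: "r \<in> {a..R}" "r' \<in> {0..rg}" and zp: "cmod (zp - \<i> * r) \<le> \<eta> * R" and zg: "cmod (zg - \<i> * r') \<le> \<delta>g"
     and t: "t mod cycle e \<noteq> cycle e div 4 + 1 * q" "t mod cycle e \<noteq> cycle e div 4 + 2 * q"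
     and x: "x $ p = Re (zp * cis (2 * pi * (real t * \<omega> $ p)))" "x $ (p + 1) = Re (zg * cis (2 * pi * (real t * \<omega> $ (p + 1))))"
    for t r r' zp zg x
  proof -
    have Rec: "\<bar>Re (z * cis \<theta>) - (- \<rho> * sin \<theta>)\<bar> \<le> cmod (z - \<i> * \<rho>)" for z \<theta> and \<rho> :: real
    proof -
      have "Re (z * cis \<theta>) - (- \<rho> * sin \<theta>) = Re ((z - \<i> * \<rho>) * cis \<theta>)" by (simp add: algebra_simps)
      also have "\<bar>\<dots>\<bar> \<le> cmod ((z - \<i> * \<rho>) * cis \<theta>)" by (rule abs_Re_le_cmod)
      finally show ?thesis by (simp add: norm_mult)
    qed
    have "D k x = 0" for k
    proof (cases "t mod q = q div 4")
      case False
      have "x $ (p + 1) \<le> r' * (- sin (2 * pi * (real t * \<omega> $ (p + 1)))) + \<delta>g"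
        using Rec[of zg "2 * pi * (real t * \<omega> $ (p + 1))" r'] zg unfolding x by (simp add: abs_le_iff)
      also have "r' * (- sin (2 * pi * (real t * \<omega> $ (p + 1)))) \<le> r' * cos (2 * pi / q)"
        using T(1)[OF False] r by (intro mult_left_mono) auto
      also have "r' * cos (2 * pi / q) \<le> rg * cos (2 * pi / q)"
      proof -
        have "2 * pi / q \<le> 2 * pi / 4" using T(5) by (intro divide_left_mono) auto
        then have "0 \<le> cos (2 * pi / q)" by (intro cos_ge_zero) (auto intro: order_trans[of _ 0])
        then show ?thesis using r by (intro mult_right_mono) auto
      qed
      also have "rg * cos (2 * pi / q) + \<delta>g \<le> \<gamma>" using \<delta>g by (simp add: q_def)
      finally show ?thesis by (intro Dg) simp
    next
      case True
      then obtain j where j: "j < modulus p" "cis (2 * pi * (t * \<omega> $ p)) = cis (2 * pi * (real j / modulus p))"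
        "j \<in> {1, 2} \<longrightarrow> t mod cycle e = cycle e div 4 + j * q" using T(4) by blast
      then have j12: "j \<noteq> 1" "j \<noteq> 2" using t by auto
      have "\<bar>x $ p + r * s j\<bar> \<le> \<eta> * R"
        using Rec[of zp "2 * pi * (real j / modulus p)" r] zp unfolding x j(2) by (simp add: s_def)
      from band[OF r(1) this _ j(1)] j12 show ?thesis by (intro Dp) auto
    qed
    then show ?thesis by (simp add: grad_def vec_eq_iff)
  qed
  have K1: "grad D x = pair_vec p (2 * cos \<beta> * (1 - lam (x $ (p + 1))) * (r - a)) (mu (x $ (p + 1)) * (r - a)\<^sup>2)"
    if r: "r \<in> {a..R}" and x: "x $ p = - sin \<beta> * r" for x r
  proof -
    have x': "x $ p = - s 1 * r" using x s12 by simp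
    have "x $ p \<notin> {l 2 - d<..<h 2 + d}"
      using band[OF r, of "x $ p" 1 2] x' m9 \<eta>1 R by (simp add: mult.commute)
    moreover have "x $ p \<in> {l 1..h 1}" unfolding x' by (rule on[OF r])
    ultimately have *: "D (inc p (\<lambda>_. 0)) x = (1 - lam (x $ (p + 1))) * (2 * \<kappa>1 * (x $ p - (- (s 1 * a))))"
       "D (inc (p + 1) (\<lambda>_. 0)) x = dl (x $ (p + 1)) * (\<kappa>1 * (x $ p - (- (s 1 * a)))\<^sup>2)" using D1 by auto
    have "x $ p - (- (s 1 * a)) = - s 1 * (r - a)" unfolding x' by (simp add: algebra_simps)
    then have "D (inc p (\<lambda>_. 0)) x = 2 * cos \<beta> * (1 - lam (x $ (p + 1))) * (r - a)"
      "D (inc (p + 1) (\<lambda>_. 0)) x = mu (x $ (p + 1)) * (r - a)\<^sup>2"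
      unfolding * using s0 by (simp_all add: \<kappa>1_def mu_def power_mult_distrib power2_eq_square)
    then show ?thesis using D3 by (auto simp: grad_def pair_vec_def vec_eq_iff)
  qed
  have K2: "grad D x = pair_vec p (- (1 / lam (x $ (p + 1)) - 1) * (r - a)) (- mu (x $ (p + 1)) / (lam (x $ (p + 1)))\<^sup>2 * (r - a)\<^sup>2)"
    if r: "r \<in> {a..R}" and x: "x $ p = - sin (2 * \<beta>) * r" for x r
  proof -
    have x': "x $ p = - s 2 * r" using x s12 by simp
    have "x $ p \<notin> {l 1 - d<..<h 1 + d}"
      using band[OF r, of "x $ p" 2 1] x' m9 \<eta>1 R by (simp add: mult.commute)
    moreover have "x $ p \<in> {l 2..h 2}" unfolding x' by (rule on[OF r])
    ultimately have *: "D (inc p (\<lambda>_. 0)) x = (1 / lam (x $ (p + 1)) - 1) * (2 * \<kappa>2 * (x $ p - (- (s 2 * a))))"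
       "D (inc (p + 1) (\<lambda>_. 0)) x = dl (x $ (p + 1)) / (lam (x $ (p + 1)))\<^sup>2 * (\<kappa>2 * (x $ p - (- (s 2 * a)))\<^sup>2)" using D2 by auto
    have "x $ p - (- (s 2 * a)) = - s 2 * (r - a)" unfolding x' by (simp add: algebra_simps)
    then have x'': "x $ p - (- (s 2 * a)) = - (s 2 * (r - a))" by simp
    have e1: "2 * \<kappa>2 * (- (s 2 * (r - a))) = a - r" using s0 by (simp add: \<kappa>2_def)
    have e2: "\<kappa>2 * (- (s 2 * (r - a)))\<^sup>2 = s 1 * cos \<beta> * (r - a)\<^sup>2"
      using s0 s2 by (simp add: \<kappa>2_def power_mult_distrib power2_eq_square)
    have "D (inc p (\<lambda>_. 0)) x = - (1 / lam (x $ (p + 1)) - 1) * (r - a)"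
      unfolding * x'' e1 by (simp add: algebra_simps diff_divide_distrib)
    moreover have "D (inc (p + 1) (\<lambda>_. 0)) x = - mu (x $ (p + 1)) / (lam (x $ (p + 1)))\<^sup>2 * (r - a)\<^sup>2"
      unfolding * x'' e2 by (simp add: mu_def)
    ultimately have "D (inc p (\<lambda>_. 0)) x = - (1 / lam (x $ (p + 1)) - 1) * (r - a)"
      "D (inc (p + 1) (\<lambda>_. 0)) x = - mu (x $ (p + 1)) / (lam (x $ (p + 1)))\<^sup>2 * (r - a)\<^sup>2" by blast+
    then show ?thesis using D3 by (auto simp: grad_def pair_vec_def vec_eq_iff)
  qed
  have ph: "cis (2 * pi * (real t * \<omega> $ p)) = cis (real j * \<beta>)" "cis (2 * pi * (real t * \<omega> $ (p + 1))) = - \<i>"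
    if "t mod cycle e = cycle e div 4 + j * q" for t j
    using T(2,3)[of t] T(3)[OF that] by (auto simp: \<beta>_def mult_ac)
  show ?thesis
  proof (rule that[OF D lam Dg])
    show "pulse p e (\<omega> $ p) (\<omega> $ (p + 1)) ((1 - \<eta>) * R) R rg (\<eta> * R) \<delta>g lam mu (grad D)"
      unfolding pulse_def q_def[symmetric] \<beta>_def[symmetric] a_def[symmetric]
      using rest K1 K2 ph by blast
  qed
qed

text \<open>
  A kick at time \<open>t\<close> acts in co-rotating coordinates along \<open>cis (- \<theta>)\<close>. As
  \<open>1 - 2 cos \<beta> cis (- \<beta>) + cis (- 2 \<beta>) = 0\<close>, two kicks of strengths \<open>2 cos \<beta> W\<close> and \<open>- W\<close> at
  the phases \<open>\<beta>\<close> and \<open>2 \<beta>\<close> add up to a radial displacement by \<open>- W\<close>, although each of them also turns the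
  point. The position read off at the second kick is already that of the new radius, so the second force
  can be prescribed as a function of it.
\<close>

lemma kick_pair:
  fixes \<rho> W \<beta> :: real
  shows "\<i> * \<rho> - \<i> * (2 * cos \<beta> * W) * cis (- \<beta>) + \<i> * W * cis (- (2 * \<beta>)) = \<i> * (\<rho> - W)"
    and "Re ((\<i> * \<rho> - \<i> * (2 * cos \<beta> * W) * cis (- \<beta>)) * cis (2 * \<beta>)) = - sin (2 * \<beta>) * (\<rho> - W)"
proof -
  have c2: "cos (2 * \<beta>) = 2 * (cos \<beta>)\<^sup>2 - 1" "cos (\<beta> * 2) = 2 * (cos \<beta>)\<^sup>2 - 1"
    by (simp_all add: cos_double_cos mult.commute[of \<beta>])
  have s2: "sin (2 * \<beta>) = 2 * sin \<beta> * cos \<beta>" "sin (\<beta> * 2) = 2 * sin \<beta> * cos \<beta>"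
    by (simp_all add: sin_double mult.commute[of \<beta>])
  show "\<i> * \<rho> - \<i> * (2 * cos \<beta> * W) * cis (- \<beta>) + \<i> * W * cis (- (2 * \<beta>)) = \<i> * (\<rho> - W)"
    by (simp add: complex_eq_iff c2 s2 algebra_simps power2_eq_square)
  have c1: "cis (- \<beta>) * cis (2 * \<beta>) = cis \<beta>" by (simp add: cis_mult)
  have "(\<i> * \<rho> - \<i> * (2 * cos \<beta> * W) * cis (- \<beta>)) * cis (2 * \<beta>) = \<i> * \<rho> * cis (2 * \<beta>) - \<i> * (2 * cos \<beta> * W) * cis \<beta>"
    by (simp only: left_diff_distrib mult.assoc c1)
  also have "Re \<dots> = - (\<rho> * sin (2 * \<beta>)) + 2 * cos \<beta> * W * sin \<beta>" by simp
  also have "\<dots> = - sin (2 * \<beta>) * (\<rho> - W)" unfolding s2(1) by (simp add: algebra_simps)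
  finally show "Re ((\<i> * \<rho> - \<i> * (2 * cos \<beta> * W) * cis (- \<beta>)) * cis (2 * \<beta>)) = - sin (2 * \<beta>) * (\<rho> - W)" .
qed

lemma pulse_rest:
  assumes "pulse p e wp wg a R rg \<delta>p \<delta>g lam mu v" "r \<in> {a..R}" "r' \<in> {0..rg}"
    "cmod (zp - \<i> * r) \<le> \<delta>p" "cmod (zg - \<i> * r') \<le> \<delta>g"
    "t mod cycle e \<noteq> cycle e div 4 + 1 * (cycle e div modulus p)"
    "t mod cycle e \<noteq> cycle e div 4 + 2 * (cycle e div modulus p)"
    "x $ p = Re (zp * cis (2 * pi * (real t * wp)))" "x $ (p + 1) = Re (zg * cis (2 * pi * (real t * wg)))"
  shows "v x = 0"
  using assms unfolding pulse_def by blast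

lemma pulse_phase:
  assumes "pulse p e wp wg a R rg \<delta>p \<delta>g lam mu v" "j \<in> {1, 2}"
    "t mod cycle e = cycle e div 4 + j * (cycle e div modulus p)"
  shows "cis (2 * pi * (real t * wp)) = cis (real j * (2 * pi / modulus p))" "cis (2 * pi * (real t * wg)) = - \<i>"
  using assms unfolding pulse_def by blast+

lemma pulse_kick1:
  assumes "pulse p e wp wg a R rg \<delta>p \<delta>g lam mu v" "r \<in> {a..R}" "x $ p = - sin (2 * pi / modulus p) * r"
  shows "v x = pair_vec p (2 * cos (2 * pi / modulus p) * (1 - lam (x $ (p + 1))) * (r - a)) (mu (x $ (p + 1)) * (r - a)\<^sup>2)"
  using assms unfolding pulse_def by blast

lemma pulse_kick2:
  assumes "pulse p e wp wg a R rg \<delta>p \<delta>g lam mu v" "r \<in> {a..R}" "x $ p = - sin (2 * (2 * pi / modulus p)) * r"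
  shows "v x = pair_vec p (- (1 / lam (x $ (p + 1)) - 1) * (r - a)) (- mu (x $ (p + 1)) / (lam (x $ (p + 1)))\<^sup>2 * (r - a)\<^sup>2)"
  using assms unfolding pulse_def by blast

lemma pulse_first_kick:
  assumes P: "pulse p e wp wg a R rg \<delta>p \<delta>g lam mu v" and r: "r \<in> {a..R}"
    and t: "t mod cycle e = cycle e div 4 + 1 * (cycle e div modulus p)"
    and x: "x $ p = Re (\<i> * r * cis (2 * pi * (real t * wp)))" "x $ (p + 1) = Re (zg * cis (2 * pi * (real t * wg)))"
  shows "\<i> * r - \<i> * (v x $ p) * cis (- (2 * pi * (real t * wp)))
      = \<i> * r - \<i> * (2 * cos (2 * pi / modulus p) * ((1 - lam (Im zg)) * (r - a))) * cis (- (2 * pi / modulus p))"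
    and "zg - \<i> * (v x $ (p + 1)) * cis (- (2 * pi * (real t * wg))) = zg + mu (Im zg) * (r - a)\<^sup>2"
    and "i = p + 2 \<Longrightarrow> v x $ i = 0"
proof -
  have pg: "p \<noteq> p + 1" "p + 2 \<noteq> p" "p + 2 \<noteq> p + 1" using three_cases[of p] by auto
  note ph = pulse_phase[OF P _ t]
  have ph1: "cis (2 * pi * (real t * wp)) = cis (2 * pi / modulus p)" using ph(1) by simp
  have ph2: "cis (2 * pi * (real t * wg)) = - \<i>" using ph(2) by simp
  have n1: "cis (- (2 * pi * (real t * wp))) = cis (- (2 * pi / modulus p))"
    using arg_cong[OF ph1, of cnj] by (simp add: cis_cnj)
  have n2: "cis (- (2 * pi * (real t * wg))) = \<i>" using arg_cong[OF ph2, of cnj] by (simp add: cis_cnj)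
  have xp: "x $ p = - sin (2 * pi / modulus p) * r" unfolding x ph1 by simp
  have xg: "x $ (p + 1) = Im zg" unfolding x ph2 by simp
  note v = pulse_kick1[OF P r xp, unfolded xg]
  show "\<i> * r - \<i> * (v x $ p) * cis (- (2 * pi * (real t * wp)))
      = \<i> * r - \<i> * (2 * cos (2 * pi / modulus p) * ((1 - lam (Im zg)) * (r - a))) * cis (- (2 * pi / modulus p))"
    unfolding v n1 by (simp add: pair_vec_def mult.assoc)
  show "zg - \<i> * (v x $ (p + 1)) * cis (- (2 * pi * (real t * wg))) = zg + mu (Im zg) * (r - a)\<^sup>2"
  proof -
    have "v x $ (p + 1) = mu (Im zg) * (r - a)\<^sup>2" unfolding v using pg by (simp add: pair_vec_def)
    then show ?thesis unfolding n2 by (simp add: complex_eq_iff)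
  qed
  show "i = p + 2 \<Longrightarrow> v x $ i = 0" unfolding v using pg by (simp add: pair_vec_def)
qed

text \<open>
  The new radius satisfies \<open>r' - a = lam (r - a)\<close>. In terms of it the strengths are \<open>(1 / lam - 1) (r' - a)\<close>
  for the pushed plane and \<open>mu / lam\<^sup>2 (r' - a)\<^sup>2\<close> for the gate, which is exactly what cancels the
  deflection of the gate by the first kick.
\<close>

lemma pulse_second_kick:
  assumes P: "pulse p e wp wg a R rg \<delta>p \<delta>g lam mu v" and r: "r \<in> {a..R}"
    and lam: "0 < lam (Im g)" "lam (Im g) \<le> 1"
    and t: "t mod cycle e = cycle e div 4 + 2 * (cycle e div modulus p)"
    and zp: "zp = \<i> * r - \<i> * (2 * cos (2 * pi / modulus p) * ((1 - lam (Im g)) * (r - a))) * cis (- (2 * pi / modulus p))"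
    and zg: "zg = g + mu (Im g) * (r - a)\<^sup>2"
    and x: "x $ p = Re (zp * cis (2 * pi * (real t * wp)))" "x $ (p + 1) = Re (zg * cis (2 * pi * (real t * wg)))"
  shows "zp - \<i> * (v x $ p) * cis (- (2 * pi * (real t * wp))) = \<i> * (a + lam (Im g) * (r - a))"
    and "zg - \<i> * (v x $ (p + 1)) * cis (- (2 * pi * (real t * wg))) = g"
    and "i = p + 2 \<Longrightarrow> v x $ i = 0"
proof -
  have pg: "p \<noteq> p + 1" "p + 2 \<noteq> p" "p + 2 \<noteq> p + 1" using three_cases[of p] by auto
  define \<beta> where "\<beta> = 2 * pi / modulus p"
  define W where "W = (1 - lam (Im g)) * (r - a)"
  define r' where "r' = a + lam (Im g) * (r - a)"
  have rW: "r - W = r'" by (simp add: W_def r'_def algebra_simps)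
  have r': "r' \<in> {a..R}" using r lam mult_left_le_one_le[of "r - a" "lam (Im g)"] by (auto simp: r'_def)
  note ph = pulse_phase[OF P _ t]
  have ph1: "cis (2 * pi * (real t * wp)) = cis (2 * \<beta>)" using ph(1) by (simp add: \<beta>_def)
  have ph2: "cis (2 * pi * (real t * wg)) = - \<i>" using ph(2) by simp
  have n1: "cis (- (2 * pi * (real t * wp))) = cis (- (2 * \<beta>))"
    using arg_cong[OF ph1, of cnj] by (simp add: cis_cnj)
  have n2: "cis (- (2 * pi * (real t * wg))) = \<i>" using arg_cong[OF ph2, of cnj] by (simp add: cis_cnj)
  have zp': "zp = \<i> * r - \<i> * (2 * cos \<beta> * W) * cis (- \<beta>)" by (simp add: zp \<beta>_def W_def)
  have xp: "x $ p = - sin (2 * \<beta>) * r'" unfolding x ph1 zp' kick_pair(2) rW ..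
  have xg: "x $ (p + 1) = Im g" unfolding x ph2 zg by simp
  note v = pulse_kick2[OF P r' xp[unfolded \<beta>_def], unfolded xg]
  have "(1 / lam (Im g) - 1) * (r' - a) = W" using lam by (simp add: r'_def W_def field_simps)
  moreover have "v x $ p = - ((1 / lam (Im g) - 1) * (r' - a))"
    unfolding v by (simp only: pair_vec_def vec_lambda_beta if_True mult_minus_left refl)
  ultimately have vp: "v x $ p = - W" by simp
  have "zp - \<i> * (v x $ p) * cis (- (2 * pi * (real t * wp))) = \<i> * r - \<i> * (2 * cos \<beta> * W) * cis (- \<beta>) + \<i> * W * cis (- (2 * \<beta>))"
    unfolding vp n1 zp' by simp
  also have "\<dots> = \<i> * (r - W)" by (rule kick_pair)
  finally show "zp - \<i> * (v x $ p) * cis (- (2 * pi * (real t * wp))) = \<i> * (a + lam (Im g) * (r - a))"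
    unfolding rW r'_def[symmetric] by simp
  have "mu (Im g) / (lam (Im g))\<^sup>2 * (r' - a)\<^sup>2 = mu (Im g) * (r - a)\<^sup>2"
    using lam by (simp add: r'_def power_mult_distrib)
  then have vg: "v x $ (p + 1) = - (mu (Im g) * (r - a)\<^sup>2)" unfolding v using pg by (simp add: pair_vec_def)
  show "zg - \<i> * (v x $ (p + 1)) * cis (- (2 * pi * (real t * wg))) = g"
    unfolding vg n2 zg by (simp add: complex_eq_iff)
  show "i = p + 2 \<Longrightarrow> v x $ i = 0" unfolding v using pg by (simp add: pair_vec_def)
qed

text \<open>
  A bound on the force bounds the kicks for every value of the gate variable, because a test position
  realizing any given value can be inserted.
\<close>

lemma pulse_kick_bound:
  assumes P: "pulse p e wp wg a R rg \<delta>p \<delta>g lam mu v" and r: "r \<in> {a..R}" and b: "\<And>x i. \<bar>v x $ i\<bar> \<le> b"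
  shows "\<bar>2 * cos (2 * pi / modulus p) * ((1 - lam y) * (r - a))\<bar> \<le> b" "\<bar>mu y * (r - a)\<^sup>2\<bar> \<le> b"
proof -
  have pg: "p + 1 \<noteq> p" using three_cases[of p] by auto
  define x :: "real ^ 3" where "x = (\<chi> i. if i = p then - sin (2 * pi / modulus p) * r else y)"
  have x: "x $ p = - sin (2 * pi / modulus p) * r" "x $ (p + 1) = y" using pg by (auto simp: x_def)
  note v = pulse_kick1[OF P r x(1), unfolded x(2)]
  show "\<bar>2 * cos (2 * pi / modulus p) * ((1 - lam y) * (r - a))\<bar> \<le> b"
    using b[of x p] unfolding v by (simp add: pair_vec_def mult.assoc)
  show "\<bar>mu y * (r - a)\<^sup>2\<bar> \<le> b"
    using b[of x "p + 1"] unfolding v using pg by (simp add: pair_vec_def)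
qed

lemma cycle_facts:
  assumes "24 dvd e"
  shows "0 < cycle e div modulus i" "cycle e div 4 + 2 * (cycle e div modulus i) < cycle e" "0 < cycle e div 4"
proof -
  obtain M where M: "1989 = modulus i * M" using modulus_dvd[of i] by blast
  have m: "modulus i > 0" using modulus_bounds(1)[of i] by simp
  have q: "cycle e div modulus i = M * 2 ^ e" using m by (simp add: cycle_def M mult.assoc)
  have C: "cycle e = modulus i * (M * 2 ^ e)" by (simp add: cycle_def M)
  have "M > 0" using M by (cases M) auto
  then have X: "M * 2 ^ e > 0" by simp
  show "0 < cycle e div modulus i" using X q by simp
  have "9 * (M * 2 ^ e) \<le> cycle e" unfolding C using modulus_bounds(1)[of i] by (intro mult_right_mono) auto
  moreover have "c div 4 + 2 * X < c" if "9 * X \<le> c" "0 < X" for c X :: nat using that by linarith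
  ultimately show "cycle e div 4 + 2 * (cycle e div modulus i) < cycle e" using X q by auto
  have "1989 * 1 \<le> cycle e" unfolding cycle_def by (intro mult_left_mono) auto
  then show "0 < cycle e div 4" by linarith
qed

section \<open>Two pulses acting together\<close>

text \<open>
  One cycle of the later pulse \<open>v2\<close>, which pushes plane \<open>p + 1\<close> through plane \<open>p + 2\<close>, while the earlier pulse
  \<open>v1\<close>, which pushes plane \<open>p\<close> through plane \<open>p + 1\<close>, is still active. The orbit is \<open>\<zeta>\<close>, in
  co-rotating coordinates, starting on the imaginary axes; \<open>\<rho>\<close> bounds the region where no other force acts.
\<close>

locale two_pulses =
  fixes p :: 3 and e1 e2 :: nat and \<omega> :: "real ^ 3"
    and a1 R1 rg1 \<delta>p1 \<delta>g1 b1 a2 R2 rg2 \<delta>p2 \<delta>g2 b2 rp rg rh :: real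
    and lam1 mu1 lam2 mu2 :: "real \<Rightarrow> real"
    and v1 v2 V :: "real ^ 3 \<Rightarrow> real ^ 3" and \<rho> :: "real ^ 3" and \<zeta> :: "nat \<Rightarrow> complex ^ 3"
  assumes P1: "pulse p e1 (\<omega> $ p) (\<omega> $ (p + 1)) a1 R1 rg1 \<delta>p1 \<delta>g1 lam1 mu1 v1"
    and P2: "pulse (p + 1) e2 (\<omega> $ (p + 1)) (\<omega> $ (p + 1 + 1)) a2 R2 rg2 \<delta>p2 \<delta>g2 lam2 mu2 v2"
    and e: "24 dvd e1" "24 dvd e2" "e1 < e2"
    and lam1: "\<And>y. 0 < lam1 y" "\<And>y. lam1 y \<le> 1"
    and lam2: "\<And>y. 0 < lam2 y" "\<And>y. lam2 y \<le> 1"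
    and b1: "\<And>x i. \<bar>v1 x $ i\<bar> \<le> b1" and b2: "\<And>x i. \<bar>v2 x $ i\<bar> \<le> b2"
    and V: "\<And>x. (\<And>i. x $ i \<le> \<rho> $ i) \<Longrightarrow> V x = v1 x + v2 x"
    and rp: "0 \<le> a1" "a1 \<le> rp" "rp \<le> R1" and rg: "0 \<le> a2" "a2 \<le> rg" "rg \<le> R2" "rg \<le> rg1"
    and rh: "0 \<le> rh" "rh \<le> rg2"
    and small: "b1 \<le> \<delta>p1" "b1 + b2 \<le> \<delta>g1" "b1 + b2 \<le> \<delta>p2" "b2 \<le> \<delta>g2"
    and region: "rp + b1 \<le> \<rho> $ p" "rg + b1 + b2 \<le> \<rho> $ (p + 1)" "rh + b2 \<le> \<rho> $ (p + 1 + 1)"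
    and init: "\<zeta> 0 $ p = \<i> * rp" "\<zeta> 0 $ (p + 1) = \<i> * rg" "\<zeta> 0 $ (p + 1 + 1) = \<i> * rh"
    and step: "\<And>t i. \<zeta> (Suc t) $ i = \<zeta> t $ i -
       \<i> * V (\<chi> j. Re (\<zeta> t $ j * cis (2 * pi * (real (Suc t) * \<omega> $ j)))) $ i * cis (- (2 * pi * (real (Suc t) * \<omega> $ i)))"
begin

definition "q1 = cycle e1 div modulus p"
definition "q2 = cycle e2 div modulus (p + 1)"
definition "kick1 j = cycle e1 div 4 + j * q1"
definition "kick2 j = cycle e2 div 4 + j * q2"

definition "W = (1 - lam2 rh) * (rg - a2)"
definition "rg' = a2 + lam2 rh * (rg - a2)"

text \<open>
  \<open>G\<close> and \<open>H\<close> are the motions of plane \<open>p + 1\<close> and of plane \<open>p + 2\<close> under the later pulse alone.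
\<close>

definition G :: "nat \<Rightarrow> complex" where
  "G t = (if t < kick2 1 then \<i> * rg
     else if t < kick2 2 then \<i> * rg - \<i> * (2 * cos (2 * pi / modulus (p + 1)) * W) * cis (- (2 * pi / modulus (p + 1)))
     else \<i> * rg')"

definition H :: "nat \<Rightarrow> complex" where
  "H t = (if kick2 1 \<le> t \<and> t < kick2 2 then \<i> * rh + mu2 rh * (rg - a2)\<^sup>2 else \<i> * rh)"

text \<open>
  The times between the two kicks of the earlier pulse.
\<close>

definition window :: "nat \<Rightarrow> bool" where
  "window t \<longleftrightarrow> kick1 1 \<le> t mod cycle e1 \<and> t mod cycle e1 < kick1 2"

text \<open>
  The earlier pulse deflects its gate only inside a window, on top of \<open>G\<close>; of the radius of plane \<open>p\<close>
  it suffices to know an interval, since the gate opens by an unspecified amount.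
\<close>

definition Inv :: "nat \<Rightarrow> bool" where
  "Inv t \<longleftrightarrow> \<zeta> t $ (p + 1 + 1) = H t \<and> (\<exists>s\<in>{a1..rp}.
     if window t
     then \<zeta> t $ p = \<i> * s - \<i> * (2 * cos (2 * pi / modulus p) * ((1 - lam1 (Im (G t))) * (s - a1))) * cis (- (2 * pi / modulus p)) \<and>
          \<zeta> t $ (p + 1) = G t + mu1 (Im (G t)) * (s - a1)\<^sup>2
     else \<zeta> t $ p = \<i> * s \<and> \<zeta> t $ (p + 1) = G t)"

lemma idx: "p + 1 \<noteq> p" "p + 1 + 1 \<noteq> p" "p + 1 + 1 \<noteq> p + 1" "p + 2 = p + 1 + 1" "p + 1 + 2 = p" "i = p \<or> i = p + 1 \<or> i = p + 1 + 1"
  using three_cases[of p] three_cases[of i] by auto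

lemma b_nonneg: "0 \<le> b1" "0 \<le> b2"
  using b1[where x=0 and i=1] b2[where x=0 and i=1] by auto

lemma kick_order: "0 < kick1 1" "kick1 1 < kick1 2" "kick1 2 < cycle e1" "0 < kick2 1" "kick2 1 < kick2 2" "kick2 2 < cycle e2"
  using cycle_facts(1,2)[OF e(1), of p] cycle_facts(1,2)[OF e(2), of "p + 1"] cycle_facts(3)[OF e(1)] cycle_facts(3)[OF e(2)]
  by (auto simp: kick1_def kick2_def q1_def q2_def)

lemma kick2_mod:
  assumes "t \<le> cycle e2" "j \<in> {1, 2}"
  shows "t mod cycle e2 = kick2 j \<longleftrightarrow> t = kick2 j"
  using assms kick_order by (cases "t = cycle e2") auto

lemma kick2_not_kick1:
  assumes "j \<in> {1, 2}"
  shows "0 < kick2 j mod cycle e1" "kick2 j mod cycle e1 < kick1 1"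
proof -
  have "kick2 j mod cycle e2 = cycle e2 div 4 + j * (cycle e2 div modulus (p + 1))"
    using kick_order assms by (auto simp: kick2_def q2_def)
  note k = kick_time_lower[OF e assms this]
  show "0 < kick2 j mod cycle e1" using k by simp
  show "kick2 j mod cycle e1 < kick1 1" using k by (simp add: kick1_def)
qed

lemma window_Suc:
  assumes "Suc t mod cycle e1 \<noteq> kick1 1" "Suc t mod cycle e1 \<noteq> kick1 2"
  shows "window (Suc t) \<longleftrightarrow> window t"
  using assms kick_order unfolding window_def mod_Suc by (auto split: if_splits)

lemma window_kick1: "Suc t mod cycle e1 = kick1 1 \<Longrightarrow> \<not> window t \<and> window (Suc t)"
  using kick_order unfolding window_def mod_Suc by (auto split: if_splits)

lemma window_kick2: "Suc t mod cycle e1 = kick1 2 \<Longrightarrow> window t \<and> \<not> window (Suc t)"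
  using kick_order unfolding window_def mod_Suc by (auto split: if_splits)

lemma GH_Suc:
  assumes "Suc t \<noteq> kick2 1" "Suc t \<noteq> kick2 2"
  shows "G (Suc t) = G t" "H (Suc t) = H t"
  using assms unfolding G_def H_def by auto

lemma rg'_bounds: "rg' \<in> {a2..rg}" "rg - W = rg'"
  using rg lam2[of rh] mult_left_le_one_le[of "rg - a2" "lam2 rh"] by (auto simp: rg'_def W_def algebra_simps)

lemma G_near: "\<exists>s\<in>{a2..rg}. cmod (G t - \<i> * s) \<le> b2"
proof -
  have k: "\<bar>2 * cos (2 * pi / modulus (p + 1)) * W\<bar> \<le> b2"
    using pulse_kick_bound(1)[OF P2 _ b2, of rg rh] rg by (simp add: W_def)
  have "G t = \<i> * rg \<or> G t = \<i> * rg - \<i> * (2 * cos (2 * pi / modulus (p + 1)) * W) * cis (- (2 * pi / modulus (p + 1))) \<or> G t = \<i> * rg'"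
    by (cases "t < kick2 1"; cases "t < kick2 2") (simp_all only: G_def if_True if_False refl simp_thms)
  then consider "G t = \<i> * rg" | "G t = \<i> * rg - \<i> * (2 * cos (2 * pi / modulus (p + 1)) * W) * cis (- (2 * pi / modulus (p + 1)))" | "G t = \<i> * rg'"
    by blast
  then show ?thesis
  proof cases
    case 1
    then show ?thesis using rg b_nonneg by (intro bexI[of _ rg]) auto
  next
    case 2
    have z: "G t - \<i> * rg = - (\<i> * complex_of_real (2 * cos (2 * pi / modulus (p + 1)) * W) * cis (- (2 * pi / modulus (p + 1))))"
      unfolding 2 by simp
    have "cmod (G t - \<i> * rg) = \<bar>2 * cos (2 * pi / modulus (p + 1)) * W\<bar>"
      unfolding z by (simp only: norm_minus_cancel norm_mult norm_ii norm_cis norm_of_real mult_1_left mult_1_right)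
    then show ?thesis using rg k by (intro bexI[of _ rg]) auto
  next
    case 3
    then show ?thesis using rg'_bounds b_nonneg by (intro bexI[of _ rg']) auto
  qed
qed

lemma H_near: "cmod (H t - \<i> * rh) \<le> b2"
proof -
  have "\<bar>mu2 rh * (rg - a2)\<^sup>2\<bar> \<le> b2" using pulse_kick_bound(2)[OF P2 _ b2, of rg rh] rg by simp
  then show ?thesis using b_nonneg unfolding H_def by (auto simp del: of_real_mult of_real_power simp flip: of_real_mult of_real_power of_real_diff)
qed

lemma Inv_near:
  assumes "Inv t"
  obtains s where "s \<in> {a1..rp}" "cmod (\<zeta> t $ p - \<i> * s) \<le> b1" "cmod (\<zeta> t $ (p + 1) - G t) \<le> b1" "\<zeta> t $ (p + 1 + 1) = H t"
proof -
  obtain s where s: "s \<in> {a1..rp}" and h: "\<zeta> t $ (p + 1 + 1) = H t" and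
    I: "if window t
     then \<zeta> t $ p = \<i> * s - \<i> * (2 * cos (2 * pi / modulus p) * ((1 - lam1 (Im (G t))) * (s - a1))) * cis (- (2 * pi / modulus p)) \<and>
          \<zeta> t $ (p + 1) = G t + mu1 (Im (G t)) * (s - a1)\<^sup>2
     else \<zeta> t $ p = \<i> * s \<and> \<zeta> t $ (p + 1) = G t"
    using assms unfolding Inv_def by blast
  have sR: "s \<in> {a1..R1}" using s rp by auto
  note k = pulse_kick_bound[OF P1 sR b1, of "Im (G t)"]
  have "cmod (\<zeta> t $ p - \<i> * s) \<le> b1 \<and> cmod (\<zeta> t $ (p + 1) - G t) \<le> b1"
  proof (cases "window t")
    case True
    then have z: "\<zeta> t $ p - \<i> * s = - (\<i> * complex_of_real (2 * cos (2 * pi / modulus p) * ((1 - lam1 (Im (G t))) * (s - a1))) * cis (- (2 * pi / modulus p)))"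
      "\<zeta> t $ (p + 1) - G t = complex_of_real (mu1 (Im (G t)) * (s - a1)\<^sup>2)"
      using I by simp_all
    show ?thesis unfolding z using k by (simp only: norm_minus_cancel norm_mult norm_ii norm_cis norm_of_real mult_1_left mult_1_right)
  next
    case False
    then show ?thesis using I b_nonneg by simp
  qed
  then show ?thesis using that s h by blast
qed

lemma Inv_norm:
  assumes "Inv t"
  shows "cmod (\<zeta> t $ i) \<le> \<rho> $ i"
proof -
  obtain s where s: "s \<in> {a1..rp}" "cmod (\<zeta> t $ p - \<i> * s) \<le> b1" "cmod (\<zeta> t $ (p + 1) - G t) \<le> b1" "\<zeta> t $ (p + 1 + 1) = H t"
    using Inv_near[OF assms] by blast
  obtain s' where s': "s' \<in> {a2..rg}" "cmod (G t - \<i> * s') \<le> b2" using G_near by blast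
  have tri: "cmod z \<le> s + b" if "cmod (z - \<i> * of_real s) \<le> b" "0 \<le> s" for z s b
    using norm_triangle_ineq[of "z - \<i> * of_real s" "\<i> * of_real s"] that by (simp add: norm_mult)
  have "cmod (\<zeta> t $ p) \<le> s + b1" using tri[OF s(2)] s rp by auto
  then have 1: "cmod (\<zeta> t $ p) \<le> \<rho> $ p" using s region by auto
  have "cmod (\<zeta> t $ (p + 1)) \<le> cmod (\<zeta> t $ (p + 1) - G t) + cmod (G t)"
    using norm_triangle_ineq[of "\<zeta> t $ (p + 1) - G t" "G t"] by simp
  then have 2: "cmod (\<zeta> t $ (p + 1)) \<le> \<rho> $ (p + 1)" using s(3) tri[OF s'(2)] s'(1) rg region by auto
  have 3: "cmod (\<zeta> t $ (p + 1 + 1)) \<le> \<rho> $ (p + 1 + 1)" using tri[OF H_near] rh s(4) region by (metis order_trans)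
  show ?thesis using idx(6)[of i] 1 2 3 by auto
qed

text \<open>
  The kick times of the two pulses are disjoint, and the later pulse kicks outside the windows of the
  earlier one. So there are five cases: one for each of the four kicks, and the times without a force.
\<close>

lemma Inv_step:
  assumes I: "Inv t" and t: "Suc t \<le> cycle e2"
  shows "Inv (Suc t)"
proof -
  define \<tau> where "\<tau> = Suc t"
  define x :: "real ^ 3" where "x = (\<chi> j. Re (\<zeta> t $ j * cis (2 * pi * (real \<tau> * \<omega> $ j))))"
  have xi: "x $ j = Re (\<zeta> t $ j * cis (2 * pi * (real \<tau> * \<omega> $ j)))" for j by (simp add: x_def)
  have "x $ j \<le> \<rho> $ j" for j
    using Inv_norm[OF I, of j] complex_Re_le_cmod[of "\<zeta> t $ j * cis (2 * pi * (real \<tau> * \<omega> $ j))"]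
    unfolding xi norm_mult norm_cis by simp
  then have Vx: "V x = v1 x + v2 x" by (rule V)
  have new: "\<zeta> \<tau> $ i = \<zeta> t $ i - \<i> * (v1 x $ i + v2 x $ i) * cis (- (2 * pi * (real \<tau> * \<omega> $ i)))" for i
    using step[of t i] unfolding \<tau>_def[symmetric] x_def[symmetric] Vx by simp
  obtain s0 where s0: "s0 \<in> {a1..rp}" "cmod (\<zeta> t $ p - \<i> * s0) \<le> b1" "cmod (\<zeta> t $ (p + 1) - G t) \<le> b1"
    using Inv_near[OF I] by blast
  obtain s' where s': "s' \<in> {a2..rg}" "cmod (G t - \<i> * s') \<le> b2" using G_near by blast
  have gn: "cmod (\<zeta> t $ (p + 1) - \<i> * s') \<le> b1 + b2"
    using norm_triangle_ineq[of "\<zeta> t $ (p + 1) - G t" "G t - \<i> * s'"] s0 s' by simp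
  obtain s where s: "s \<in> {a1..rp}" and h: "\<zeta> t $ (p + 1 + 1) = H t" and
    Is: "if window t
     then \<zeta> t $ p = \<i> * s - \<i> * (2 * cos (2 * pi / modulus p) * ((1 - lam1 (Im (G t))) * (s - a1))) * cis (- (2 * pi / modulus p)) \<and>
          \<zeta> t $ (p + 1) = G t + mu1 (Im (G t)) * (s - a1)\<^sup>2
     else \<zeta> t $ p = \<i> * s \<and> \<zeta> t $ (p + 1) = G t"
    using I unfolding Inv_def by blast
  have sR: "s \<in> {a1..R1}" using s rp by auto
  have rest1: "v1 x = 0" if "\<tau> mod cycle e1 \<noteq> kick1 1" "\<tau> mod cycle e1 \<noteq> kick1 2"
  proof (rule pulse_rest[OF P1])
    show "s0 \<in> {a1..R1}" "s' \<in> {0..rg1}" using s0 s' rp rg by auto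
    show "cmod (\<zeta> t $ p - \<i> * s0) \<le> \<delta>p1" "cmod (\<zeta> t $ (p + 1) - \<i> * s') \<le> \<delta>g1" using s0 gn small by auto
  qed (use that in \<open>simp_all add: kick1_def q1_def xi\<close>)
  have rest2: "v2 x = 0" if "\<tau> \<noteq> kick2 1" "\<tau> \<noteq> kick2 2"
  proof (rule pulse_rest[OF P2])
    show "s' \<in> {a2..R2}" "rh \<in> {0..rg2}" using s' rh rg by auto
    show "cmod (\<zeta> t $ (p + 1) - \<i> * s') \<le> \<delta>p2" using gn small by auto
    show "cmod (\<zeta> t $ (p + 1 + 1) - \<i> * rh) \<le> \<delta>g2" using H_near[of t] h small by simp
    show "\<tau> mod cycle e2 \<noteq> cycle e2 div 4 + 1 * (cycle e2 div modulus (p + 1))"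
      "\<tau> mod cycle e2 \<noteq> cycle e2 div 4 + 2 * (cycle e2 div modulus (p + 1))"
      using kick2_mod[of \<tau> 1] kick2_mod[of \<tau> 2] that t unfolding \<tau>_def kick2_def q2_def by auto
  qed (simp_all add: xi)
  have t2: "\<tau> mod cycle e2 = cycle e2 div 4 + j * (cycle e2 div modulus (p + 1))" if "\<tau> = kick2 j" "j \<in> {1, 2}" for j
    using kick2_mod[of \<tau> j] t that unfolding \<tau>_def kick2_def q2_def by auto
  have n1: "\<tau> mod cycle e1 \<noteq> kick1 1" "\<tau> mod cycle e1 \<noteq> kick1 2" "\<not> window t" "\<not> window \<tau>"
    if "\<tau> = kick2 j" "j \<in> {1, 2}" for j
  proof -
    have lt: "0 < \<tau> mod cycle e1" "\<tau> mod cycle e1 < kick1 1" using kick2_not_kick1[OF that(2)] that(1) by simp_all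
    show k: "\<tau> mod cycle e1 \<noteq> kick1 1" "\<tau> mod cycle e1 \<noteq> kick1 2" using lt kick_order by auto
    show "\<not> window \<tau>" using lt by (simp add: window_def)
    then show "\<not> window t" using window_Suc[of t] k by (simp add: \<tau>_def)
  qed
  consider "\<tau> = kick2 1" | "\<tau> = kick2 2" | "\<tau> mod cycle e1 = kick1 1" "\<tau> \<noteq> kick2 1" "\<tau> \<noteq> kick2 2"
    | "\<tau> mod cycle e1 = kick1 2" "\<tau> \<noteq> kick2 1" "\<tau> \<noteq> kick2 2"
    | "\<tau> mod cycle e1 \<noteq> kick1 1" "\<tau> mod cycle e1 \<noteq> kick1 2" "\<tau> \<noteq> kick2 1" "\<tau> \<noteq> kick2 2" by blast
  then have "Inv \<tau>"
  proof cases
    case 1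
    have "1 \<in> {1, 2::nat}" by simp
    note n = n1[OF 1 this]
    have v1: "v1 x = 0" by (rule rest1[OF n(1,2)])
    have z: "\<zeta> t $ p = \<i> * s" "\<zeta> t $ (p + 1) = G t" using Is n(3) by auto
    have Gt: "G t = \<i> * rg" "H t = \<i> * rh" using 1 by (auto simp: G_def H_def \<tau>_def)
    have tm: "\<tau> mod cycle e2 = cycle e2 div 4 + 1 * (cycle e2 div modulus (p + 1))" using t2[OF 1] by simp
    have rr: "rg \<in> {a2..R2}" using rg by auto
    have xs: "x $ (p + 1) = Re (\<i> * rg * cis (2 * pi * (real \<tau> * \<omega> $ (p + 1))))"
        "x $ (p + 1 + 1) = Re (\<i> * rh * cis (2 * pi * (real \<tau> * \<omega> $ (p + 1 + 1))))"
      unfolding xi z h Gt by (rule refl)+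
    note K = pulse_first_kick[OF P2 rr tm xs]
    have "\<zeta> \<tau> $ p = \<i> * s" using new[of p] K(3)[of p] idx(5) z v1 by simp
    moreover have "\<zeta> \<tau> $ (p + 1) = G \<tau>"
      using new[of "p + 1"] K(1) z Gt v1 kick_order 1 unfolding G_def by (simp add: W_def)
    moreover have "\<zeta> \<tau> $ (p + 1 + 1) = H \<tau>"
      using new[of "p + 1 + 1"] K(2) h Gt v1 kick_order 1 unfolding H_def by simp
    ultimately show ?thesis using s n(4) unfolding Inv_def by auto
  next
    case 2
    have "2 \<in> {1, 2::nat}" by simp
    note n = n1[OF 2 this]
    have v1: "v1 x = 0" by (rule rest1[OF n(1,2)])
    have z: "\<zeta> t $ p = \<i> * s" "\<zeta> t $ (p + 1) = G t" using Is n(3) by auto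
    have tl: "kick2 1 \<le> t" "t < kick2 2" using 2 kick_order by (auto simp: \<tau>_def)
    have Ht: "H t = \<i> * rh + mu2 (Im (\<i> * complex_of_real rh)) * (rg - a2)\<^sup>2" using tl by (simp add: H_def)
    have Gt: "G t = \<i> * rg - \<i> * (2 * cos (2 * pi / modulus (p + 1)) * ((1 - lam2 (Im (\<i> * complex_of_real rh))) * (rg - a2))) * cis (- (2 * pi / modulus (p + 1)))"
      using tl by (simp add: G_def W_def)
    have tm: "\<tau> mod cycle e2 = cycle e2 div 4 + 2 * (cycle e2 div modulus (p + 1))" using t2[OF 2] by simp
    have rr: "rg \<in> {a2..R2}" using rg by auto
    have xs: "x $ (p + 1) = Re (G t * cis (2 * pi * (real \<tau> * \<omega> $ (p + 1))))"
        "x $ (p + 1 + 1) = Re (H t * cis (2 * pi * (real \<tau> * \<omega> $ (p + 1 + 1))))"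
      unfolding xi z h by (rule refl)+
    note K = pulse_second_kick[OF P2 rr lam2 tm Gt Ht xs]
    have "\<zeta> \<tau> $ p = \<i> * s" using new[of p] K(3)[of p] idx(5) z v1 by simp
    moreover have "\<zeta> \<tau> $ (p + 1) = G \<tau>"
    proof -
      have "\<zeta> \<tau> $ (p + 1) = G t - \<i> * (v2 x $ (p + 1)) * cis (- (2 * pi * (real \<tau> * \<omega> $ (p + 1))))"
        using new[of "p + 1"] z v1 by simp
      then show ?thesis using K(1) kick_order 2 by (simp add: G_def rg'_def)
    qed
    moreover have "\<zeta> \<tau> $ (p + 1 + 1) = H \<tau>"
    proof -
      have "\<zeta> \<tau> $ (p + 1 + 1) = H t - \<i> * (v2 x $ (p + 1 + 1)) * cis (- (2 * pi * (real \<tau> * \<omega> $ (p + 1 + 1))))"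
        using new[of "p + 1 + 1"] h v1 by simp
      then show ?thesis using K(2) kick_order 2 by (simp add: H_def)
    qed
    ultimately show ?thesis using s n(4) unfolding Inv_def by auto
  next
    case 3
    have w: "\<not> window t" "window \<tau>" using window_kick1[of t] 3 by (auto simp: \<tau>_def)
    have v2: "v2 x = 0" by (rule rest2[OF 3(2,3)])
    have z: "\<zeta> t $ p = \<i> * s" "\<zeta> t $ (p + 1) = G t" using Is w(1) by auto
    have GH: "G \<tau> = G t" "H \<tau> = H t" using GH_Suc[of t] 3 by (auto simp: \<tau>_def)
    have tm: "\<tau> mod cycle e1 = cycle e1 div 4 + 1 * (cycle e1 div modulus p)" using 3 by (simp add: kick1_def q1_def)
    have xs: "x $ p = Re (\<i> * s * cis (2 * pi * (real \<tau> * \<omega> $ p)))" "x $ (p + 1) = Re (G t * cis (2 * pi * (real \<tau> * \<omega> $ (p + 1))))"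
      unfolding xi z by (rule refl)+
    note K = pulse_first_kick[OF P1 sR tm xs]
    have "\<zeta> \<tau> $ p = \<i> * s - \<i> * (2 * cos (2 * pi / modulus p) * ((1 - lam1 (Im (G \<tau>))) * (s - a1))) * cis (- (2 * pi / modulus p))"
      using new[of p] K(1) z v2 GH by simp
    moreover have "\<zeta> \<tau> $ (p + 1) = G \<tau> + mu1 (Im (G \<tau>)) * (s - a1)\<^sup>2"
      using new[of "p + 1"] K(2) z v2 GH by simp
    moreover have "\<zeta> \<tau> $ (p + 1 + 1) = H \<tau>"
      using new[of "p + 1 + 1"] K(3)[of "p + 1 + 1"] h v2 GH idx(4) by simp
    ultimately show ?thesis using s w(2) unfolding Inv_def by auto
  next
    case 4
    have w: "window t" "\<not> window \<tau>" using window_kick2[of t] 4 by (auto simp: \<tau>_def)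
    have v2: "v2 x = 0" by (rule rest2[OF 4(2,3)])
    have z: "\<zeta> t $ p = \<i> * s - \<i> * (2 * cos (2 * pi / modulus p) * ((1 - lam1 (Im (G t))) * (s - a1))) * cis (- (2 * pi / modulus p))"
          "\<zeta> t $ (p + 1) = G t + mu1 (Im (G t)) * (s - a1)\<^sup>2" using Is w(1) by auto
    have GH: "G \<tau> = G t" "H \<tau> = H t" using GH_Suc[of t] 4 by (auto simp: \<tau>_def)
    have tm: "\<tau> mod cycle e1 = cycle e1 div 4 + 2 * (cycle e1 div modulus p)" using 4 by (simp add: kick1_def q1_def)
    note K = pulse_second_kick[OF P1 sR lam1 tm z xi xi]
    define s2 where "s2 = a1 + lam1 (Im (G t)) * (s - a1)"
    have s2: "s2 \<in> {a1..rp}"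
      using s lam1[of "Im (G t)"] mult_left_le_one_le[of "s - a1" "lam1 (Im (G t))"] by (auto simp: s2_def)
    have "\<zeta> \<tau> $ p = \<i> * s2" using new[of p] K(1) v2 by (simp add: s2_def)
    moreover have "\<zeta> \<tau> $ (p + 1) = G \<tau>"
      using new[of "p + 1"] K(2) v2 GH by simp
    moreover have "\<zeta> \<tau> $ (p + 1 + 1) = H \<tau>"
      using new[of "p + 1 + 1"] K(3)[of "p + 1 + 1"] h v2 GH idx(4) by simp
    ultimately show ?thesis using s2 w(2) unfolding Inv_def by auto
  next
    case 5
    have v: "v1 x = 0" "v2 x = 0" by (rule rest1[OF 5(1,2)], rule rest2[OF 5(3,4)])
    have "\<zeta> \<tau> $ i = \<zeta> t $ i" for i using new[of i] v by simp
    moreover have "window \<tau> = window t" "G \<tau> = G t" "H \<tau> = H t"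
      using window_Suc[of t] GH_Suc[of t] 5 by (auto simp: \<tau>_def)
    ultimately show ?thesis using I unfolding Inv_def by (simp only:)
  qed
  then show ?thesis by (simp add: \<tau>_def)
qed

lemma Inv_all: "t \<le> cycle e2 \<Longrightarrow> Inv t"
proof (induction t)
  case 0
  have "\<not> window 0" using kick_order by (simp add: window_def)
  then show ?case using init rp kick_order unfolding Inv_def by (auto simp: G_def H_def intro!: bexI[of _ rp])
next
  case (Suc t)
  then show ?case using Inv_step by simp
qed

lemma cycle_result:
  obtains s where "s \<in> {a1..rp}" "\<zeta> (cycle e2) $ p = \<i> * s" "\<zeta> (cycle e2) $ (p + 1) = \<i> * (a2 + lam2 rh * (rg - a2))"
    "\<zeta> (cycle e2) $ (p + 1 + 1) = \<i> * rh"
proof -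
  have "cycle e1 dvd cycle e2" using e by (simp add: cycle_def le_imp_power_dvd)
  then have "\<not> window (cycle e2)" using kick_order by (simp add: window_def)
  moreover have "G (cycle e2) = \<i> * rg'" "H (cycle e2) = \<i> * rh" using kick_order by (auto simp: G_def H_def)
  ultimately show ?thesis using Inv_all[of "cycle e2"] that unfolding Inv_def by (auto simp: rg'_def)
qed

end

section \<open>The map in complex coordinates\<close>

text \<open>
  The map of the phase space in the coordinates \<open>z $ i = x\<^sub>i + \<i> y\<^sub>i\<close>.
\<close>

definition cmap :: "real ^ 3 \<Rightarrow> (real ^ 3 \<Rightarrow> real ^ 3) \<Rightarrow> complex ^ 3 \<Rightarrow> complex ^ 3" where
  "cmap \<omega> V z = (\<chi> i. z $ i * cis (2 * pi * \<omega> $ i) - \<i> * V (\<chi> j. Re (z $ j * cis (2 * pi * \<omega> $ j))) $ i)"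

definition corotating :: "real ^ 3 \<Rightarrow> (real ^ 3 \<Rightarrow> real ^ 3) \<Rightarrow> complex ^ 3 \<Rightarrow> nat \<Rightarrow> complex ^ 3" where
  "corotating \<omega> V z t = (\<chi> i. (cmap \<omega> V ^^ t) z $ i * cis (- (2 * pi * (real t * \<omega> $ i))))"

lemma corotating_Suc:
  "corotating \<omega> V z (Suc t) $ i = corotating \<omega> V z t $ i -
     \<i> * V (\<chi> j. Re (corotating \<omega> V z t $ j * cis (2 * pi * (real (Suc t) * \<omega> $ j)))) $ i * cis (- (2 * pi * (real (Suc t) * \<omega> $ i)))"
proof -
  define y where "y = (cmap \<omega> V ^^ t) z"
  have 1: "corotating \<omega> V z t $ j * cis (2 * pi * (real (Suc t) * \<omega> $ j)) = y $ j * cis (2 * pi * \<omega> $ j)" for j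
  proof -
    have "cis (- (2 * pi * (real t * \<omega> $ j))) * cis (2 * pi * (real (Suc t) * \<omega> $ j)) = cis (2 * pi * \<omega> $ j)"
      unfolding cis_mult by (rule arg_cong[of _ _ cis]) (simp add: algebra_simps)
    then show ?thesis by (simp add: corotating_def y_def mult.assoc)
  qed
  have 2: "cis (2 * pi * \<omega> $ i) * cis (- (2 * pi * (real (Suc t) * \<omega> $ i))) = cis (- (2 * pi * (real t * \<omega> $ i)))"
    unfolding cis_mult by (rule arg_cong[of _ _ cis]) (simp add: algebra_simps)
  have "corotating \<omega> V z (Suc t) $ i = cmap \<omega> V y $ i * cis (- (2 * pi * (real (Suc t) * \<omega> $ i)))"
    by (simp add: corotating_def y_def)
  also have "\<dots> = y $ i * (cis (2 * pi * \<omega> $ i) * cis (- (2 * pi * (real (Suc t) * \<omega> $ i)))) -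
     \<i> * V (\<chi> j. Re (y $ j * cis (2 * pi * \<omega> $ j))) $ i * cis (- (2 * pi * (real (Suc t) * \<omega> $ i)))"
    by (simp only: cmap_def vec_lambda_beta left_diff_distrib mult.assoc)
  also have "\<dots> = corotating \<omega> V z t $ i -
     \<i> * V (\<chi> j. Re (corotating \<omega> V z t $ j * cis (2 * pi * (real (Suc t) * \<omega> $ j)))) $ i * cis (- (2 * pi * (real (Suc t) * \<omega> $ i)))"
    unfolding 1 2 by (simp only: corotating_def y_def vec_lambda_beta)
  finally show ?thesis .
qed

lemma corotating_norm: "cmod (corotating \<omega> V z t $ i) = cmod ((cmap \<omega> V ^^ t) z $ i)"
  by (simp add: corotating_def norm_mult)

lemma corotating_period:
  assumes "\<And>i. real t * \<omega> $ i \<in> \<int>"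
  shows "corotating \<omega> V z t = (cmap \<omega> V ^^ t) z"
proof -
  have "cis (- (2 * pi * (real t * \<omega> $ i))) = 1" for i
    using cis_eq_if_diff_Ints[of "- (real t * \<omega> $ i)" 0] assms[of i] by simp
  then show ?thesis by (simp add: corotating_def vec_eq_iff)
qed

text \<open>
  Iterating cycles of the later pulse. Its own gate \<open>p + 2\<close> is the same at the beginning of each cycle, so
  the radius of plane \<open>p + 1\<close> converges geometrically to \<open>a2\<close>, with the constant factor \<open>lam2\<close>.
\<close>

lemma stage_run:
  fixes r \<rho> :: "real ^ 3"
  assumes P1: "pulse p e1 (\<omega> $ p) (\<omega> $ (p + 1)) a1 R1 rg1 \<delta>p1 \<delta>g1 lam1 mu1 v1"
    and P2: "pulse (p + 1) e2 (\<omega> $ (p + 1)) (\<omega> $ (p + 1 + 1)) a2 R2 rg2 \<delta>p2 \<delta>g2 lam2 mu2 v2"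
    and e: "24 dvd e1" "24 dvd e2" "e1 < e2"
    and lam1: "\<And>y. 0 < lam1 y" "\<And>y. lam1 y \<le> 1"
    and lam2: "\<And>y. 0 < lam2 y" "\<And>y. lam2 y \<le> 1"
    and b1: "\<And>x i. \<bar>v1 x $ i\<bar> \<le> b1" and b2: "\<And>x i. \<bar>v2 x $ i\<bar> \<le> b2"
    and V: "\<And>x. (\<And>i. x $ i \<le> \<rho> $ i) \<Longrightarrow> V x = v1 x + v2 x"
    and rp: "0 \<le> a1" "a1 \<le> r $ p" "r $ p \<le> R1" and rg: "0 \<le> a2" "a2 \<le> r $ (p + 1)" "r $ (p + 1) \<le> R2" "r $ (p + 1) \<le> rg1"
    and rh: "0 \<le> r $ (p + 1 + 1)" "r $ (p + 1 + 1) \<le> rg2"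
    and small: "b1 \<le> \<delta>p1" "b1 + b2 \<le> \<delta>g1" "b1 + b2 \<le> \<delta>p2" "b2 \<le> \<delta>g2"
    and region: "r $ p + b1 \<le> \<rho> $ p" "r $ (p + 1) + b1 + b2 \<le> \<rho> $ (p + 1)" "r $ (p + 1 + 1) + b2 \<le> \<rho> $ (p + 1 + 1)"
    and per: "\<And>i. real (cycle e2) * \<omega> $ i \<in> \<int>"
  shows "(\<exists>s\<in>{a1..r $ p}. (cmap \<omega> V ^^ (K * cycle e2)) (\<chi> i. \<i> * r $ i) =
     (\<chi> i. \<i> * complex_of_real (if i = p then s else if i = p + 1 then a2 + lam2 (r $ (p + 1 + 1)) ^ K * (r $ (p + 1) - a2) else r $ i))) \<and>
     (\<forall>t i. t \<le> K * cycle e2 \<longrightarrow> cmod ((cmap \<omega> V ^^ t) (\<chi> i. \<i> * r $ i) $ i) \<le> \<rho> $ i)"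
proof (induction K)
  case 0
  have ix: "p + 1 \<noteq> p" "p + 1 + 1 \<noteq> p" "p + 1 + 1 \<noteq> p + 1" "i = p \<or> i = p + 1 \<or> i = p + 1 + 1" for i
    using three_cases[of p] three_cases[of i] by auto
  have b: "0 \<le> b1" "0 \<le> b2" using b1[of 0 1] b2[of 0 1] by auto
  have "r $ i \<le> \<rho> $ i \<and> 0 \<le> r $ i" for i using ix(4)[of i] region b rp rg rh by auto
  then have "cmod (\<i> * complex_of_real (r $ i)) \<le> \<rho> $ i" for i by (simp add: norm_mult)
  moreover have "(\<chi> i. \<i> * complex_of_real (r $ i)) = (\<chi> i. \<i> * complex_of_real (if i = p then r $ p else if i = p + 1 then a2 + lam2 (r $ (p + 1 + 1)) ^ 0 * (r $ (p + 1) - a2) else r $ i))"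
    by (simp add: vec_eq_iff)
  ultimately show ?case using rp by (auto intro!: bexI[of _ "r $ p"])
next
  case (Suc K)
  have ix: "p + 1 \<noteq> p" "p + 1 + 1 \<noteq> p" "p + 1 + 1 \<noteq> p + 1" "i = p \<or> i = p + 1 \<or> i = p + 1 + 1" for i
    using three_cases[of p] three_cases[of i] by auto
  define C where "C = cycle e2"
  define l where "l = lam2 (r $ (p + 1 + 1))"
  define g where "g = a2 + l ^ K * (r $ (p + 1) - a2)"
  define z0 :: "complex ^ 3" where "z0 = (\<chi> i. \<i> * r $ i)"
  obtain s where s: "s \<in> {a1..r $ p}" and zK: "(cmap \<omega> V ^^ (K * C)) z0 =
     (\<chi> i. \<i> * complex_of_real (if i = p then s else if i = p + 1 then g else r $ i))"
    and nK: "\<And>t i. t \<le> K * C \<Longrightarrow> cmod ((cmap \<omega> V ^^ t) z0 $ i) \<le> \<rho> $ i"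
    using Suc unfolding C_def l_def g_def z0_def by blast
  define z where "z = (cmap \<omega> V ^^ (K * C)) z0"
  have zi: "z $ p = \<i> * s" "z $ (p + 1) = \<i> * g" "z $ (p + 1 + 1) = \<i> * r $ (p + 1 + 1)"
    using ix unfolding z_def zK by auto
  have l: "0 < l" "l \<le> 1" using lam2 by (auto simp: l_def)
  have "l ^ K \<le> 1" "0 \<le> l ^ K" using l by (auto intro: power_le_one)
  then have "0 \<le> l ^ K * (r $ (p + 1) - a2)" "l ^ K * (r $ (p + 1) - a2) \<le> 1 * (r $ (p + 1) - a2)"
    using rg by (auto simp: mult_left_le_one_le)
  then have gb: "a2 \<le> g" "g \<le> r $ (p + 1)" by (auto simp: g_def)
  interpret two_pulses p e1 e2 \<omega> a1 R1 rg1 \<delta>p1 \<delta>g1 b1 a2 R2 rg2 \<delta>p2 \<delta>g2 b2 s g "r $ (p + 1 + 1)" lam1 mu1 lam2 mu2 v1 v2 V \<rho> "corotating \<omega> V z"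
  proof
    show "corotating \<omega> V z 0 $ p = \<i> * s" "corotating \<omega> V z 0 $ (p + 1) = \<i> * g"
      "corotating \<omega> V z 0 $ (p + 1 + 1) = \<i> * r $ (p + 1 + 1)"
      using zi by (simp_all add: corotating_def)
  qed (use assms s gb corotating_Suc in \<open>auto\<close>)
  obtain s' where s': "s' \<in> {a1..s}" "corotating \<omega> V z C $ p = \<i> * s'" "corotating \<omega> V z C $ (p + 1) = \<i> * (a2 + l * (g - a2))"
    "corotating \<omega> V z C $ (p + 1 + 1) = \<i> * r $ (p + 1 + 1)"
    using cycle_result unfolding C_def l_def by blast
  have "(cmap \<omega> V ^^ (Suc K * C)) z0 = (cmap \<omega> V ^^ C) z"
    by (simp add: z_def funpow_add)
  also have "\<dots> = corotating \<omega> V z C" using corotating_period[of C \<omega>] per by (simp add: C_def)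
  also have "\<dots> = (\<chi> i. \<i> * complex_of_real (if i = p then s' else if i = p + 1 then a2 + l ^ Suc K * (r $ (p + 1) - a2) else r $ i))"
  proof (subst vec_eq_iff, rule allI)
    fix i
    have "a2 + l * (g - a2) = a2 + l ^ Suc K * (r $ (p + 1) - a2)" by (simp add: g_def)
    note s3 = s'(3)[unfolded this]
    show "corotating \<omega> V z C $ i = (\<chi> i. \<i> * complex_of_real (if i = p then s' else if i = p + 1 then a2 + l ^ Suc K * (r $ (p + 1) - a2) else r $ i)) $ i"
      using ix(4)[of i]
      by (elim disjE) (simp_all only: vec_lambda_beta s'(2,4) s3 ix(1-3) if_True if_False refl simp_thms)
  qed
  finally have zz: "(cmap \<omega> V ^^ (Suc K * C)) z0 = (\<chi> i. \<i> * complex_of_real (if i = p then s' else if i = p + 1 then a2 + l ^ Suc K * (r $ (p + 1) - a2) else r $ i))" .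
  have "cmod ((cmap \<omega> V ^^ t) z0 $ i) \<le> \<rho> $ i" if t: "t \<le> Suc K * C" for t i
  proof (cases "t \<le> K * C")
    case True
    then show ?thesis by (rule nK)
  next
    case False
    define u where "u = t - K * C"
    have u: "t = u + K * C" "u \<le> C" using False t by (auto simp: u_def)
    have "(cmap \<omega> V ^^ t) z0 = (cmap \<omega> V ^^ u) z" unfolding u z_def by (simp add: funpow_add)
    then have "cmod ((cmap \<omega> V ^^ t) z0 $ i) = cmod (corotating \<omega> V z u $ i)" by (simp add: corotating_norm)
    also have "\<dots> \<le> \<rho> $ i" using Inv_norm[OF Inv_all] u by (simp add: C_def)
    finally show ?thesis .
  qed
  moreover have "s' \<in> {a1..r $ p}" using s' s by auto
  ultimately show ?case using zz unfolding C_def[symmetric] l_def[symmetric] z0_def[symmetric] by blast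
qed

definition cmap_inv :: "real ^ 3 \<Rightarrow> (real ^ 3 \<Rightarrow> real ^ 3) \<Rightarrow> complex ^ 3 \<Rightarrow> complex ^ 3" where
  "cmap_inv \<omega> V z = (\<chi> i. (z $ i + \<i> * V (\<chi> j. Re (z $ j)) $ i) * cis (- (2 * pi * \<omega> $ i)))"

lemma cmap_cmap_inv: "cmap \<omega> V (cmap_inv \<omega> V z) = z"
proof -
  have 1: "cmap_inv \<omega> V z $ i * cis (2 * pi * \<omega> $ i) = z $ i + \<i> * V (\<chi> j. Re (z $ j)) $ i" for i
    by (simp add: cmap_inv_def mult.assoc cis_mult)
  show ?thesis unfolding cmap_def 1 by (simp add: vec_eq_iff)
qed

lemma cmap_inv_cmap: "cmap_inv \<omega> V (cmap \<omega> V z) = z"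
proof -
  have "Re (cmap \<omega> V z $ j) = Re (z $ j * cis (2 * pi * \<omega> $ j))" for j by (simp add: cmap_def)
  then have "cmap \<omega> V z $ i + \<i> * V (\<chi> j. Re (cmap \<omega> V z $ j)) $ i = z $ i * cis (2 * pi * \<omega> $ i)" for i
    by (simp add: cmap_def)
  then show ?thesis by (simp add: cmap_inv_def vec_eq_iff mult.assoc cis_mult)
qed

lemma cmap_pow_inv: "k \<le> N \<Longrightarrow> (cmap \<omega> V ^^ k) ((cmap_inv \<omega> V ^^ N) z) = (cmap_inv \<omega> V ^^ (N - k)) z"
proof (induction k)
  case (Suc k)
  then have "N - k = Suc (N - Suc k)" by simp
  then show ?case using Suc by (simp add: cmap_cmap_inv)
qed simp

lemma cmap_inv_pow: "(cmap \<omega> V ^^ N) w = z \<Longrightarrow> (cmap_inv \<omega> V ^^ N) z = w"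
proof (induction N arbitrary: w)
  case (Suc N)
  have "(cmap_inv \<omega> V ^^ N) z = cmap \<omega> V w" using Suc.prems by (intro Suc.IH) (simp add: funpow_swap1)
  then show ?case by (simp add: cmap_inv_cmap)
qed simp

lemma continuous_cmap_inv:
  assumes "continuous_on UNIV V" shows "continuous_on UNIV (cmap_inv \<omega> V)"
  unfolding cmap_inv_def
  by (intro continuous_on_vec_lambda continuous_intros continuous_on_compose2[OF assms]) auto

text \<open>
  Finitely many iterations depend continuously on the map, in the topology of uniform convergence on bounded
  sets.
\<close>

lemma finite_time_closeness:
  fixes F :: "'a::real_normed_vector \<Rightarrow> 'a"
  assumes "continuous_on UNIV F" "\<epsilon> > 0"
  obtains \<delta> B where "\<delta> > 0" "\<And>F'. (\<And>y. norm y \<le> B \<Longrightarrow> dist (F' y) (F y) \<le> \<delta>) \<Longrightarrow> \<forall>k\<le>N. dist ((F' ^^ k) z) ((F ^^ k) z) \<le> \<epsilon>"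
proof -
  have "\<exists>\<delta>>0. \<exists>B. \<forall>F'. (\<forall>y. norm y \<le> B \<longrightarrow> dist (F' y) (F y) \<le> \<delta>) \<longrightarrow> (\<forall>k\<le>N. dist ((F' ^^ k) z) ((F ^^ k) z) \<le> \<epsilon>)"
    using assms(2)
  proof (induction N arbitrary: \<epsilon>)
    case 0
    then show ?case by (intro exI[of _ 1]) auto
  next
    case (Suc N)
    have "isCont F ((F ^^ N) z)" using assms(1) by (simp add: continuous_on_eq_continuous_at)
    then obtain d where d: "d > 0" "\<And>y. dist y ((F ^^ N) z) < d \<Longrightarrow> dist (F y) (F ((F ^^ N) z)) < \<epsilon> / 2"
      using Suc.prems unfolding continuous_at_eps_delta by (metis half_gt_zero)
    define \<epsilon>' where "\<epsilon>' = min \<epsilon> (min 1 (d / 2))"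
    have "\<epsilon>' > 0" using d Suc.prems by (simp add: \<epsilon>'_def)
    from Suc.IH[OF this] obtain \<delta> B where \<delta>: "\<delta> > 0"
      and IH: "\<And>F'. (\<forall>y. norm y \<le> B \<longrightarrow> dist (F' y) (F y) \<le> \<delta>) \<Longrightarrow> \<forall>k\<le>N. dist ((F' ^^ k) z) ((F ^^ k) z) \<le> \<epsilon>'" by blast
    define B' where "B' = max B (norm ((F ^^ N) z) + 1)"
    have "\<forall>k\<le>Suc N. dist ((F' ^^ k) z) ((F ^^ k) z) \<le> \<epsilon>"
      if F': "\<forall>y. norm y \<le> B' \<longrightarrow> dist (F' y) (F y) \<le> min \<delta> (\<epsilon> / 2)" for F'
    proof (intro allI impI)
      fix k assume k: "k \<le> Suc N"
      have I: "\<forall>k\<le>N. dist ((F' ^^ k) z) ((F ^^ k) z) \<le> \<epsilon>'" using F' by (intro IH) (auto simp: B'_def)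
      show "dist ((F' ^^ k) z) ((F ^^ k) z) \<le> \<epsilon>"
      proof (cases "k \<le> N")
        case True
        then show ?thesis using I by (auto simp: \<epsilon>'_def intro: order_trans)
      next
        case False
        then have kN: "k = Suc N" using k by simp
        define y where "y = (F' ^^ N) z"
        have y: "dist y ((F ^^ N) z) \<le> \<epsilon>'" using I by (simp add: y_def)
        have "norm y \<le> norm ((F ^^ N) z) + dist y ((F ^^ N) z)"
          using norm_triangle_ineq[of "y - (F ^^ N) z" "(F ^^ N) z"] by (simp add: dist_norm)
        then have "norm y \<le> B'" using y by (auto simp: B'_def \<epsilon>'_def)
        then have "dist (F' y) (F y) \<le> \<epsilon> / 2" using F' by auto
        moreover have "dist (F y) (F ((F ^^ N) z)) < \<epsilon> / 2" using d y by (intro d(2)) (auto simp: \<epsilon>'_def)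
        ultimately have "dist (F' y) (F ((F ^^ N) z)) \<le> \<epsilon>" using dist_triangle[of "F' y" "F ((F ^^ N) z)" "F y"] by linarith
        then show ?thesis by (simp add: kN y_def)
      qed
    qed
    moreover have "min \<delta> (\<epsilon> / 2) > 0" using \<delta> Suc.prems by simp
    ultimately show ?case by blast
  qed
  then show ?thesis using that by blast
qed

lemma cis_diff_bound: "cmod (cis x - cis y) \<le> \<bar>x - y\<bar>"
proof -
  have "cis x - cis y = cis y * (cis (x - y) - 1)" by (simp add: right_diff_distrib cis_mult)
  then have "cmod (cis x - cis y) = cmod (cis (x - y) - 1)" by (simp add: norm_mult)
  also have "\<dots> = cmod (exp (\<i> * of_real (x - y)) - 1)" by (simp only: cis_conv_exp)
  also have "\<dots> = 2 * \<bar>sin ((x - y) / 2)\<bar>" by (rule dist_exp_i_1)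
  also have "\<dots> \<le> 2 * \<bar>(x - y) / 2\<bar>" by (intro mult_left_mono abs_sin_x_le_abs_x) auto
  finally show ?thesis by simp
qed

lemma cmap_inv_close:
  assumes V: "\<And>x i. \<bar>V x $ i\<bar> \<le> B'" and d: "\<And>x i. \<bar>V' x $ i - V x $ i\<bar> \<le> b" and w: "\<And>i. \<bar>\<omega>' $ i - \<omega> $ i\<bar> \<le> c"
    and z: "norm z \<le> B"
  shows "dist (cmap_inv \<omega>' V' z) (cmap_inv \<omega> V z) \<le> 3 * (b + (B + B') * (2 * pi * c))"
proof -
  have comp: "cmod (cmap_inv \<omega>' V' z $ i - cmap_inv \<omega> V z $ i) \<le> b + (B + B') * (2 * pi * c)" for i
  proof -
    define x :: "real ^ 3" where "x = (\<chi> j. Re (z $ j))"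
    have "cmap_inv \<omega>' V' z $ i - cmap_inv \<omega> V z $ i = \<i> * of_real (V' x $ i - V x $ i) * cis (- (2 * pi * \<omega>' $ i))
       + (z $ i + \<i> * V x $ i) * (cis (- (2 * pi * \<omega>' $ i)) - cis (- (2 * pi * \<omega> $ i)))"
      by (simp add: cmap_inv_def x_def algebra_simps)
    also have "cmod \<dots> \<le> cmod (\<i> * of_real (V' x $ i - V x $ i) * cis (- (2 * pi * \<omega>' $ i)))
       + cmod ((z $ i + \<i> * V x $ i) * (cis (- (2 * pi * \<omega>' $ i)) - cis (- (2 * pi * \<omega> $ i))))"
      by (rule norm_triangle_ineq)
    also have "cmod (\<i> * of_real (V' x $ i - V x $ i) * cis (- (2 * pi * \<omega>' $ i))) \<le> b"
      unfolding norm_mult norm_ii norm_cis norm_of_real using d by simp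
    also have "cmod ((z $ i + \<i> * V x $ i) * (cis (- (2 * pi * \<omega>' $ i)) - cis (- (2 * pi * \<omega> $ i)))) \<le> (B + B') * (2 * pi * c)"
      unfolding norm_mult
    proof (rule mult_mono)
      have "cmod (z $ i + \<i> * V x $ i) \<le> cmod (z $ i) + \<bar>V x $ i\<bar>"
        using norm_triangle_ineq[of "z $ i" "\<i> * V x $ i"] by (simp add: norm_mult)
      also have "cmod (z $ i) \<le> B" by (rule order_trans[OF Finite_Cartesian_Product.norm_nth_le z])
      finally show "cmod (z $ i + \<i> * V x $ i) \<le> B + B'" using V[of x i] by linarith
      then show "0 \<le> B + B'" by (rule order_trans[OF norm_ge_zero])
      have "cmod (cis (- (2 * pi * \<omega>' $ i)) - cis (- (2 * pi * \<omega> $ i))) \<le> \<bar>- (2 * pi * \<omega>' $ i) - (- (2 * pi * \<omega> $ i))\<bar>"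
        by (rule cis_diff_bound)
      also have "\<dots> = \<bar>2 * pi * (\<omega>' $ i - \<omega> $ i)\<bar>" by (simp add: algebra_simps abs_minus_commute)
      also have "\<dots> \<le> 2 * pi * c" using w[of i] by (simp add: abs_mult)
      finally show "cmod (cis (- (2 * pi * \<omega>' $ i)) - cis (- (2 * pi * \<omega> $ i))) \<le> 2 * pi * c" .
    qed auto
    finally show ?thesis by simp
  qed
  have "dist (cmap_inv \<omega>' V' z) (cmap_inv \<omega> V z) \<le> (\<Sum>i\<in>(UNIV :: 3 set). cmod ((cmap_inv \<omega>' V' z - cmap_inv \<omega> V z) $ i))"
    unfolding dist_norm norm_vec_def by (rule L2_set_le_sum) simp
  also have "\<dots> \<le> (\<Sum>i\<in>(UNIV :: 3 set). b + (B + B') * (2 * pi * c))"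
    by (intro sum_mono) (use comp in simp)
  finally show ?thesis by simp
qed

section \<open>One stage of the construction\<close>

lemma jet3_bound_mono:
  assumes "jet3_bound \<alpha> L \<mu> D" "\<mu> \<le> \<mu>'" "L > 0"
  shows "jet3_bound \<alpha> L \<mu>' D"
proof -
  have "\<mu> * (\<Prod>j\<in>UNIV. gweight \<alpha> L (k j)) \<le> \<mu>' * (\<Prod>j\<in>UNIV. gweight \<alpha> L (k j))" for k :: "3 \<Rightarrow> nat"
    using assms by (intro mult_right_mono prod_nonneg) (auto intro: less_imp_le gweight_pos)
  then show ?thesis using assms(1) unfolding jet3_bound_def by (meson order_trans)
qed

lemma grad_bound:
  assumes "jet3_bound \<alpha> L \<mu> D" "L > 0"
  shows "\<bar>grad D x $ i\<bar> \<le> \<mu>"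
proof -
  have "gweight \<alpha> L 0 = 1" using assms(2) by (simp add: gweight_def)
  then show ?thesis using assms(1)[unfolded jet3_bound_def, rule_format, of i "\<lambda>_. 0" x] by (simp add: grad_def)
qed

lemma continuous_grad:
  assumes "jet3 D" shows "continuous_on UNIV (grad D)"
  unfolding grad_def
proof (intro continuous_on_vec_lambda continuous_at_imp_continuous_on ballI)
  fix i x
  show "isCont (D (inc i (\<lambda>_. 0))) x"
    using assms has_derivative_continuous unfolding jet3_def by blast
qed

text \<open>
  A pulse that has room for a further perturbation: its forces use up at most half of the tolerances.
\<close>

definition pulse_state :: "real \<Rightarrow> 3 \<Rightarrow> nat \<Rightarrow> real ^ 3 \<Rightarrow> real ^ 3 \<Rightarrow> (real ^ 3 \<Rightarrow> real ^ 3) \<Rightarrow> bool" where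
  "pulse_state \<eta> p e \<omega> r v \<longleftrightarrow> (\<exists>a R rg \<delta>g b lam mu.
     pulse p e (\<omega> $ p) (\<omega> $ (p + 1)) a R rg (\<eta> * R) \<delta>g lam mu v \<and> (\<forall>y. 0 < lam y \<and> lam y \<le> 1) \<and>
     0 < a \<and> a \<le> r $ p \<and> r $ p \<le> R \<and> r $ (p + 1) \<le> rg \<and> (\<forall>x i. \<bar>v x $ i\<bar> \<le> b) \<and>
     0 < \<delta>g \<and> 2 * b \<le> \<delta>g \<and> \<delta>g \<le> \<eta> * R \<and> \<delta>g \<le> \<eta> / 4 * r $ p \<and> \<delta>g \<le> \<eta> / 4 * r $ (p + 1))"

text \<open>
  The last pulse \<open>v\<close> is the only part of \<open>V\<close> that acts within the radii reached, and it disappears as soon as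
  the radius of its gate plane drops below \<open>1 - \<eta> / 4\<close> of its present value. This happens in the next
  stage, when the gate plane is pushed itself.
\<close>

definition stage_inv :: "real \<Rightarrow> 3 \<Rightarrow> nat \<Rightarrow> real ^ 3 \<Rightarrow> real ^ 3 \<Rightarrow> (real ^ 3 \<Rightarrow> real ^ 3) \<Rightarrow> (real ^ 3 \<Rightarrow> real ^ 3) \<Rightarrow> bool" where
  "stage_inv \<eta> p e \<omega> r v V \<longleftrightarrow> freq_ok p e \<omega> \<and> pulse_state \<eta> p e \<omega> r v \<and> (\<forall>i. 0 < r $ i) \<and>
     (\<forall>x. x $ (p + 1) \<le> (1 - \<eta> / 4) * r $ (p + 1) \<longrightarrow> v x = 0) \<and>
     (\<forall>x. (\<forall>i. x $ i \<le> (1 + \<eta> / 4) * r $ i) \<longrightarrow> V x = v x) \<and>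
     continuous_on UNIV V \<and> (\<exists>B. \<forall>x i. \<bar>V x $ i\<bar> \<le> B)"

definition imag_point :: "real ^ 3 \<Rightarrow> complex ^ 3" where
  "imag_point r = (\<chi> i. \<i> * r $ i)"

text \<open>
  A new pulse of arbitrarily small size is added, which pushes plane \<open>p + 1\<close> until its radius has lost the
  fraction \<open>\<eta> / 2\<close>. The order of choices matters: first the tolerance \<open>\<delta>\<close> that keeps the first \<open>N\<close> steps of
  the orbit, then the change of frequency, then the gate level \<open>\<gamma>\<close> just below the present radius of
  the new gate plane, then the size of the pulse, and at last the number \<open>K\<close> of cycles, which compensates the
  weakness of the pulse. The orbit is continued from its end point: the new starting point is the preimage
  of the old end point under \<open>N\<close> steps of the new map, and it stays close to the old orbit by continuity of the
  inverse map.
\<close>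

lemma stage_step:
  fixes m N :: nat and w :: "complex ^ 3"
  assumes \<alpha>: "\<alpha> > 1" and L: "L > 0" and \<eta>: "separated \<eta>" and \<mu>: "\<mu> > 0" and \<epsilon>: "\<epsilon> > 0"
    and inv: "stage_inv \<eta> p e \<omega> r v V" and w: "(cmap \<omega> V ^^ N) w = imag_point r"
  obtains D e' \<omega>' r' N' w' where "jet3 D" "jet3_bound \<alpha> L \<mu> D" "\<And>k. D k 0 = 0"
    "e + m < e'" "\<omega>' = (\<chi> i. if i = p + 2 then \<omega> $ i - 1 / 2 ^ e' else \<omega> $ i)"
    "stage_inv \<eta> (p + 1) e' \<omega>' r' (grad D) (\<lambda>x. V x + grad D x)"
    "(cmap \<omega>' (\<lambda>x. V x + grad D x) ^^ N') w' = imag_point r'" "N < N'"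
    "r' $ (p + 1) \<le> (1 - \<eta> / 2) * r $ (p + 1)" "\<And>i. r' $ i \<le> r $ i"
    "\<And>k. k \<le> N \<Longrightarrow> dist ((cmap \<omega>' (\<lambda>x. V x + grad D x) ^^ k) w') ((cmap \<omega> V ^^ k) w) \<le> \<epsilon>"
    "\<And>k i. N \<le> k \<Longrightarrow> k \<le> N' \<Longrightarrow> cmod ((cmap \<omega>' (\<lambda>x. V x + grad D x) ^^ k) w' $ i) \<le> 2 * r $ i"
proof -
  have ix: "p + 1 \<noteq> p" "p + 1 + 1 \<noteq> p" "p + 1 + 1 \<noteq> p + 1" "p + 2 = p + 1 + 1" "i = p \<or> i = p + 1 \<or> i = p + 1 + 1" for i
    using three_cases[of p] three_cases[of i] by auto
  have \<eta>1: "0 < \<eta>" "\<eta> < 1 / 100" using \<eta> by (auto simp: separated_def)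
  have fo: "freq_ok p e \<omega>" and rpos: "\<And>i. 0 < r $ i"
    and closing: "\<And>x. x $ (p + 1) \<le> (1 - \<eta> / 4) * r $ (p + 1) \<Longrightarrow> v x = 0"
    and agree: "\<And>x. (\<And>i. x $ i \<le> (1 + \<eta> / 4) * r $ i) \<Longrightarrow> V x = v x"
    and cont: "continuous_on UNIV V"
    using inv unfolding stage_inv_def by blast+
  obtain B where B: "\<And>x i. \<bar>V x $ i\<bar> \<le> B" using inv unfolding stage_inv_def by blast
  obtain a1 R1 rg1 \<delta>1 b1 lam1 mu1 where P1: "pulse p e (\<omega> $ p) (\<omega> $ (p + 1)) a1 R1 rg1 (\<eta> * R1) \<delta>1 lam1 mu1 v"
     and lam1: "\<And>y. 0 < lam1 y" "\<And>y. lam1 y \<le> 1"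
     and a1: "0 < a1" "a1 \<le> r $ p" "r $ p \<le> R1" "r $ (p + 1) \<le> rg1" and b1: "\<And>x i. \<bar>v x $ i\<bar> \<le> b1"
     and "0 < \<delta>1" and d1: "2 * b1 \<le> \<delta>1" "\<delta>1 \<le> \<eta> * R1" "\<delta>1 \<le> \<eta> / 4 * r $ p" "\<delta>1 \<le> \<eta> / 4 * r $ (p + 1)"
  proof -
    have "pulse_state \<eta> p e \<omega> r v" using inv unfolding stage_inv_def by blast
    then show ?thesis unfolding pulse_state_def by (elim exE conjE) (rule that, assumption, blast+)
  qed
  have "b1 \<ge> 0" using b1[of 0 1] by simp
  have e24: "24 dvd e" using fo by (simp add: freq_ok_def)
  obtain \<delta> B0 where \<delta>: "\<delta> > 0" and close: "\<And>F'. (\<And>y. norm y \<le> B0 \<Longrightarrow> dist (F' y) (cmap_inv \<omega> V y) \<le> \<delta>) \<Longrightarrow>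
      \<forall>k\<le>N. dist ((F' ^^ k) (imag_point r)) ((cmap_inv \<omega> V ^^ k) (imag_point r)) \<le> \<epsilon>"
    using finite_time_closeness[OF continuous_cmap_inv[OF cont] \<epsilon>] by metis
  \<comment> \<open>A change \<open>c\<close> of the frequency moves points of norm at most \<open>\<bar>B0\<bar> + \<bar>B\<bar>\<close> by at most \<open>2 pi c\<close> times this norm; all three coordinates together may use half of \<open>\<delta>\<close>.\<close>
  define Q where "Q = (\<bar>B0\<bar> + \<bar>B\<bar> + 1) * 2 * pi * 6 / \<delta>"
  obtain k0 where k0: "Q < 2 ^ k0" using real_arch_pow[of 2 Q] by auto
  define e' where "e' = 24 * (e + m + k0 + 1)"
  have e': "24 dvd e'" "e + m < e'" "e < e'" "k0 \<le> e'" by (auto simp: e'_def)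
  define c where "c = 1 / (2::real) ^ e'"
  have "(2::real) ^ k0 \<le> 2 ^ e'" using e' by (intro power_increasing) auto
  then have "Q \<le> 2 ^ e'" using k0 by linarith
  then have c: "(\<bar>B0\<bar> + \<bar>B\<bar> + 1) * (2 * pi * c) \<le> \<delta> / 6" using \<delta> by (simp add: Q_def c_def field_simps)
  define \<omega>' where "\<omega>' = (\<chi> i. if i = p + 2 then \<omega> $ i - 1 / 2 ^ e' else \<omega> $ i)"
  have \<omega>': "\<omega>' $ p = \<omega> $ p" "\<omega>' $ (p + 1) = \<omega> $ (p + 1)" using ix unfolding \<omega>'_def by auto
  have \<omega>c: "\<bar>\<omega>' $ i - \<omega> $ i\<bar> \<le> c" for i by (simp add: \<omega>'_def c_def)
  have fo': "freq_ok (p + 1) e' \<omega>'" unfolding \<omega>'_def by (rule freq_ok_advance[OF fo e'(1,3)])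
  define rh where "rh = r $ (p + 1 + 1)"
  define ri where "ri = r $ (p + 1)"
  have rr: "0 < rh" "0 < ri" using rpos by (auto simp: rh_def ri_def)
  define \<kappa> where "\<kappa> = cos (2 * pi / (cycle e' div modulus (p + 1)))"
  have "\<kappa> < 1"
  proof -
    have q: "4 \<le> cycle e' div modulus (p + 1)" by (rule freq_timing(5)[OF fo'])
    then have "0 < 2 * pi / (cycle e' div modulus (p + 1))" by simp
    moreover have "2 * pi / (cycle e' div modulus (p + 1)) \<le> 2 * pi / 4" using q by (intro divide_left_mono) auto
    ultimately show ?thesis unfolding \<kappa>_def using cos_monotone_0_pi[of 0 "2 * pi / (cycle e' div modulus (p + 1))"] by simp
  qed
  \<comment> \<open>The gate must be closed at all times but the widest opening, and it must close for good when its radius shrinks by \<open>\<eta> / 4\<close>.\<close>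
  define \<gamma>0 where "\<gamma>0 = max \<kappa> (1 - \<eta> / 4)"
  have \<gamma>0: "\<gamma>0 < 1" "\<kappa> \<le> \<gamma>0" "1 - \<eta> / 4 \<le> \<gamma>0" using \<open>\<kappa> < 1\<close> \<eta>1 by (auto simp: \<gamma>0_def)
  define \<gamma> where "\<gamma> = (\<gamma>0 + 1) / 2 * rh"
  have \<gamma>: "\<gamma> < rh" "(1 - \<eta> / 4) * rh \<le> \<gamma>" "0 < \<gamma>"
  proof -
    show "\<gamma> < rh" using \<gamma>0 rr by (simp add: \<gamma>_def)
    show "(1 - \<eta> / 4) * rh \<le> \<gamma>" unfolding \<gamma>_def using \<gamma>0 rr by (intro mult_right_mono) auto
    moreover have "0 < (1 - \<eta> / 4) * rh" using \<eta>1 rr by (intro mult_pos_pos) auto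
    ultimately show "0 < \<gamma>" by linarith
  qed
  define \<delta>2 where "\<delta>2 = min ((1 - \<gamma>0) / 2 * rh) (min (\<eta> / 4 * rh) (\<eta> / 8 * ri))"
  have \<delta>2: "0 < \<delta>2" "\<delta>2 \<le> (1 - \<gamma>0) / 2 * rh" "\<delta>2 \<le> \<eta> / 4 * rh" "\<delta>2 \<le> \<eta> / 8 * ri"
    using \<gamma>0 rr \<eta>1 by (auto simp: \<delta>2_def)
  have gate: "rh * cos (2 * pi / (cycle e' div modulus (p + 1))) + \<delta>2 \<le> \<gamma>"
  proof -
    have "rh * \<kappa> \<le> rh * \<gamma>0" using \<gamma>0 rr by simp
    then show ?thesis using \<delta>2(2) unfolding \<kappa>_def[symmetric] \<gamma>_def by (simp add: algebra_simps)
  qed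
  \<comment> \<open>The new force has to stay within half of its own tolerance and within the half of the old tolerance that is still free.\<close>
  define b2 where "b2 = min \<mu> (min (\<delta> / 6) (min (\<delta>2 / 2) (\<delta>1 / 2)))"
  have b2: "0 < b2" "b2 \<le> \<mu>" "b2 \<le> \<delta> / 6" "b2 \<le> \<delta>2 / 2" "b2 \<le> \<delta>1 / 2"
    using \<mu> \<delta> \<delta>2 \<open>0 < \<delta>1\<close> by (auto simp: b2_def)
  obtain D lam2 mu2 where D: "jet3 D" "jet3_bound \<alpha> L b2 D"
    and lam2: "\<And>y. 0 < lam2 y" "\<And>y. lam2 y \<le> 1" "\<And>y. y > \<gamma> \<Longrightarrow> lam2 y < 1"
    and Dg: "\<And>k x. x $ (p + 1 + 1) \<le> \<gamma> \<Longrightarrow> D k x = 0"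
    and P2: "pulse (p + 1) e' (\<omega>' $ (p + 1)) (\<omega>' $ (p + 1 + 1)) ((1 - \<eta>) * ri) ri rh (\<eta> * ri) \<delta>2 lam2 mu2 (grad D)"
    using pulse_exists[OF \<alpha> L \<eta> fo' rr(2,1) gate b2(1)] by blast
  define v2 where "v2 = grad D"
  define V' where "V' = (\<lambda>x. V x + v2 x)"
  have v2b: "\<bar>v2 x $ i\<bar> \<le> b2" for x i unfolding v2_def by (rule grad_bound[OF D(2) L])
  define a2 where "a2 = (1 - \<eta>) * ri"
  have a2: "0 < a2" "a2 \<le> ri" "ri - a2 = \<eta> * ri" using \<eta>1 rr by (auto simp: a2_def algebra_simps)
  define l where "l = lam2 rh"
  have l: "0 < l" "l < 1" using lam2 \<gamma> by (auto simp: l_def)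
  obtain K where K: "l ^ K < 1 / 2" using real_arch_pow_inv[of "1/2" l] l by auto
  have K0: "K > 0" using K by (cases K) auto
  \<comment> \<open>Within these radii the stage invariant identifies the old force with the last pulse.\<close>
  define \<rho> :: "real ^ 3" where "\<rho> = (\<chi> i. (1 + \<eta> / 4) * r $ i)"
  have run: "(\<exists>s\<in>{a1..r $ p}. (cmap \<omega>' V' ^^ (K * cycle e')) (\<chi> i. \<i> * r $ i) =
     (\<chi> i. \<i> * complex_of_real (if i = p then s else if i = p + 1 then a2 + lam2 (r $ (p + 1 + 1)) ^ K * (r $ (p + 1) - a2) else r $ i))) \<and>
     (\<forall>t i. t \<le> K * cycle e' \<longrightarrow> cmod ((cmap \<omega>' V' ^^ t) (\<chi> i. \<i> * r $ i) $ i) \<le> \<rho> $ i)"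
  proof (rule stage_run)
    show "pulse p e (\<omega>' $ p) (\<omega>' $ (p + 1)) a1 R1 rg1 (\<eta> * R1) \<delta>1 lam1 mu1 v" unfolding \<omega>' by (rule P1)
    show "pulse (p + 1) e' (\<omega>' $ (p + 1)) (\<omega>' $ (p + 1 + 1)) a2 ri rh (\<eta> * ri) \<delta>2 lam2 mu2 v2"
      using P2 by (simp only: a2_def v2_def)
    show "V' x = v x + v2 x" if "\<And>i. x $ i \<le> \<rho> $ i" for x
      using agree[of x] that by (simp add: \<rho>_def V'_def)
    show "real (cycle e') * \<omega>' $ i \<in> \<int>" for i by (rule freq_ok_periodic[OF fo'])
    show "b1 \<le> \<eta> * R1" "b1 + b2 \<le> \<delta>1" "b1 + b2 \<le> \<eta> * ri" "b2 \<le> \<delta>2"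
      using d1 b2 \<open>b1 \<ge> 0\<close> \<delta>2 \<open>0 < \<delta>1\<close> rr \<eta>1 unfolding ri_def
      by (auto intro: order_trans[of _ "\<delta>1"] order_trans[OF _ d1(4), THEN order_trans])
    show "r $ p + b1 \<le> \<rho> $ p" "r $ (p + 1) + b1 + b2 \<le> \<rho> $ (p + 1)" "r $ (p + 1 + 1) + b2 \<le> \<rho> $ (p + 1 + 1)"
      using d1 b2 \<delta>2 \<open>b1 \<ge> 0\<close> unfolding \<rho>_def rh_def by (auto simp: distrib_right)
  qed (use e' e24 lam1 lam2 b1 v2b a1 a2 rpos in \<open>auto simp: ri_def rh_def intro: less_imp_le\<close>)
  obtain s where s: "s \<in> {a1..r $ p}" and end_pt: "(cmap \<omega>' V' ^^ (K * cycle e')) (imag_point r) =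
     (\<chi> i. \<i> * complex_of_real (if i = p then s else if i = p + 1 then a2 + l ^ K * (ri - a2) else r $ i))"
    and stay: "\<And>t i. t \<le> K * cycle e' \<Longrightarrow> cmod ((cmap \<omega>' V' ^^ t) (imag_point r) $ i) \<le> \<rho> $ i"
    using run unfolding imag_point_def l_def rh_def ri_def by blast
  define r' :: "real ^ 3" where "r' = (\<chi> i. if i = p then s else if i = p + 1 then a2 + l ^ K * (ri - a2) else r $ i)"
  have r': "r' $ p = s" "r' $ (p + 1) = a2 + l ^ K * (ri - a2)" "r' $ (p + 1 + 1) = rh"
    using ix by (auto simp: r'_def rh_def)
  have "0 \<le> ri - a2" "0 \<le> l ^ K" "l ^ K \<le> 1 / 2" using a2 l K by auto
  then have lK: "0 \<le> l ^ K * (ri - a2)" "l ^ K * (ri - a2) \<le> 1 / 2 * (ri - a2)"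
    by (blast intro: mult_right_mono mult_nonneg_nonneg)+
  have r'b: "a2 \<le> r' $ (p + 1)" "r' $ (p + 1) \<le> (1 - \<eta> / 2) * ri"
    using lK a2(3) unfolding r' by (auto simp: a2_def algebra_simps)
  have "(1 - \<eta> / 2) * ri \<le> 1 * ri" using \<eta>1 rr by (intro mult_right_mono) auto
  then have r'ri: "r' $ (p + 1) \<le> ri" using r'b by simp
  have le: "r' $ i \<le> r $ i" for i
    using ix(5)[of i] r' s r'ri by (auto simp: ri_def rh_def)
  have pos': "0 < r' $ i" for i
    using ix(5)[of i] r'(1,3) s a1 a2(1) r'b(1) rr by (auto intro: less_le_trans)
  have cont': "continuous_on UNIV V'" unfolding V'_def v2_def by (intro continuous_on_add cont continuous_grad D)
  define w' where "w' = (cmap_inv \<omega>' V' ^^ N) (imag_point r)"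
  have wN: "(cmap \<omega>' V' ^^ N) w' = imag_point r" using cmap_pow_inv[of N N \<omega>' V' "imag_point r"] by (simp add: w'_def)
  show ?thesis
  proof (rule that[of D e' \<omega>' r' "K * cycle e' + N" w'])
    show "jet3 D" by fact
    show "jet3_bound \<alpha> L \<mu> D" using jet3_bound_mono[OF D(2) b2(2) L] .
    show "D k 0 = 0" for k using Dg[of 0 k] \<gamma> by simp
    show "e + m < e'" by fact
    show "\<omega>' = (\<chi> i. if i = p + 2 then \<omega> $ i - 1 / 2 ^ e' else \<omega> $ i)" by (rule \<omega>'_def)
    show "(cmap \<omega>' (\<lambda>x. V x + grad D x) ^^ (K * cycle e' + N)) w' = imag_point r'"
      using end_pt wN unfolding V'_def v2_def by (simp add: funpow_add imag_point_def r'_def)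
    show "N < K * cycle e' + N" using K0 by (simp add: cycle_def)
    show "r' $ (p + 1) \<le> (1 - \<eta> / 2) * r $ (p + 1)" using r'b by (simp add: ri_def)
    show "r' $ i \<le> r $ i" for i by (rule le)
    show "cmod ((cmap \<omega>' (\<lambda>x. V x + grad D x) ^^ k) w' $ i) \<le> 2 * r $ i" if k: "N \<le> k" "k \<le> K * cycle e' + N" for k i
    proof -
      define t where "t = k - N"
      have t: "k = t + N" "t \<le> K * cycle e'" using k by (auto simp: t_def)
      have "cmod ((cmap \<omega>' V' ^^ k) w' $ i) \<le> \<rho> $ i" using stay[OF t(2), of i] unfolding t(1) by (simp add: funpow_add wN)
      also have "\<rho> $ i \<le> 2 * r $ i" unfolding \<rho>_def using \<eta>1 rpos[of i] by (simp add: mult_right_mono)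
      finally show ?thesis by (simp add: V'_def v2_def)
    qed
    show "dist ((cmap \<omega>' (\<lambda>x. V x + grad D x) ^^ k) w') ((cmap \<omega> V ^^ k) w) \<le> \<epsilon>" if k: "k \<le> N" for k
    proof -
      have "dist (cmap_inv \<omega>' V' y) (cmap_inv \<omega> V y) \<le> \<delta>" if y: "norm y \<le> B0" for y
      proof -
        have "dist (cmap_inv \<omega>' V' y) (cmap_inv \<omega> V y) \<le> 3 * (b2 + (\<bar>B0\<bar> + \<bar>B\<bar>) * (2 * pi * c))"
        proof (rule cmap_inv_close)
          show "\<bar>V x $ i\<bar> \<le> \<bar>B\<bar>" for x i using B[of x i] by simp
          show "\<bar>V' x $ i - V x $ i\<bar> \<le> b2" for x i using v2b[of x i] by (simp add: V'_def)
          show "norm y \<le> \<bar>B0\<bar>" using y by simp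
        qed (rule \<omega>c)
        also have "(\<bar>B0\<bar> + \<bar>B\<bar>) * (2 * pi * c) \<le> (\<bar>B0\<bar> + \<bar>B\<bar> + 1) * (2 * pi * c)" by (intro mult_right_mono) (auto simp: c_def)
        also have "\<dots> \<le> \<delta> / 6" by (rule c)
        finally show ?thesis using b2(3) by simp
      qed
      then have cl: "\<forall>k\<le>N. dist ((cmap_inv \<omega>' V' ^^ k) (imag_point r)) ((cmap_inv \<omega> V ^^ k) (imag_point r)) \<le> \<epsilon>" by (rule close)
      have "(cmap \<omega> V ^^ k) w = (cmap_inv \<omega> V ^^ (N - k)) (imag_point r)"
        using cmap_pow_inv[OF k] cmap_inv_pow[OF w] by metis
      moreover have "(cmap \<omega>' V' ^^ k) w' = (cmap_inv \<omega>' V' ^^ (N - k)) (imag_point r)"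
        unfolding w'_def by (rule cmap_pow_inv[OF k])
      ultimately show ?thesis using cl by (simp add: V'_def v2_def)
    qed
    show "stage_inv \<eta> (p + 1) e' \<omega>' r' (grad D) (\<lambda>x. V x + grad D x)"
      unfolding stage_inv_def
    proof (intro conjI allI impI)
      show "freq_ok (p + 1) e' \<omega>'" by (rule fo')
      show "0 < r' $ i" for i by (rule pos')
      show "grad D x = 0" if "x $ (p + 1 + 1) \<le> (1 - \<eta> / 4) * r' $ (p + 1 + 1)" for x
        using Dg[of x] that \<gamma> r'(3) by (simp add: grad_def vec_eq_iff)
      show "V x + grad D x = grad D x" if x: "\<forall>i. x $ i \<le> (1 + \<eta> / 4) * r' $ i" for x
      proof -
        have "x $ i \<le> (1 + \<eta> / 4) * r $ i" for i
          using x le[of i] \<eta>1 mult_left_mono[OF le[of i], of "1 + \<eta> / 4"] by (auto intro: order_trans)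
        then have "V x = v x" by (rule agree)
        also have "v x = 0"
        proof (rule closing)
          have "x $ (p + 1) \<le> (1 + \<eta> / 4) * ((1 - \<eta> / 2) * ri)"
            using x[rule_format, of "p + 1"] mult_left_mono[OF r'b(2), of "1 + \<eta> / 4"] \<eta>1 by (auto intro: order_trans)
          also have "\<dots> = ((1 - \<eta> / 4) - \<eta>\<^sup>2 / 8) * ri" by (simp add: algebra_simps power2_eq_square)
          also have "\<dots> \<le> (1 - \<eta> / 4) * ri" using rr by (intro mult_right_mono) auto
          finally show "x $ (p + 1) \<le> (1 - \<eta> / 4) * r $ (p + 1)" by (simp add: ri_def)
        qed
        finally show ?thesis by simp
      qed
      show "continuous_on UNIV (\<lambda>x. V x + grad D x)" using cont' by (simp add: V'_def v2_def)
      have "\<bar>(V x + grad D x) $ i\<bar> \<le> B + b2" for x i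
        using B[of x i] v2b[of x i] by (simp add: v2_def)
      then show "\<exists>B. \<forall>x i. \<bar>(V x + grad D x) $ i\<bar> \<le> B" by blast
      show "pulse_state \<eta> (p + 1) e' \<omega>' r' (grad D)"
        unfolding pulse_state_def
      proof (intro exI conjI allI)
        show "pulse (p + 1) e' (\<omega>' $ (p + 1)) (\<omega>' $ (p + 1 + 1)) ((1 - \<eta>) * ri) ri rh (\<eta> * ri) \<delta>2 lam2 mu2 (grad D)" by (rule P2)
        show "0 < lam2 y" "lam2 y \<le> 1" for y by (rule lam2)+
        show "0 < (1 - \<eta>) * ri" "(1 - \<eta>) * ri \<le> r' $ (p + 1)" using a2 r'b by (simp_all add: a2_def)
        show "r' $ (p + 1) \<le> ri" by (rule r'ri)
        show "r' $ (p + 1 + 1) \<le> rh" using r' by simp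
        show "\<bar>grad D x $ i\<bar> \<le> b2" for x i using v2b by (simp add: v2_def)
        show "2 * b2 \<le> \<delta>2" using b2 by simp
        have "\<eta> / 8 * ri \<le> \<eta> * ri" using \<eta>1 rr by (intro mult_right_mono) auto
        then show "\<delta>2 \<le> \<eta> * ri" using \<delta>2(4) by linarith
        show "0 < \<delta>2" by (rule \<delta>2)
        have "\<eta> / 8 * ri \<le> \<eta> / 4 * a2"
        proof -
          have "1 / 2 * ri \<le> a2" unfolding a2_def using \<eta>1 rr by (intro mult_right_mono) auto
          then have "\<eta> / 4 * (1 / 2 * ri) \<le> \<eta> / 4 * a2" using \<eta>1 by (intro mult_left_mono) auto
          then show ?thesis by simp
        qed
        also have "\<dots> \<le> \<eta> / 4 * r' $ (p + 1)" using r'b \<eta>1 by (intro mult_left_mono) auto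
        finally show "\<delta>2 \<le> \<eta> / 4 * r' $ (p + 1)" using \<delta>2(4) by simp
        show "\<delta>2 \<le> \<eta> / 4 * r' $ (p + 1 + 1)" using \<delta>2 r' by simp
      qed
    qed
  qed
qed

section \<open>The sequence of stages\<close>

text \<open>
  Plane \<open>1\<close> is the gate of the first stage, so its frequency needs an odd numerator over the power of \<open>2\<close>.
\<close>

definition start_freq :: "real ^ 3" where
  "start_freq = (\<chi> i. if i = 1 then base_freq 1 - 1 / 2 ^ 24 else base_freq i)"

text \<open>
  With the force zero, the trivial pulse of strength \<open>lam = 1\<close> starts the induction.
\<close>

lemma stage_inv_start:
  assumes \<eta>: "separated \<eta>"
  shows "stage_inv \<eta> 0 24 start_freq 1 (\<lambda>_. 0) (\<lambda>_. 0)"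
proof -
  have \<eta>1: "0 < \<eta>" using \<eta> by (auto simp: separated_def)
  have f: "freq_ok 0 24 start_freq"
    unfolding freq_ok_def start_freq_def by (auto intro: exI[of _ "0::int"] exI[of _ "1::int"])
  have "pulse 0 24 (start_freq $ 0) (start_freq $ (0 + 1)) 1 1 1 (\<eta> * 1) (\<eta> / 4) (\<lambda>_. 1) (\<lambda>_. 0) (\<lambda>_. 0)"
    unfolding pulse_def
  proof (intro conjI allI impI)
    fix t j :: nat
    assume t: "t mod cycle 24 = cycle 24 div 4 + j * (cycle 24 div modulus 0)"
    show "cis (2 * pi * (real t * start_freq $ (0 + 1))) = - \<i>"
      using freq_timing(2,3)[OF f] t by blast
    have "2 * pi * (real j / modulus 0) = real j * (2 * pi / modulus 0)" by simp
    then show "cis (2 * pi * (real t * start_freq $ 0)) = cis (real j * (2 * pi / modulus 0))"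
      using freq_timing(3)[OF f t] by metis
  qed (auto simp: pair_vec_def vec_eq_iff)
  then have "pulse_state \<eta> 0 24 start_freq 1 (\<lambda>_. 0)"
    unfolding pulse_state_def using \<eta>1
    by (intro exI[of _ 1] exI[of _ "\<eta> / 4"] exI[of _ 0] exI[of _ "\<lambda>_. 1"] exI[of _ "\<lambda>_. 0"]) auto
  then show ?thesis using f by (auto simp: stage_inv_def intro: exI[of _ 0])
qed

text \<open>
  The deviations \<open>1 / 8 / 2 ^ n\<close> of the orbits add up to \<open>1 / 4\<close>, less than the norm of the first starting
  point.
\<close>

locale stages =
  fixes \<alpha> L \<eta> \<mu> :: real and D :: "nat \<Rightarrow> (3 \<Rightarrow> nat) \<Rightarrow> real ^ 3 \<Rightarrow> real" and e :: "nat \<Rightarrow> nat"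
    and \<omega> :: "nat \<Rightarrow> real ^ 3" and V :: "nat \<Rightarrow> real ^ 3 \<Rightarrow> real ^ 3" and r :: "nat \<Rightarrow> real ^ 3" and N :: "nat \<Rightarrow> nat"
    and w :: "nat \<Rightarrow> complex ^ 3"
  assumes L: "L > 0" and \<mu>: "\<mu> > 0" and \<eta>: "0 < \<eta>" "\<eta> < 1"
    and V0: "V 0 = (\<lambda>_. 0)" and D0: "D 0 = (\<lambda>_ _. 0)" and w0: "w 0 = imag_point 1"
    and jet: "jet3 (D (Suc n))" and bound: "jet3_bound \<alpha> L (\<mu> / 2 ^ Suc n) (D (Suc n))" and flat: "D (Suc n) l 0 = 0"
    and e: "e n + n < e (Suc n)"
    and \<omega>: "\<omega> (Suc n) = (\<chi> i. if i = of_nat n + 2 then \<omega> n $ i - 1 / 2 ^ e (Suc n) else \<omega> n $ i)"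
    and period: "real (cycle (e n)) * \<omega> n $ i \<in> \<int>"
    and V: "V (Suc n) = (\<lambda>x. V n x + grad (D (Suc n)) x)"
    and N: "N n < N (Suc n)"
    and r_pos: "0 < r n $ i" and r_dec: "r (Suc n) $ i \<le> r n $ i"
    and r_shrink: "r (Suc n) $ (of_nat n + 1) \<le> (1 - \<eta> / 2) * r n $ (of_nat n + 1)"
    and close: "k \<le> N n \<Longrightarrow> dist ((cmap (\<omega> (Suc n)) (V (Suc n)) ^^ k) (w (Suc n))) ((cmap (\<omega> n) (V n) ^^ k) (w n)) \<le> 1 / 8 / 2 ^ n"
    and small: "N n \<le> k \<Longrightarrow> k \<le> N (Suc n) \<Longrightarrow> cmod ((cmap (\<omega> (Suc n)) (V (Suc n)) ^^ k) (w (Suc n)) $ i) \<le> 2 * r n $ i"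

lemma stages_exist:
  assumes \<alpha>: "\<alpha> > 1" and L: "L > 0" and \<mu>: "\<mu> > 0"
  obtains \<eta> D e \<omega> V r N w where "stages \<alpha> L \<eta> \<mu> D e \<omega> V r N w"
proof -
  obtain \<eta> where \<eta>: "separated \<eta>" using separated_exists by blast
  have \<eta>1: "0 < \<eta>" "\<eta> < 1 / 100" using \<eta> by (auto simp: separated_def)
  define ok where "ok = (\<lambda>n (D, e, \<omega>, V, r, N, w). stage_inv \<eta> (of_nat n) e \<omega> r (grad D) V \<and>
    (cmap \<omega> V ^^ N) w = imag_point r \<and> (n = 0 \<longrightarrow> D = (\<lambda>_ _. 0) \<and> V = (\<lambda>_. 0) \<and> w = imag_point 1))"
  define next_ok where "next_ok = (\<lambda>(n::nat) (D :: (3 \<Rightarrow> nat) \<Rightarrow> real ^ 3 \<Rightarrow> real, e, \<omega>, V, r, N, w) (D', e', \<omega>', V', r', N', w').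
     jet3 D' \<and> jet3_bound \<alpha> L (\<mu> / 2 ^ Suc n) D' \<and> (\<forall>k. D' k 0 = 0) \<and> e + n < (e'::nat) \<and>
     \<omega>' = (\<chi> i. if i = of_nat n + 2 then \<omega> $ i - 1 / 2 ^ e' else \<omega> $ i) \<and> V' = (\<lambda>x. V x + grad D' x) \<and> N < (N'::nat) \<and>
     r' $ (of_nat n + 1) \<le> (1 - \<eta> / 2) * r $ (of_nat n + 1) \<and> (\<forall>i. r' $ i \<le> r $ i) \<and>
     (\<forall>k\<le>N. dist ((cmap \<omega>' V' ^^ k) w') ((cmap \<omega> V ^^ k) w) \<le> 1 / 8 / 2 ^ n) \<and>
     (\<forall>k i. N \<le> k \<longrightarrow> k \<le> N' \<longrightarrow> cmod ((cmap \<omega>' V' ^^ k) w' $ i) \<le> 2 * r $ i))"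
  have "grad (\<lambda>_ _. 0) = (\<lambda>_. 0)" by (simp add: grad_def fun_eq_iff vec_eq_iff)
  then have "ok 0 (\<lambda>_ _. 0, 24, start_freq, \<lambda>_. 0, 1, 0, imag_point 1)"
    using stage_inv_start[OF \<eta>] by (simp add: ok_def)
  then have "\<exists>s. ok 0 s" by blast
  moreover have "\<exists>s'. ok (Suc n) s' \<and> next_ok n s s'" if "ok n s" for n s
  proof -
    obtain D e \<omega> V r N w where s: "s = (D, e, \<omega>, V, r, N, w)" by (cases s)
    have inv: "stage_inv \<eta> (of_nat n) e \<omega> r (grad D) V" and w: "(cmap \<omega> V ^^ N) w = imag_point r"
      using that by (simp_all add: ok_def s)
    have pos: "\<mu> / 2 ^ Suc n > 0" "1 / 8 / 2 ^ n > (0::real)" using \<mu> by auto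
    obtain D' e' \<omega>' r' N' w' where new: "jet3 D'" "jet3_bound \<alpha> L (\<mu> / 2 ^ Suc n) D'" "\<And>k. D' k 0 = 0"
    "e + n < e'" "\<omega>' = (\<chi> i. if i = of_nat n + 2 then \<omega> $ i - 1 / 2 ^ e' else \<omega> $ i)"
    "stage_inv \<eta> (of_nat n + 1) e' \<omega>' r' (grad D') (\<lambda>x. V x + grad D' x)"
    "(cmap \<omega>' (\<lambda>x. V x + grad D' x) ^^ N') w' = imag_point r'" "N < N'"
    "r' $ (of_nat n + 1) \<le> (1 - \<eta> / 2) * r $ (of_nat n + 1)" "\<And>i. r' $ i \<le> r $ i"
    "\<And>k. k \<le> N \<Longrightarrow> dist ((cmap \<omega>' (\<lambda>x. V x + grad D' x) ^^ k) w') ((cmap \<omega> V ^^ k) w) \<le> 1 / 8 / 2 ^ n"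
    "\<And>k i. N \<le> k \<Longrightarrow> k \<le> N' \<Longrightarrow> cmod ((cmap \<omega>' (\<lambda>x. V x + grad D' x) ^^ k) w' $ i) \<le> 2 * r $ i"
      by (rule stage_step[OF \<alpha> L \<eta> pos inv w, of n]) (rule that, assumption+)
    have "ok (Suc n) (D', e', \<omega>', (\<lambda>x. V x + grad D' x), r', N', w')"
      using new(6,7) by (simp add: ok_def add.commute)
    moreover have "next_ok n s (D', e', \<omega>', (\<lambda>x. V x + grad D' x), r', N', w')"
      unfolding s next_ok_def prod.case using new(1-5,8-12) by blast
    ultimately show ?thesis by blast
  qed
  ultimately obtain f where f: "\<And>n. ok n (f n)" "\<And>n. next_ok n (f n) (f (Suc n))"
    using dependent_nat_choice[of ok next_ok] by blast
  define D where "D n = fst (f n)" for n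
  define e where "e n = fst (snd (f n))" for n
  define \<omega> where "\<omega> n = fst (snd (snd (f n)))" for n
  define V where "V n = fst (snd (snd (snd (f n))))" for n
  define r where "r n = fst (snd (snd (snd (snd (f n)))))" for n
  define N where "N n = fst (snd (snd (snd (snd (snd (f n))))))" for n
  define w where "w n = snd (snd (snd (snd (snd (snd (f n))))))" for n
  have fn: "f n = (D n, e n, \<omega> n, V n, r n, N n, w n)" for n
    by (simp add: D_def e_def \<omega>_def V_def r_def N_def w_def)
  have ok: "stage_inv \<eta> (of_nat n) (e n) (\<omega> n) (r n) (grad (D n)) (V n)"
    "n = 0 \<Longrightarrow> D n = (\<lambda>_ _. 0) \<and> V n = (\<lambda>_. 0) \<and> w n = imag_point 1" for n
    using f(1)[of n] by (simp_all add: fn ok_def)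
  note nxt = f(2)[unfolded fn next_ok_def prod.case]
  have fq: "freq_ok (of_nat n) (e n) (\<omega> n)" "0 < r n $ i" for n i
    using ok(1)[of n] unfolding stage_inv_def by blast+
  have "stages \<alpha> L \<eta> \<mu> D e \<omega> V r N w"
  proof
    show "real (cycle (e n)) * \<omega> n $ i \<in> \<int>" for n i by (rule freq_ok_periodic[OF fq(1)])
    show "0 < r n $ i" for n i by (rule fq)
    show "0 < \<eta>" "\<eta> < 1" "L > 0" "\<mu> > 0" using \<eta>1 L \<mu> by auto
    show "V 0 = (\<lambda>_. 0)" "D 0 = (\<lambda>_ _. 0)" "w 0 = imag_point 1" using ok(2)[of 0] by auto
  qed (use nxt in \<open>blast+\<close>)
  then show ?thesis by (rule that)
qed

section \<open>Passage to the limit\<close>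

context stages begin

definition P :: "(3 \<Rightarrow> nat) \<Rightarrow> real ^ 3 \<Rightarrow> real" where
  "P = (\<lambda>k x. \<Sum>n. D n k x)"

definition \<omega>_lim :: "real ^ 3" where "\<omega>_lim = (\<chi> i. lim (\<lambda>n. \<omega> n $ i))"

lemma jet_all: "jet3 (D n)" "jet3_bound \<alpha> L (\<mu> / 2 ^ n) (D n)" "D n k 0 = 0"
proof -
  show "jet3 (D n)" using jet by (cases n) (auto simp: D0 jet3_def)
  have "0 \<le> (\<Prod>j\<in>UNIV. gweight \<alpha> L (k j))" for k :: "3 \<Rightarrow> nat"
    using L by (intro prod_nonneg) (auto intro: less_imp_le gweight_pos)
  then show "jet3_bound \<alpha> L (\<mu> / 2 ^ n) (D n)" using bound \<mu> by (cases n) (auto simp: D0 jet3_bound_def)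
  show "D n k 0 = 0" using flat by (cases n) (auto simp: D0)
qed

lemma jet3_P: "jet3 P" "jet3_bound \<alpha> L (2 * \<mu>) P" "P k 0 = 0"
  using jet3_series(2,3)[OF L \<mu> jet_all(1,2)] by (simp_all add: P_def jet_all)

lemma V_sum: "V n x $ i = (\<Sum>j\<le>n. D j (inc i (\<lambda>_. 0)) x)"
  by (induction n) (simp_all add: V0 D0 V grad_def)

lemma V_tendsto: "(\<lambda>n. V n x $ i) \<longlonglongrightarrow> grad P x $ i"
  using jet3_series(1)[OF L \<mu> jet_all(1,2), of i "\<lambda>_. 0" x]
  by (simp add: V_sum sums_def_le grad_def P_def)

lemma V_uniform: "\<bar>V n x $ i - grad P x $ i\<bar> \<le> \<mu> / 2 ^ n"
proof -
  have "\<bar>V n x $ i - V (n + m) x $ i\<bar> \<le> \<mu> / 2 ^ n - \<mu> / 2 ^ (n + m)" for m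
  proof (induction m)
    case (Suc m)
    have "\<bar>V (n + Suc m) x $ i - V (n + m) x $ i\<bar> \<le> \<mu> / 2 ^ Suc (n + m)"
      using grad_bound[OF bound L, of "n + m" x i] by (simp add: V)
    also have "\<dots> = \<mu> / 2 ^ (n + m) - \<mu> / 2 ^ (n + Suc m)" by (simp add: field_simps)
    finally show ?case using Suc by linarith
  qed simp
  moreover have "\<mu> / 2 ^ (n + m) \<ge> 0" for m using \<mu> by simp
  ultimately have "\<bar>V n x $ i - V (n + m) x $ i\<bar> \<le> \<mu> / 2 ^ n" for m
    by (meson diff_le_eq le_add_same_cancel1 order_trans)
  moreover have "(\<lambda>m. \<bar>V n x $ i - V (n + m) x $ i\<bar>) \<longlonglongrightarrow> \<bar>V n x $ i - grad P x $ i\<bar>"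
    using LIMSEQ_ignore_initial_segment[OF V_tendsto, of n x i]
    by (intro tendsto_rabs tendsto_diff tendsto_const) (simp add: add.commute)
  ultimately show ?thesis by (intro LIMSEQ_le_const2) auto
qed

lemma e_mono: "e n < e (Suc n)" using e[of n] by simp

lemma \<omega>_tail: "\<bar>\<omega> (n + m) $ i - \<omega> n $ i\<bar> \<le> 2 / 2 ^ e (Suc n) - 2 / 2 ^ e (Suc (n + m))"
proof (induction m)
  case (Suc m)
  have "(2::real) * 2 ^ e (Suc (n + m)) \<le> 2 ^ e (Suc (n + Suc m))"
    unfolding power_Suc[symmetric] using e_mono[of "Suc (n + m)"] by (intro power_increasing) auto
  then have "2 / (2::real) ^ e (Suc (n + Suc m)) \<le> 2 / (2 * 2 ^ e (Suc (n + m)))" by (intro divide_left_mono) auto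
  moreover have "\<bar>\<omega> (n + Suc m) $ i - \<omega> (n + m) $ i\<bar> \<le> 1 / 2 ^ e (Suc (n + m))" by (simp add: \<omega>)
  moreover have "2 / (2 * 2 ^ e (Suc (n + m))) = 1 / (2::real) ^ e (Suc (n + m))"
     "2 / 2 ^ e (Suc (n + m)) = 2 * (1 / (2::real) ^ e (Suc (n + m)))" by auto
  ultimately show ?case using Suc by linarith
qed simp

lemma \<omega>_tendsto: "(\<lambda>n. \<omega> n $ i) \<longlonglongrightarrow> \<omega>_lim $ i"
proof -
  have "decseq (\<lambda>n. \<omega> n $ i)" by (intro decseq_SucI) (simp add: \<omega>)
  moreover have "\<omega> 0 $ i - 2 \<le> \<omega> n $ i" for n
  proof -
    have "2 / (2::real) ^ e (Suc 0) \<le> 2 / 1" by (intro divide_left_mono) auto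
    moreover have "0 \<le> 2 / (2::real) ^ e (Suc n)" by simp
    ultimately show ?thesis using \<omega>_tail[of 0 n i] unfolding add_0 by linarith
  qed
  ultimately obtain l where "(\<lambda>n. \<omega> n $ i) \<longlonglongrightarrow> l" by (metis decseq_convergent)
  then show ?thesis by (simp add: \<omega>_lim_def limI)
qed

lemma \<omega>_close: "\<bar>\<omega>_lim $ i - \<omega> n $ i\<bar> \<le> 2 / 2 ^ e (Suc n)"
proof -
  have "\<bar>\<omega> (n + m) $ i - \<omega> n $ i\<bar> \<le> 2 / 2 ^ e (Suc n)" for m
    using \<omega>_tail[of n m i] by (meson diff_le_eq le_add_same_cancel1 order_trans zero_le_divide_iff zero_le_numeral zero_le_power)
  moreover have "(\<lambda>m. \<bar>\<omega> (n + m) $ i - \<omega> n $ i\<bar>) \<longlonglongrightarrow> \<bar>\<omega>_lim $ i - \<omega> n $ i\<bar>"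
    using LIMSEQ_ignore_initial_segment[OF \<omega>_tendsto, of n i]
    by (intro tendsto_rabs tendsto_diff tendsto_const) (simp add: add.commute)
  ultimately show ?thesis by (intro LIMSEQ_le_const2) auto
qed

text \<open>
  Suppose that an integer combination \<open>X\<close> of the limit frequencies is an integer. At stage \<open>n\<close> the same
  combination is a multiple of \<open>1 / (1989 * 2 ^ e n)\<close>, and it differs from the limit by
  \<open>O (1 / 2 ^ e (Suc n))\<close>, which is much smaller. So it is eventually constant; but each step changes it by a
  multiple of the coefficient of the gate plane, and every plane is the gate in every third step.
\<close>

lemma non_resonant_limit: "non_resonant \<omega>_lim"
  unfolding non_resonant_def
proof (intro allI impI notI)
  fix k :: "int ^ 3"
  assume k: "k \<noteq> 0" and "(\<chi> i. real_of_int (k $ i)) \<bullet> \<omega>_lim \<in> \<int>"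
  define X where "X \<theta> = (\<Sum>i\<in>UNIV. real_of_int (k $ i) * \<theta> $ i)" for \<theta> :: "real ^ 3"
  have int: "X \<omega>_lim \<in> \<int>" using \<open>_ \<in> \<int>\<close> by (simp add: X_def inner_vec_def)
  define K where "K = (\<Sum>i\<in>UNIV. \<bar>real_of_int (k $ i)\<bar>)"
  obtain n0 where n0: "1989 * (2 * K) < 2 ^ n0" using real_arch_pow[of 2] by auto
  have eq: "X (\<omega> n) = X \<omega>_lim" if n: "n0 \<le> n" for n
  proof -
    have "real (cycle (e n)) * X (\<omega> n) = (\<Sum>i\<in>UNIV. of_int (k $ i) * (real (cycle (e n)) * \<omega> n $ i))"
      by (simp add: X_def sum_distrib_left algebra_simps)
    then have "real (cycle (e n)) * X (\<omega> n) \<in> \<int>" using period by (simp add: Ints_sum Ints_mult)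
    then have I: "real (cycle (e n)) * (X \<omega>_lim - X (\<omega> n)) \<in> \<int>"
      using int by (simp add: right_diff_distrib Ints_mult Ints_diff)
    have "\<bar>X \<omega>_lim - X (\<omega> n)\<bar> = \<bar>\<Sum>i\<in>UNIV. of_int (k $ i) * (\<omega>_lim $ i - \<omega> n $ i)\<bar>"
      by (simp add: X_def sum_subtractf algebra_simps)
    also have "\<dots> \<le> (\<Sum>i\<in>UNIV. \<bar>of_int (k $ i) * (\<omega>_lim $ i - \<omega> n $ i)\<bar>)" by (rule sum_abs)
    also have "\<dots> \<le> (\<Sum>i\<in>UNIV. \<bar>real_of_int (k $ i)\<bar> * (2 / 2 ^ e (Suc n)))"
      unfolding abs_mult by (intro sum_mono mult_left_mono \<omega>_close) auto
    also have "\<dots> = 2 * K / 2 ^ e (Suc n)" by (simp add: K_def sum_distrib_right sum_divide_distrib sum_distrib_left mult.commute)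
    finally have "\<bar>real (cycle (e n)) * (X \<omega>_lim - X (\<omega> n))\<bar> \<le> real (cycle (e n)) * (2 * K / 2 ^ e (Suc n))"
      unfolding abs_mult abs_of_nat by (rule mult_left_mono) simp
    also have "\<dots> = 1989 * (2 * K) * (2 ^ e n / 2 ^ e (Suc n))" by (simp add: cycle_def)
    also have "\<dots> < 1"
    proof -
      have "1989 * (2 * K) * 2 ^ e n < 2 ^ n0 * 2 ^ e n" using n0 by simp
      also have "(2::real) ^ n0 * 2 ^ e n \<le> 2 ^ e (Suc n)"
        unfolding power_add[symmetric] using e[of n] n by (intro power_increasing) auto
      finally show ?thesis by simp
    qed
    finally have "real (cycle (e n)) * (X \<omega>_lim - X (\<omega> n)) = 0" using I by (metis Ints_nonzero_abs_less1)
    then show ?thesis by (simp add: cycle_def)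
  qed
  have zero: "k $ (of_nat n + 2) = 0" if "n0 \<le> n" for n
  proof -
    have "X (\<omega> n) - X (\<omega> (Suc n)) = (\<Sum>i\<in>UNIV. of_int (k $ i) * (\<omega> n $ i - \<omega> (Suc n) $ i))"
      by (simp add: X_def sum_subtractf algebra_simps)
    also have "\<dots> = (\<Sum>i\<in>UNIV. if i = of_nat n + 2 then of_int (k $ i) * (1 / 2 ^ e (Suc n)) else 0)"
      by (intro sum.cong) (auto simp: \<omega>)
    also have "\<dots> = of_int (k $ (of_nat n + 2)) * (1 / 2 ^ e (Suc n))" by simp
    finally show ?thesis using eq[of n] eq[of "Suc n"] that by simp
  qed
  have "k $ i = 0" for i
  proof -
    have z: "(3::3) = 0" using add_right_imp_eq[of "3::3" 1 0] by simp
    have ex: "of_nat (n0 * 3) + 2 = (2::3)" "of_nat (n0 * 3 + 1) + 2 = (3::3)" "of_nat (n0 * 3 + 2) + 2 = (1::3)"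
      unfolding of_nat_add of_nat_mult of_nat_numeral of_nat_1 z mult_zero_right by simp_all
    show ?thesis using zero[of "n0 * 3"] zero[of "n0 * 3 + 1"] zero[of "n0 * 3 + 2"] three_cases[of i]
      unfolding ex by auto
  qed
  then show False using k by (simp add: vec_eq_iff)
qed

lemma N_ge: "n \<le> N n"
proof (induction n)
  case (Suc n)
  then show ?case using N[of n] by simp
qed simp

abbreviation "orb n k \<equiv> (cmap (\<omega> n) (V n) ^^ k) (w n)"

lemma orb_close: "k \<le> N n \<Longrightarrow> dist (orb (n + m) k) (orb n k) \<le> 1 / 4 / 2 ^ n - 1 / 4 / 2 ^ (n + m)"
proof (induction m)
  case (Suc m)
  have "N n \<le> N (n + m)" by (rule lift_Suc_mono_le[of N, OF less_imp_le[OF N]]) simp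
  then have "dist (orb (n + Suc m) k) (orb (n + m) k) \<le> 1 / 8 / 2 ^ (n + m)" using close[of k "n + m"] Suc.prems by simp
  also have "\<dots> = 1 / 4 / 2 ^ (n + m) - 1 / 4 / 2 ^ (n + Suc m)" by (simp add: field_simps)
  finally show ?case using Suc dist_triangle[of "orb (n + Suc m) k" "orb n k" "orb (n + m) k"] by linarith
qed simp

definition w_lim :: "complex ^ 3" where "w_lim = lim w"

lemma w_tendsto: "w \<longlonglongrightarrow> w_lim"
proof -
  have "Cauchy w"
  proof (rule CauchyI')
    fix \<epsilon> :: real assume "\<epsilon> > 0"
    then obtain n0 where n0: "(1/2) ^ n0 < \<epsilon>" using real_arch_pow_inv[of \<epsilon> "1/2"] by auto
    show "\<exists>M. \<forall>m\<ge>M. \<forall>n>m. dist (w m) (w n) < \<epsilon>"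
    proof (intro exI allI impI)
      fix m n assume mn: "n0 \<le> m" "m < n"
      have "dist (w n) (w m) \<le> 1 / 4 / 2 ^ m - 1 / 4 / 2 ^ n" using orb_close[of 0 m "n - m"] mn by simp
      moreover have "0 \<le> 1 / 4 / (2::real) ^ n" by simp
      moreover have "1 / 4 / (2::real) ^ m \<le> 1 / 2 ^ m" by (simp add: field_simps)
      moreover have "1 / (2::real) ^ m \<le> 1 / 2 ^ n0" using mn by (intro divide_left_mono power_increasing) auto
      ultimately show "dist (w m) (w n) < \<epsilon>" using n0 unfolding dist_commute[of "w n"] power_one_over by linarith
    qed
  qed
  then show ?thesis by (simp add: w_lim_def Cauchy_convergent convergent_LIMSEQ_iff[symmetric])
qed

lemma cmap_tendsto:
  assumes "y \<longlonglongrightarrow> z" shows "(\<lambda>n. cmap (\<omega> n) (V n) (y n)) \<longlonglongrightarrow> cmap \<omega>_lim (grad P) z"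
proof (rule vec_tendstoI)
  fix i
  have yi: "(\<lambda>n. y n $ j) \<longlonglongrightarrow> z $ j" for j by (rule tendsto_vec_nth[OF assms])
  have c: "(\<lambda>n. cis (2 * pi * \<omega> n $ j)) \<longlonglongrightarrow> cis (2 * pi * \<omega>_lim $ j)" for j
    unfolding cis_conv_exp by (intro tendsto_intros \<omega>_tendsto)
  define x where "x = (\<lambda>n. \<chi> j. Re (y n $ j * cis (2 * pi * \<omega> n $ j)))"
  define x0 where "x0 = (\<chi> j. Re (z $ j * cis (2 * pi * \<omega>_lim $ j)))"
  have x: "x \<longlonglongrightarrow> x0" unfolding x_def x0_def by (intro vec_tendstoI) (simp only: vec_lambda_beta, intro tendsto_intros yi c)
  have "isCont (grad P) x0" using continuous_grad[OF jet3_P(1)] by (simp add: continuous_on_eq_continuous_at)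
  then have G: "(\<lambda>n. grad P (x n) $ i) \<longlonglongrightarrow> grad P x0 $ i" by (intro tendsto_vec_nth isCont_tendsto_compose[OF _ x])
  have "(\<lambda>n. V n (x n) $ i - grad P (x n) $ i) \<longlonglongrightarrow> 0"
  proof (rule Lim_null_comparison)
    show "\<forall>\<^sub>F n in sequentially. norm (V n (x n) $ i - grad P (x n) $ i) \<le> \<mu> * (1/2) ^ n"
      using V_uniform by (auto simp: power_one_over field_simps)
    show "(\<lambda>n. \<mu> * (1/2) ^ n) \<longlonglongrightarrow> 0" by (intro tendsto_mult_right_zero LIMSEQ_power_zero) simp
  qed
  from tendsto_add[OF this G] have "(\<lambda>n. V n (x n) $ i) \<longlonglongrightarrow> grad P x0 $ i" by simp
  then have "(\<lambda>n. y n $ i * cis (2 * pi * \<omega> n $ i) - \<i> * V n (x n) $ i) \<longlonglongrightarrow> z $ i * cis (2 * pi * \<omega>_lim $ i) - \<i> * grad P x0 $ i"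
    by (intro tendsto_diff tendsto_mult tendsto_of_real tendsto_const yi c)
  then show "(\<lambda>n. cmap (\<omega> n) (V n) (y n) $ i) \<longlonglongrightarrow> cmap \<omega>_lim (grad P) z $ i"
    by (simp add: cmap_def x_def x0_def)
qed

abbreviation "orb_lim k \<equiv> (cmap \<omega>_lim (grad P) ^^ k) w_lim"

lemma orb_tendsto: "(\<lambda>n. orb n k) \<longlonglongrightarrow> orb_lim k"
  by (induction k) (auto intro: w_tendsto cmap_tendsto)

lemma orb_lim_close: "k \<le> N n \<Longrightarrow> dist (orb_lim k) (orb n k) \<le> 1 / 4 / 2 ^ n"
proof -
  assume k: "k \<le> N n"
  have "dist (orb (n + m) k) (orb n k) \<le> 1 / 4 / 2 ^ n" for m
  proof -
    have "0 \<le> 1 / 4 / (2::real) ^ (n + m)" by simp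
    then show ?thesis using orb_close[OF k, of m] by linarith
  qed
  moreover have "(\<lambda>m. dist (orb (n + m) k) (orb n k)) \<longlonglongrightarrow> dist (orb_lim k) (orb n k)"
    using LIMSEQ_ignore_initial_segment[OF orb_tendsto[of k], of n]
    by (intro tendsto_dist tendsto_const) (simp add: add.commute)
  ultimately show ?thesis by (intro LIMSEQ_le_const2) auto
qed

lemma w_lim_nonzero: "w_lim \<noteq> 0"
proof
  assume "w_lim = 0"
  then have "norm (w 0) \<le> 1 / 4" using orb_lim_close[of 0 0] by simp
  moreover have "norm (w 0 $ 1) \<le> norm (w 0)" by (rule Finite_Cartesian_Product.norm_nth_le)
  ultimately show False by (simp add: w0 imag_point_def)
qed

text \<open>
  Three consecutive stages push each plane once.
\<close>

lemma r_tendsto: "(\<lambda>n. r n $ i) \<longlonglongrightarrow> 0"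
proof -
  have dec: "decseq (\<lambda>n. r n $ i)" by (intro decseq_SucI r_dec)
  then obtain l where l: "(\<lambda>n. r n $ i) \<longlonglongrightarrow> l" using r_pos less_imp_le by (metis decseq_convergent)
  have step: "r (n + 3) $ i \<le> (1 - \<eta> / 2) * r n $ i" for n
  proof -
    \<comment> \<open>The stage \<open>n + j\<close> pushes plane \<open>i\<close>.\<close>
    obtain j where j: "j < 3" "i = of_nat (n + j) + 1"
    proof -
      have "(of_nat n :: 3) = 1 \<or> (of_nat n :: 3) = 2 \<or> (of_nat n :: 3) = 3" by (rule three_cases)
      then show ?thesis using that[of 0] that[of 1] that[of 2] three_cases[of i] by auto
    qed
    have "r (n + 3) $ i \<le> r (Suc (n + j)) $ i" using j by (intro decseqD[OF dec]) simp
    also have "\<dots> \<le> (1 - \<eta> / 2) * r (n + j) $ i" using r_shrink[of "n + j"] j by simp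
    also have "\<dots> \<le> (1 - \<eta> / 2) * r n $ i" using \<eta> by (intro mult_left_mono decseqD[OF dec]) auto
    finally show ?thesis .
  qed
  have "l \<le> (1 - \<eta> / 2) * l"
    by (rule LIMSEQ_le[OF LIMSEQ_ignore_initial_segment[OF l, of 3] tendsto_mult_left[OF l]]) (use step in auto)
  then have "\<eta> * l \<le> 0" by (simp add: algebra_simps)
  moreover have "0 \<le> l" using l r_pos by (intro LIMSEQ_le_const) (auto intro: less_imp_le)
  ultimately have "l = 0" using \<eta> by (simp add: mult_le_0_iff)
  then show ?thesis using l by simp
qed

text \<open>
  Between the times \<open>N n\<close> and \<open>N (Suc n)\<close> the limit orbit is close to the orbit of stage \<open>Suc n\<close>, which is
  bounded by the radii of stage \<open>n\<close>.
\<close>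

lemma orb_lim_tendsto_zero: "orb_lim \<longlonglongrightarrow> 0"
proof (rule LIMSEQ_I)
  fix \<epsilon> :: real assume "\<epsilon> > 0"
  define b where "b n = (\<Sum>i\<in>(UNIV :: 3 set). 2 * r n $ i) + 1 / 4 * (1/2) ^ Suc n" for n
  have "b \<longlonglongrightarrow> (\<Sum>i\<in>(UNIV :: 3 set). 2 * 0) + 1 / 4 * 0"
    unfolding b_def by (intro tendsto_add tendsto_sum tendsto_mult_left r_tendsto LIMSEQ_Suc LIMSEQ_power_zero) simp
  then have b0: "b \<longlonglongrightarrow> 0" by simp
  obtain n0 where n0: "\<And>n. n0 \<le> n \<Longrightarrow> b n < \<epsilon>"
    using order_tendstoD(2)[OF b0 \<open>\<epsilon> > 0\<close>] unfolding eventually_sequentially by blast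
  have "norm (orb_lim k) < \<epsilon>" if k: "N n0 \<le> k" for k
  proof -
    have "N n0 \<le> k \<Longrightarrow> k < N (n0 + m) \<Longrightarrow> \<exists>n\<ge>n0. N n \<le> k \<and> k \<le> N (Suc n)" for m
    proof (induction m)
      case (Suc m)
      then show ?case by (cases "k < N (n0 + m)") (auto intro!: exI[of _ "n0 + m"])
    qed simp
    moreover have "k < N (n0 + Suc k)" using N_ge[of "n0 + Suc k"] by linarith
    ultimately obtain n where n: "n \<ge> n0" "N n \<le> k" "k \<le> N (Suc n)" using k by blast
    have "norm (orb (Suc n) k) \<le> (\<Sum>i\<in>UNIV. cmod (orb (Suc n) k $ i))"
      unfolding norm_vec_def by (rule L2_set_le_sum) simp
    also have "\<dots> \<le> (\<Sum>i\<in>UNIV. 2 * r n $ i)" by (intro sum_mono small n)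
    finally have "norm (orb (Suc n) k) \<le> (\<Sum>i\<in>UNIV. 2 * r n $ i)" .
    moreover have "dist (orb_lim k) (orb (Suc n) k) \<le> 1 / 4 * (1/2) ^ Suc n"
      using orb_lim_close[OF n(3)] by (simp add: power_one_over)
    moreover have "norm (orb_lim k) \<le> norm (orb (Suc n) k) + dist (orb_lim k) (orb (Suc n) k)"
      unfolding dist_norm by (metis add.commute norm_triangle_sub)
    ultimately show ?thesis using n0[OF n(1)] unfolding b_def by linarith
  qed
  then show "\<exists>no. \<forall>k\<ge>no. norm (orb_lim k - 0) < \<epsilon>" by auto
qed

end

section \<open>Return to the phase space\<close>

definition to_phase :: "complex ^ 3 \<Rightarrow> phase" where
  "to_phase z = (\<chi> i. vector [Re (z $ i), Im (z $ i)])"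

lemma shear_to_phase:
  "(shear (-1) P \<circ> product_rotation \<omega>) (to_phase z) = to_phase (cmap \<omega> (grad P) z)"
proof -
  have rot: "product_rotation \<omega> (to_phase z) = to_phase (\<chi> i. z $ i * cis (2 * pi * \<omega> $ i))"
    by (simp add: product_rotation_def to_phase_def rotation_def vec_eq_iff algebra_simps)
  have pos: "positions (to_phase y) = (\<chi> j. Re (y $ j))" for y by (simp add: positions_def to_phase_def)
  show ?thesis
    unfolding comp_def rot shear_def shift_def pos
    by (simp add: to_phase_def cmap_def grad_def vec_eq_iff forall_2)
qed

lemma to_phase_iterate:
  "((shear (-1) P \<circ> product_rotation \<omega>) ^^ n) (to_phase z) = to_phase ((cmap \<omega> (grad P) ^^ n) z)"
  by (induction n) (simp_all add: shear_to_phase[unfolded comp_def])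

theorem theorem1:
  fixes \<alpha> L \<gamma> :: real
  assumes "\<alpha> > 1" and "L > 0" and "\<gamma> > 0"
  shows "\<exists>(\<omega> :: real ^ 3) (z :: phase) (\<Psi> :: phase \<Rightarrow> phase).
           non_resonant \<omega> \<and> z \<noteq> 0 \<and> \<Psi> \<in> gevrey_symplectic \<alpha> L \<and>
           gevrey_norm_vec \<alpha> L (\<lambda>s. \<Psi> s - s) \<le> ennreal \<gamma> \<and>
           (\<lambda>n. ((\<Psi> \<circ> product_rotation \<omega>) ^^ n) z) \<longlonglongrightarrow> 0"
proof -
  define \<mu> where "\<mu> = \<gamma> / 96"
  have \<mu>: "\<mu> > 0" using assms(3) by (simp add: \<mu>_def)
  obtain \<eta> D e \<omega> V r N w where "stages \<alpha> L \<eta> \<mu> D e \<omega> V r N w" using stages_exist[OF assms(1,2) \<mu>] by metis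
  then interpret stages \<alpha> L \<eta> \<mu> D e \<omega> V r N w .
  have \<Psi>: "shear (-1) P \<in> gevrey_symplectic \<alpha> L"
    "gevrey_norm_vec \<alpha> L (\<lambda>s. shear (-1) P s - s) \<le> ennreal (48 * (2 * \<mu>))"
    using shear_in_gevrey_symplectic[OF jet3_P(1,2) assms(2), of "-1"] \<mu> jet3_P(3) by auto
  have "to_phase w_lim \<noteq> 0"
  proof
    assume "to_phase w_lim = 0"
    then have "Re (w_lim $ i) = 0 \<and> Im (w_lim $ i) = 0" for i
      by (auto simp: to_phase_def vec_eq_iff forall_2)
    then show False using w_lim_nonzero by (simp add: vec_eq_iff complex_eq_iff)
  qed
  moreover have "(\<lambda>n. ((shear (-1) P \<circ> product_rotation \<omega>_lim) ^^ n) (to_phase w_lim)) \<longlonglongrightarrow> 0"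
    unfolding to_phase_iterate
  proof (intro vec_tendstoI)
    fix i :: 3 and j :: 2
    have c: "(\<lambda>n. orb_lim n $ i) \<longlonglongrightarrow> 0" using tendsto_vec_nth[OF orb_lim_tendsto_zero, of i] by simp
    show "(\<lambda>n. to_phase (orb_lim n) $ i $ j) \<longlonglongrightarrow> 0 $ i $ j"
      using tendsto_Re[OF c] tendsto_Im[OF c] exhaust_2[of j] by (auto simp: to_phase_def)
  qed
  moreover have "48 * (2 * \<mu>) = \<gamma>" by (simp add: \<mu>_def)
  ultimately show ?thesis using \<Psi> non_resonant_limit
    by (intro exI[of _ \<omega>_lim] exI[of _ "to_phase w_lim"] exI[of _ "shear (-1) P"] conjI) simp_all
qed

end
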